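(* For any positive integer $n$: the square torus graph $T\bigl(2(2n^2 + 2n + 1),\, 2(2n^2 + 2n + 1)\bigr)$ has a locked $(2n^2 + 2n + 1)$-omino tiling; likewise, the infinite square grid lattice has a locked $(2n^2 + 2n + 1)$-omino tiling; and the infinite triangular lattice has a locked $((n + 1)(n + 2) + 1)$-omino tiling.
   Context: The infinite square grid lattice is the graph on vertex set $\mathbb{Z} \times \mathbb{Z}$ in which two vertices are adjacent exactly when they are horizontal or vertical neighbors (at Euclidean distance $1$). The infinite triangular lattice is the graph obtained from the infinite square grid lattice by adding a diagonal to every unit square, all in the same direction (i.e., additionally joining $(x,y)$ to $(x+1,y+1)$ for all $x,y$). $G(a,b)$ denotes the $a \times b$ grid graph (cells of an $a \times b$ array, adjacent when horizontal or vertical neighbors), and the torus graph $T(a,b)$ is $G(a,b)$ with additional edges connecting each vertex on the left border to the corresponding vertex on the right border in the same row, and each vertex on the top border to the corresponding vertex on the bottom border in the same column. For a (finite or infinite) graph $G$ and a positive integer $t$, the metagraph $\mathcal{M}(G,t)$ is the graph whose vertices are the (unordered) partitions of the vertex set of $G$ into parts, each containing exactly $t$ vertices and inducing a connected subgraph of $G$; two distinct partitions are joined by an edge whenever they differ only on two parts (i.e., one is obtained from the other by replacing two parts by two other parts with the same union, all other parts being unchanged). A locked $t$-omino tiling of $G$ is an isolated vertex of $\mathcal{M}(G,t)$ that is not the only vertex of $\mathcal{M}(G,t)$. *)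

theory Defs
  imports "Graph_Theory.Graph_Theory" "HOL-Library.Disjoint_Sets"
begin

text \<open>
  As usual for Graph_Theory, an undirected simple graph is a symmetric loop-free digraph without
  parallel arcs; an edge is a pair of opposite arcs. Vertex sets may be infinite.
\<close>

definition square_lattice :: "(int \<times> int) pair_pre_digraph" where
  "square_lattice =
    \<lparr> pverts = UNIV,
      parcs = {((x, y), (x', y')). \<bar>x - x'\<bar> + \<bar>y - y'\<bar> = 1} \<rparr>"

definition triangular_lattice :: "(int \<times> int) pair_pre_digraph" where
  "triangular_lattice =
    \<lparr> pverts = pverts square_lattice,
      parcs = parcs square_lattice
        \<union> {((x, y), (x + 1, y + 1)) | x y. True}
        \<union> {((x + 1, y + 1), (x, y)) | x y. True} \<rparr>"

text \<open>The cell in row \<open>i\<close> and column \<open>j\<close> of the \<open>a\<close> by \<open>b\<close> array is \<open>(i, j)\<close>, counted from 0.\<close>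

definition grid_graph :: "nat \<Rightarrow> nat \<Rightarrow> (int \<times> int) pair_pre_digraph" where
  "grid_graph a b =
    (let V = {0..<int a} \<times> {0..<int b} in
      \<lparr> pverts = V, parcs = parcs square_lattice \<inter> (V \<times> V) \<rparr>)"

definition wrap_pairs :: "nat \<Rightarrow> nat \<Rightarrow> (int \<times> int) rel" where
  "wrap_pairs a b =
    {((i, 0), (i, int b - 1)) | i. 0 \<le> i \<and> i < int a}
    \<union> {((0, j), (int a - 1, j)) | j. 0 \<le> j \<and> j < int b}"

text \<open>
  Subtracting the identity removes the loops that a side of length 1 would produce, so that the
  torus graph is simple for all side lengths.
\<close>

definition torus_graph :: "nat \<Rightarrow> nat \<Rightarrow> (int \<times> int) pair_pre_digraph" where
  "torus_graph a b =
    \<lparr> pverts = pverts (grid_graph a b),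
      parcs = parcs (grid_graph a b)
        \<union> ((wrap_pairs a b \<union> (wrap_pairs a b)\<inverse>) - Id) \<rparr>"

definition omino_tiling :: "'a pair_pre_digraph \<Rightarrow> nat \<Rightarrow> 'a set set \<Rightarrow> bool" where
  "omino_tiling G t P \<longleftrightarrow>
    partition_on (pverts G) P \<and>
    (\<forall>A\<in>P. finite A \<and> card A = t \<and> Digraph_Component.connected (with_proj G \<restriction> A))"

definition metagraph :: "'a pair_pre_digraph \<Rightarrow> nat \<Rightarrow> 'a set set pair_pre_digraph" where
  "metagraph G t =
    \<lparr> pverts = {P. omino_tiling G t P},
      parcs = {(P, Q). omino_tiling G t P \<and> omino_tiling G t Q \<and> P \<noteq> Q \<and>
        (\<exists>A\<in>P. \<exists>B\<in>P. \<exists>C\<in>Q. \<exists>D\<in>Q. A \<noteq> B \<and> C \<noteq> D \<and>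
          A \<union> B = C \<union> D \<and> P - {A, B} = Q - {C, D})} \<rparr>"

definition isolated_vertex :: "'a pair_pre_digraph \<Rightarrow> 'a \<Rightarrow> bool" where
  "isolated_vertex G v \<longleftrightarrow>
    v \<in> pverts G \<and> (\<forall>w. (v, w) \<notin> parcs G \<and> (w, v) \<notin> parcs G)"

definition locked_tiling :: "'a pair_pre_digraph \<Rightarrow> nat \<Rightarrow> 'a set set \<Rightarrow> bool" where
  "locked_tiling G t P \<longleftrightarrow>
    isolated_vertex (metagraph G t) P \<and> pverts (metagraph G t) \<noteq> {P}"

lemma pair_bidirected_digraphI:
  assumes "parcs G \<subseteq> pverts G \<times> pverts G" "sym (parcs G)" "irrefl (parcs G)"
  shows "pair_bidirected_digraph G"
  using assms
  by unfold_locales (auto simp: symmetric_def irrefl_def)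

lemma bidirected_square_lattice: "pair_bidirected_digraph square_lattice"
  by (rule pair_bidirected_digraphI) (auto simp: square_lattice_def sym_def irrefl_def)

lemma bidirected_triangular_lattice: "pair_bidirected_digraph triangular_lattice"
  by (rule pair_bidirected_digraphI)
    (auto simp: triangular_lattice_def square_lattice_def sym_def irrefl_def)

lemma bidirected_torus_graph:
  assumes "a > 0" "b > 0"
  shows "pair_bidirected_digraph (torus_graph a b)"
proof (rule pair_bidirected_digraphI)
  show "parcs (torus_graph a b) \<subseteq> pverts (torus_graph a b) \<times> pverts (torus_graph a b)"
    using assms by (auto simp: torus_graph_def grid_graph_def wrap_pairs_def Let_def)
  show "sym (parcs (torus_graph a b))"
    unfolding torus_graph_def grid_graph_def square_lattice_def
    by (auto simp: sym_def Let_def)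
  show "irrefl (parcs (torus_graph a b))"
    by (auto simp: torus_graph_def grid_graph_def square_lattice_def irrefl_def Let_def)
qed

lemma bidirected_metagraph: "pair_bidirected_digraph (metagraph G t)"
proof (rule pair_bidirected_digraphI)
  show "sym (parcs (metagraph G t))"
    unfolding metagraph_def by (rule symI) (simp, metis)
qed (auto simp: metagraph_def irrefl_def)

end

theory Submission
  imports Defs "HOL-Library.Product_Plus"
begin

text \<open>
  All three locked tilings have the same anatomy. The plane is covered by congruent blocks, squares
  or hexagons, whose positions form a lattice; neighbouring blocks overlap in one side, a \<open>bar\<close>.
  Each block is wound up by strands, one from each of its sides (four or six), which spiral in
  parallel towards the centre: a strand runs along side \<open>s\<close> of layer \<open>k\<close>, then along side \<open>s + 1\<close>
  of layer \<open>k - 1\<close>, and so on. A tile consists of the two strands that leave a bar at its two ends,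
  one into each of the two blocks that share the bar. So every tile is an induced path, every cell
  is on one tile, and two tiles touch only where neighbouring strands of one block run side by side
  (or, in a hexagon, where their tips meet).

  Such a tiling admits no change of two tiles because two touching tiles are zipped together.
  Number the cells of each of the two paths so that the common block comes last. The cross edges are
  then ordered: a later cell of one path never touches an earlier cell of the other. Moreover cross
  edges start so late that the initial pieces of the two paths up to the first cross edge have
  together more than \<open>t\<close> cells. Suppose the \<open>2 t\<close> cells are split into two connected parts of size
  \<open>t\<close>. Each initial piece lies in one part, since a part that met it without containing its end
  would be too small.
  Both pieces in one part would be too many cells, so one part \<open>X\<close> starts along the first path and
  the other part \<open>Y\<close> along the second. If \<open>X\<close> is not the first path, then \<open>X\<close> must leave its
  initial piece of the first path by a cross edge, and \<open>Y\<close> its initial piece of the second path;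
  these two cross edges violate the order. This is the lemma \<open>zipper\<close>.

  The locale \<open>path_tiling\<close> turns the lemma into isolation in the metagraph; \<open>spiral_blocks\<close> derives
  the hypotheses on the paths from a combinatorial description of the spirals; \<open>lattice_spiral\<close>
  derives that description from a finite amount of geometry of a single block, simultaneously for
  the plane and for its quotients modulo \<open>N\<close>. The square blocks and the hexagonal blocks are two
  instances. For the torus it matters that the lattice of square blocks contains all vectors
  \<open>(2 t a, 2 t b)\<close>. Finally, cutting every row into intervals of length \<open>t\<close> gives a tiling
  without bends, hence a second vertex of the metagraph.
\<close>

section \<open>Two induced paths zipped together\<close>

definition linked :: "'a pair_pre_digraph \<Rightarrow> 'a \<Rightarrow> 'a \<Rightarrow> bool" where
  "linked G v w \<longleftrightarrow> (v, w) \<in> parcs G \<or> (w, v) \<in> parcs G"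

lemma linked_sym: "linked G v w \<Longrightarrow> linked G w v"
  by (auto simp: linked_def)

text \<open>
  The form of connectedness that the splitting argument consumes: a proper nonempty piece can always
  be left by an edge. It avoids walks altogether.
\<close>
definition indecomposable :: "('a \<Rightarrow> 'a \<Rightarrow> bool) \<Rightarrow> 'a set \<Rightarrow> bool" where
  "indecomposable adj X \<longleftrightarrow>
    (\<forall>S\<subseteq>X. S \<noteq> {} \<longrightarrow> S \<noteq> X \<longrightarrow> (\<exists>v\<in>S. \<exists>w\<in>X - S. adj v w))"

lemma indecomposableE:
  assumes "indecomposable adj X" "S \<subseteq> X" "S \<noteq> {}" "S \<noteq> X"
  obtains v w where "v \<in> S" "w \<in> X" "w \<notin> S" "adj v w"
  using assms unfolding indecomposable_def by blast

lemma connected_induced_iff: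
  "Digraph_Component.connected (with_proj G \<restriction> A) \<longleftrightarrow>
    A \<noteq> {} \<and> (\<forall>u\<in>A. \<forall>v\<in>A. (u, v) \<in> rtrancl_on A {(x, y). x \<in> A \<and> y \<in> A \<and> linked G x y})"
proof -
  have "(arcs_ends (with_proj G \<restriction> A))\<^sup>s = {(x, y). x \<in> A \<and> y \<in> A \<and> linked G x y}"
    by (auto simp: symcl_def arcs_ends_conv linked_def image_iff)
  then show ?thesis
    by (simp add: connected_conv)
qed

lemma connected_imp_indecomposable:
  assumes "Digraph_Component.connected (with_proj G \<restriction> X)"
  shows "indecomposable (linked G) X"
  unfolding indecomposable_def
proof (intro allI impI, rule ccontr)
  fix S assume S: "S \<subseteq> X" "S \<noteq> {}" "S \<noteq> X"
    and no: "\<not> (\<exists>v\<in>S. \<exists>w\<in>X - S. linked G v w)"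
  obtain u v where u: "u \<in> S" and v: "v \<in> X" "v \<notin> S" using S by blast
  have "(u, v) \<in> rtrancl_on X {(x, y). x \<in> X \<and> y \<in> X \<and> linked G x y}"
    using assms u v S unfolding connected_induced_iff by blast
  then have "v \<in> S"
    by (induction rule: rtrancl_on_induct) (use u no in auto)
  with v show False by simp
qed

lemma connected_path:
  fixes f :: "int \<Rightarrow> 'a"
  assumes "0 < t" and step: "\<And>i. 0 \<le> i \<Longrightarrow> i + 1 < t \<Longrightarrow> linked G (f i) (f (i + 1))"
  shows "Digraph_Component.connected (with_proj G \<restriction> (f ` {0..<t}))"
proof -
  let ?A = "f ` {0..<t}"
  let ?r = "{(x, y). x \<in> ?A \<and> y \<in> ?A \<and> linked G x y}"
  have up: "j < t \<longrightarrow> (f 0, f j) \<in> rtrancl_on ?A ?r \<and> (f j, f 0) \<in> rtrancl_on ?A ?r" if "0 \<le> j" for j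
    using that
  proof (induction j rule: int_ge_induct)
    case base
    then show ?case using assms(1) by auto
  next
    case (step j)
    show ?case
    proof
      assume j: "j + 1 < t"
      then have IH: "(f 0, f j) \<in> rtrancl_on ?A ?r" "(f j, f 0) \<in> rtrancl_on ?A ?r"
        using step.IH by auto
      have mem: "f j \<in> ?A" "f (j + 1) \<in> ?A" using step.hyps j by auto
      have r: "(f j, f (j + 1)) \<in> ?r" "(f (j + 1), f j) \<in> ?r"
        using mem assms(2)[OF step.hyps j] linked_sym by fastforce+
      show "(f 0, f (j + 1)) \<in> rtrancl_on ?A ?r \<and> (f (j + 1), f 0) \<in> rtrancl_on ?A ?r"
        by (rule conjI[OF rtrancl_on_into_rtrancl_on[OF IH(1) r(1) mem(2)]
          converse_rtrancl_on_into_rtrancl_on[OF r(2) IH(2) mem(2)]])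
    qed
  qed
  show ?thesis
    unfolding connected_induced_iff
  proof (intro conjI ballI)
    show "?A \<noteq> {}" using assms(1) by auto
    fix u v assume "u \<in> ?A" "v \<in> ?A"
    then obtain i j where "u = f i" "v = f j" "0 \<le> i" "i < t" "0 \<le> j" "j < t" by auto
    then show "(u, v) \<in> rtrancl_on ?A ?r"
      using up[of i] up[of j] rtrancl_on_trans by fast
  qed
qed

text \<open>
  A path whose cells before \<open>\<alpha>\<close> have no neighbours off the path: the part \<open>Y\<close> cannot contain some of
  these cells without containing \<open>a \<alpha>\<close>. Going back from the last such cell, \<open>Y\<close> would be confined to
  this cell and those before it, which are fewer than \<open>t\<close>.
\<close>
lemma initial_segment_same_part:
  fixes a :: "int \<Rightarrow> 'a" and t \<alpha> :: int
  assumes "0 \<le> \<alpha>" "\<alpha> < t" and inj: "inj_on a {0..<t}"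
    and sub: "\<And>i. 0 \<le> i \<Longrightarrow> i < t \<Longrightarrow> a i \<in> X \<union> Y" and disj: "X \<inter> Y = {}"
    and nb: "\<And>i v. 0 \<le> i \<Longrightarrow> i < \<alpha> \<Longrightarrow> v \<in> Y \<Longrightarrow> adj (a i) v \<Longrightarrow>
      \<exists>j. 0 \<le> j \<and> j \<le> i + 1 \<and> v = a j"
    and Y: "indecomposable adj Y" "card Y = nat t"
    and start: "a \<alpha> \<in> X"
    and i: "0 \<le> i" "i \<le> \<alpha>"
  shows "a i \<in> X"
proof (rule ccontr)
  assume "a i \<notin> X"
  let ?J = "{j. 0 \<le> j \<and> j \<le> \<alpha> \<and> a j \<in> Y}"
  have finJ: "finite ?J" by (rule finite_subset[of _ "{0..\<alpha>}"]) auto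
  have iJ: "i \<in> ?J" using \<open>a i \<notin> X\<close> sub[of i] i assms(2) by auto
  define g where "g = Max ?J"
  have gJ: "g \<in> ?J" unfolding g_def using finJ iJ by (intro Max_in) auto
  have gmax: "j \<le> g" if "j \<in> ?J" for j unfolding g_def using finJ that by simp
  have "g \<noteq> \<alpha>" using gJ start disj by auto
  then have g: "0 \<le> g" "g < \<alpha>" "a g \<in> Y" using gJ by auto
  define S where "S = Y \<inter> a ` {0..g}"
  have "finite Y" using Y(2) assms by (metis card.infinite less_le_trans less_nat_zero_code zero_less_nat_eq nat_0_iff not_le order_le_less_trans)
  have "card S \<le> card (a ` {0..g})" unfolding S_def by (intro card_mono) auto
  also have "\<dots> \<le> card {0..g}" by (rule card_image_le) auto
  also have "\<dots> < card Y" using g assms Y(2) by auto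
  finally have "S \<noteq> Y" by auto
  moreover have "S \<subseteq> Y" "S \<noteq> {}" using g unfolding S_def by auto
  ultimately obtain v w where vw: "v \<in> S" "w \<in> Y" "w \<notin> S" "adj v w"
    using Y(1) by (elim indecomposableE)
  then obtain k where k: "0 \<le> k" "k \<le> g" "v = a k" unfolding S_def by auto
  then obtain j where j: "0 \<le> j" "j \<le> k + 1" "w = a j"
    using nb[of k w] vw g by auto
  have "g < j" using vw j unfolding S_def by (auto simp: not_less[symmetric])
  then have "j = g + 1" using j k by linarith
  then have "j \<in> ?J" using j vw g by auto
  then show False using gmax \<open>g < j\<close> by fastforce
qed

lemma card_prefix_union:
  fixes a b :: "int \<Rightarrow> 'a"
  assumes "inj_on a {0..<t}" "inj_on b {0..<t}" "a ` {0..<t} \<inter> b ` {0..<t} = {}"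
    and "\<alpha> < t" "\<beta> < t" "0 \<le> \<alpha>" "0 \<le> \<beta>"
  shows "card (a ` {0..\<alpha>} \<union> b ` {0..\<beta>}) = nat (\<alpha> + \<beta> + 2)"
proof -
  have "card (a ` {0..\<alpha>}) = nat (\<alpha> + 1)"
    using assms by (subst card_image) (auto intro: inj_on_subset)
  moreover have "card (b ` {0..\<beta>}) = nat (\<beta> + 1)"
    using assms by (subst card_image) (auto intro: inj_on_subset)
  moreover have "a ` {0..\<alpha>} \<inter> b ` {0..\<beta>} = {}"
  proof -
    have "a ` {0..\<alpha>} \<subseteq> a ` {0..<t}" "b ` {0..\<beta>} \<subseteq> b ` {0..<t}" using assms by auto
    then show ?thesis using assms(3) by blast
  qed
  ultimately show ?thesis using assms by (subst card_Un_disjoint) auto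
qed

text \<open>
  The argument of the introduction, with the part that contains \<open>a \<alpha>\<close> called \<open>X\<close>. The indices \<open>p\<close>
  and \<open>q\<close> of the proof mark the first cell of either path that has the wrong part.
\<close>
lemma zipper_aux:
  fixes a b :: "int \<Rightarrow> 'a" and t \<alpha> \<beta> :: int
  assumes sym: "\<And>v w. adj v w \<Longrightarrow> adj w v"
    and inj: "inj_on a {0..<t}" "inj_on b {0..<t}" "a ` {0..<t} \<inter> b ` {0..<t} = {}"
    and aa: "\<And>i j. \<lbrakk>i \<in> {0..<t}; j \<in> {0..<t}; adj (a i) (a j)\<rbrakk> \<Longrightarrow> \<bar>i - j\<bar> = 1"
    and bb: "\<And>i j. \<lbrakk>i \<in> {0..<t}; j \<in> {0..<t}; adj (b i) (b j)\<rbrakk> \<Longrightarrow> \<bar>i - j\<bar> = 1"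
    and lo: "\<And>i j. \<lbrakk>i \<in> {0..<t}; j \<in> {0..<t}; adj (a i) (b j)\<rbrakk> \<Longrightarrow> \<alpha> \<le> i \<and> \<beta> \<le> j"
    and nc: "\<And>i j i' j'. \<lbrakk>i \<in> {0..<t}; j \<in> {0..<t}; i' \<in> {0..<t}; j' \<in> {0..<t};
      adj (a i) (b j); adj (a i') (b j'); i < i'\<rbrakk> \<Longrightarrow> j \<le> j'"
    and rng: "0 \<le> \<alpha>" "\<alpha> < t" "0 \<le> \<beta>" "\<beta> < t" "t < \<alpha> + \<beta> + 2"
    and U: "X \<union> Y = a ` {0..<t} \<union> b ` {0..<t}" "X \<inter> Y = {}"
    and card: "card X = nat t" "card Y = nat t"
    and conn: "indecomposable adj X" "indecomposable adj Y"
    and start: "a \<alpha> \<in> X"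
  shows "X = a ` {0..<t}"
proof -
  have finU: "finite (X \<union> Y)" unfolding U by auto
  have cA: "card (a ` {0..<t}) = nat t" using inj(1) by (simp add: card_image)
  have cB: "card (b ` {0..<t}) = nat t" using inj(2) by (simp add: card_image)
  have inU: "a i \<in> X \<union> Y" "b i \<in> X \<union> Y" if "0 \<le> i" "i < t" for i
    using that unfolding U by auto
  \<comment> \<open>before their first cross edges the two paths have no neighbours but their own cells\<close>
  have nba: "\<exists>j. 0 \<le> j \<and> j \<le> i + 1 \<and> v = a j"
    if "0 \<le> i" "i < \<alpha>" "v \<in> X \<union> Y" "adj (a i) v" for i v
  proof -
    have i: "i \<in> {0..<t}" using that rng by auto
    from that(3) consider j where "j \<in> {0..<t}" "v = a j" | j where "j \<in> {0..<t}" "v = b j"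
      unfolding U by auto
    then show ?thesis
    proof cases
      case 1
      then have "\<bar>i - j\<bar> = 1" using aa[OF i 1(1)] that by simp
      then show ?thesis using 1 by (intro exI[of _ j]) auto
    next
      case 2
      then show ?thesis using lo[OF i 2(1)] that by simp
    qed
  qed
  have nbb: "\<exists>j. 0 \<le> j \<and> j \<le> i + 1 \<and> v = b j"
    if "0 \<le> i" "i < \<beta>" "v \<in> X \<union> Y" "adj (b i) v" for i v
  proof -
    have i: "i \<in> {0..<t}" using that rng by auto
    from that(3) consider j where "j \<in> {0..<t}" "v = a j" | j where "j \<in> {0..<t}" "v = b j"
      unfolding U by auto
    then show ?thesis
    proof cases
      case 1
      then show ?thesis using lo[OF 1(1) i] sym[OF that(4)] that by simp
    next
      case 2
      then have "\<bar>i - j\<bar> = 1" using bb[OF i 2(1)] that by simp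
      then show ?thesis using 2 by (intro exI[of _ j]) auto
    qed
  qed
  have preA: "a i \<in> X" if "0 \<le> i" "i \<le> \<alpha>" for i
    by (rule initial_segment_same_part[OF rng(1,2) inj(1) inU(1) U(2) _ conn(2) card(2) start that])
      (use nba in auto)
  have "b \<beta> \<in> Y"
  proof (rule ccontr)
    assume "b \<beta> \<notin> Y"
    then have "b \<beta> \<in> X" using inU(2)[of \<beta>] rng by auto
    have "b i \<in> X" if "0 \<le> i" "i \<le> \<beta>" for i
      by (rule initial_segment_same_part[OF rng(3,4) inj(2) inU(2) U(2) _ conn(2) card(2) \<open>b \<beta> \<in> X\<close> that])
        (use nbb in auto)
    then have "a ` {0..\<alpha>} \<union> b ` {0..\<beta>} \<subseteq> X" using preA by auto
    then have "card (a ` {0..\<alpha>} \<union> b ` {0..\<beta>}) \<le> card X"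
      using finU by (intro card_mono) auto
    then show False
      using card_prefix_union[OF inj rng(2,4,1,3)] card(1) rng by linarith
  qed
  have U': "Y \<union> X = a ` {0..<t} \<union> b ` {0..<t}" "Y \<inter> X = {}" using U by auto
  have preB: "b i \<in> Y" if "0 \<le> i" "i \<le> \<beta>" for i
    by (rule initial_segment_same_part[OF rng(3,4) inj(2) _ U'(2) _ conn(1) card(1) \<open>b \<beta> \<in> Y\<close> that])
      (use nbb inU in auto)
  show ?thesis
  proof (rule ccontr)
    assume neq: "X \<noteq> a ` {0..<t}"
    have "\<not> a ` {0..<t} \<subseteq> X"
      using neq card_subset_eq[of X "a ` {0..<t}"] finU cA card by auto
    then obtain p0 where p0: "p0 \<in> {0..<t}" "a p0 \<in> Y" using inU by fastforce
    have "\<not> b ` {0..<t} \<subseteq> Y"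
    proof
      assume "b ` {0..<t} \<subseteq> Y"
      then have "b ` {0..<t} = Y"
        using card_subset_eq[of Y "b ` {0..<t}"] finU cB card by auto
      then have "a p0 \<in> a ` {0..<t} \<inter> b ` {0..<t}" using p0 by blast
      then show False using inj(3) by blast
    qed
    then obtain q0 where q0: "q0 \<in> {0..<t}" "b q0 \<in> X" using inU by fastforce
    have fin: "finite {i \<in> {0..<t}. a i \<in> Y}" "finite {i \<in> {0..<t}. b i \<in> X}"
      by (rule finite_subset[of _ "{0..<t}"]; auto)+
    define p where "p = Min {i \<in> {0..<t}. a i \<in> Y}"
    define q where "q = Min {i \<in> {0..<t}. b i \<in> X}"
    have "p \<in> {i \<in> {0..<t}. a i \<in> Y}" unfolding p_def using p0 fin by (intro Min_in) auto
    then have p: "p \<in> {0..<t}" "a p \<in> Y" by auto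
    have "q \<in> {i \<in> {0..<t}. b i \<in> X}" unfolding q_def using q0 fin by (intro Min_in) auto
    then have q: "q \<in> {0..<t}" "b q \<in> X" by auto
    have belowp: "a i \<in> X" if "0 \<le> i" "i < p" for i
    proof (rule ccontr)
      assume "a i \<notin> X"
      then have "i \<in> {i \<in> {0..<t}. a i \<in> Y}" using that p inU[of i] by auto
      then have "p \<le> i" unfolding p_def using fin by (intro Min_le) auto
      then show False using that by auto
    qed
    have belowq: "b i \<in> Y" if "0 \<le> i" "i < q" for i
    proof (rule ccontr)
      assume "b i \<notin> Y"
      then have "i \<in> {i \<in> {0..<t}. b i \<in> X}" using that q inU[of i] by auto
      then have "q \<le> i" unfolding q_def using fin by (intro Min_le) auto
      then show False using that by auto
    qed
    have p1: "\<alpha> < p" using preA[of p] p U(2) by fastforce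
    have q1: "\<beta> < q" using preB[of q] q U(2) by fastforce
    \<comment> \<open>the edge by which \<open>X\<close> leaves the initial part of \<open>a\<close>\<close>
    let ?S = "a ` {0..<p}"
    have "?S \<subseteq> X" using belowp by auto
    moreover have "?S \<noteq> {}" using p1 rng by auto
    moreover have "b q \<notin> ?S" using p q inj(3) by fastforce
    then have "?S \<noteq> X" using q by auto
    ultimately obtain v w where vw: "v \<in> ?S" "w \<in> X" "w \<notin> ?S" "adj v w"
      using conn(1) by (elim indecomposableE)
    then obtain i where i: "0 \<le> i" "i < p" "v = a i" by auto
    have iT: "i \<in> {0..<t}" using i p by auto
    obtain j where j: "j \<in> {0..<t}" "w = b j"
    proof -
      consider j where "j \<in> {0..<t}" "w = a j" | j where "j \<in> {0..<t}" "w = b j"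
        using vw(2) U(1) by blast
      then show thesis
      proof cases
        case 1
        then have "p \<le> j" using vw(3) by fastforce
        moreover have "\<bar>i - j\<bar> = 1" using aa[OF iT 1(1)] vw 1 i by auto
        ultimately have "j = p" using i by auto
        then show ?thesis using p 1 vw U(2) by auto
      next
        case 2 then show ?thesis using that by auto
      qed
    qed
    have "q \<le> j" using belowq[of j] j vw(2) U(2) by fastforce
    \<comment> \<open>the edge by which \<open>Y\<close> leaves the initial part of \<open>b\<close>\<close>
    let ?S' = "b ` {0..<q}"
    have "?S' \<subseteq> Y" using belowq by auto
    moreover have "?S' \<noteq> {}" using q1 rng by auto
    moreover have "a p \<notin> ?S'" using p q inj(3) by fastforce
    then have "?S' \<noteq> Y" using p by auto
    ultimately obtain v' w' where vw': "v' \<in> ?S'" "w' \<in> Y" "w' \<notin> ?S'" "adj v' w'"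
      using conn(2) by (elim indecomposableE)
    then obtain j' where j': "0 \<le> j'" "j' < q" "v' = b j'" by auto
    have jT: "j' \<in> {0..<t}" using j' q by auto
    obtain i' where i': "i' \<in> {0..<t}" "w' = a i'"
    proof -
      consider k where "k \<in> {0..<t}" "w' = a k" | k where "k \<in> {0..<t}" "w' = b k"
        using vw'(2) U(1) by blast
      then show thesis
      proof cases
        case 1 then show ?thesis using that by auto
      next
        case 2
        then have "q \<le> k" using vw'(3) by fastforce
        moreover have "\<bar>j' - k\<bar> = 1" using bb[OF jT 2(1)] vw' 2 j' by auto
        ultimately have "k = q" using j' by auto
        then show ?thesis using q 2 vw' U(2) by auto
      qed
    qed
    have "p \<le> i'" using belowp[of i'] i' vw'(2) U(2) by fastforce
    then have "j \<le> j'"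
      using nc[OF iT j(1) i'(1) jT] vw(4) vw'(4) sym i j(2) i'(2) j'(3) by auto
    then show False using \<open>q \<le> j\<close> j' by auto
  qed
qed

text \<open>
  The condition \<open>t < \<alpha> + \<beta> + 2\<close> says that the pieces \<open>a 0, \<dots>, a \<alpha>\<close> and \<open>b 0, \<dots>, b \<beta>\<close> do not fit
  together into one part.
\<close>
lemma zipper:
  fixes a b :: "int \<Rightarrow> 'a" and t \<alpha> \<beta> :: int
  assumes sym: "\<And>v w. adj v w \<Longrightarrow> adj w v"
    and inj: "inj_on a {0..<t}" "inj_on b {0..<t}" "a ` {0..<t} \<inter> b ` {0..<t} = {}"
    and aa: "\<And>i j. \<lbrakk>i \<in> {0..<t}; j \<in> {0..<t}; adj (a i) (a j)\<rbrakk> \<Longrightarrow> \<bar>i - j\<bar> = 1"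
    and bb: "\<And>i j. \<lbrakk>i \<in> {0..<t}; j \<in> {0..<t}; adj (b i) (b j)\<rbrakk> \<Longrightarrow> \<bar>i - j\<bar> = 1"
    and lo: "\<And>i j. \<lbrakk>i \<in> {0..<t}; j \<in> {0..<t}; adj (a i) (b j)\<rbrakk> \<Longrightarrow> \<alpha> \<le> i \<and> \<beta> \<le> j"
    and nc: "\<And>i j i' j'. \<lbrakk>i \<in> {0..<t}; j \<in> {0..<t}; i' \<in> {0..<t}; j' \<in> {0..<t};
      adj (a i) (b j); adj (a i') (b j'); i < i'\<rbrakk> \<Longrightarrow> j \<le> j'"
    and rng: "0 \<le> \<alpha>" "\<alpha> < t" "0 \<le> \<beta>" "\<beta> < t" "t < \<alpha> + \<beta> + 2"
    and U: "X \<union> Y = a ` {0..<t} \<union> b ` {0..<t}" "X \<inter> Y = {}"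
    and card: "card X = nat t" "card Y = nat t"
    and conn: "indecomposable adj X" "indecomposable adj Y"
  shows "{X, Y} = {a ` {0..<t}, b ` {0..<t}}"
proof -
  have one: "{Z, W} = {a ` {0..<t}, b ` {0..<t}}"
    if ZW: "Z \<union> W = a ` {0..<t} \<union> b ` {0..<t}" "Z \<inter> W = {}" "card Z = nat t" "card W = nat t"
      "indecomposable adj Z" "indecomposable adj W" "a \<alpha> \<in> Z" for Z W
  proof -
    have "Z = a ` {0..<t}"
      by (rule zipper_aux[where adj = adj and a = a and b = b and t = t and \<alpha> = \<alpha> and \<beta> = \<beta> and Y = W])
        (fact sym inj aa bb lo nc rng ZW)+
    then show ?thesis using ZW(1,2) inj(3) by blast
  qed
  have "a \<alpha> \<in> X \<union> Y" using U rng by auto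
  then show ?thesis
  proof
    assume "a \<alpha> \<in> X"
    then show ?thesis using one[of X Y] U card conn by simp
  next
    assume "a \<alpha> \<in> Y"
    then show ?thesis using one[of Y X] U card conn by (simp add: Un_commute Int_commute insert_commute)
  qed
qed

section \<open>Tilings by paths\<close>

text \<open>
  A tile is a path and has two numberings, one from each end. So the elements of \<open>X\<close> are the ends
  of tiles, \<open>\<iota>\<close> exchanges the two ends of one tile, and \<open>Q x\<close> lists the cells of the tile, by
  convention towards the end \<open>x\<close>. An edge between different tiles is recorded by \<open>R x y i j\<close> for exactly
  one choice of numberings; this is the choice for which the edges are ordered and late, as the
  lemma \<open>zipper\<close> demands.
\<close>
locale path_tiling =
  fixes G :: "'v pair_pre_digraph" and t :: int and X :: "'x set" and \<iota> :: "'x \<Rightarrow> 'x"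
    and Q :: "'x \<Rightarrow> int \<Rightarrow> 'v" and R :: "'x \<Rightarrow> 'x \<Rightarrow> int \<Rightarrow> int \<Rightarrow> bool"
  assumes t_pos: "0 < t"
    and other_end: "x \<in> X \<Longrightarrow> \<iota> x \<in> X" "x \<in> X \<Longrightarrow> \<iota> (\<iota> x) = x" "x \<in> X \<Longrightarrow> \<iota> x \<noteq> x"
    and reverse: "\<lbrakk>x \<in> X; 0 \<le> i; i < t\<rbrakk> \<Longrightarrow> Q (\<iota> x) i = Q x (t - 1 - i)"
    and cover: "pverts G = (\<Union>x\<in>X. Q x ` {0..<t})"
    and inj: "\<lbrakk>x \<in> X; y \<in> X; i \<in> {0..<t}; j \<in> {0..<t}; Q x i = Q y j\<rbrakk> \<Longrightarrow>
      y = x \<and> j = i \<or> y = \<iota> x \<and> j = t - 1 - i"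
    and consecutive: "\<lbrakk>x \<in> X; 0 \<le> i; i + 1 < t\<rbrakk> \<Longrightarrow> linked G (Q x i) (Q x (i + 1))"
    and edge: "linked G v w \<Longrightarrow>
      (\<exists>x\<in>X. \<exists>i. 0 \<le> i \<and> i + 1 < t \<and>
        (v = Q x i \<and> w = Q x (i + 1) \<or> w = Q x i \<and> v = Q x (i + 1))) \<or>
      (\<exists>x\<in>X. \<exists>y\<in>X. \<exists>i\<in>{0..<t}. \<exists>j\<in>{0..<t}. R x y i j \<and>
        (v = Q x i \<and> w = Q y j \<or> w = Q x i \<and> v = Q y j))"
    and distinct: "\<lbrakk>x \<in> X; y \<in> X; R x y i j\<rbrakk> \<Longrightarrow> y \<noteq> x \<and> y \<noteq> \<iota> x"
    and unique: "\<lbrakk>x \<in> X; y \<in> X; R x y i j; x' \<in> {x, \<iota> x}; y' \<in> {y, \<iota> y}; R x' y' i' j'\<rbrakk> \<Longrightarrow>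
      x' = x \<and> y' = y"
    and oriented: "\<lbrakk>x \<in> X; y \<in> X; R x y i j; x' \<in> {x, \<iota> x}; y' \<in> {y, \<iota> y}\<rbrakk> \<Longrightarrow> \<not> R y' x' i' j'"
    and late: "\<lbrakk>x \<in> X; y \<in> X; R x y i0 j0\<rbrakk> \<Longrightarrow>
      \<exists>\<alpha> \<beta>. 0 \<le> \<alpha> \<and> \<alpha> < t \<and> 0 \<le> \<beta> \<and> \<beta> < t \<and> t < \<alpha> + \<beta> + 2 \<and>
        (\<forall>i\<in>{0..<t}. \<forall>j\<in>{0..<t}. R x y i j \<longrightarrow> \<alpha> \<le> i \<and> \<beta> \<le> j)"
    and noncrossing: "\<lbrakk>x \<in> X; y \<in> X; i \<in> {0..<t}; j \<in> {0..<t}; i' \<in> {0..<t}; j' \<in> {0..<t};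
      R x y i j; R x y i' j'; i < i'\<rbrakk> \<Longrightarrow> j \<le> j'"
begin

definition tile :: "'x \<Rightarrow> 'v set" where
  "tile x = Q x ` {0..<t}"

lemma tile_other_end: "x \<in> X \<Longrightarrow> tile (\<iota> x) = tile x"
proof -
  assume x: "x \<in> X"
  have sub: "tile (\<iota> y) \<subseteq> tile y" if "y \<in> X" for y
    using reverse[OF that] unfolding tile_def by fastforce
  show ?thesis using sub[OF x] sub[OF other_end(1)[OF x]] other_end(2)[OF x] by auto
qed

lemma inj_path: "x \<in> X \<Longrightarrow> inj_on (Q x) {0..<t}"
  using inj[of x x] other_end(3)[of x] by (intro inj_onI) metis

lemma card_tile: "x \<in> X \<Longrightarrow> card (tile x) = nat t"
  unfolding tile_def by (simp add: card_image inj_path)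

lemma tile_eq_iff:
  assumes "x \<in> X" "y \<in> X"
  shows "tile x = tile y \<longleftrightarrow> y = x \<or> y = \<iota> x"
proof
  assume "tile x = tile y"
  then have "Q x 0 \<in> tile y" using t_pos unfolding tile_def by auto
  then obtain j where "j \<in> {0..<t}" "Q x 0 = Q y j" unfolding tile_def by blast
  then show "y = x \<or> y = \<iota> x" using inj[OF assms, of 0 j] t_pos by auto
qed (use tile_other_end[OF assms(1)] in auto)

lemma tile_disjoint:
  assumes "x \<in> X" "y \<in> X" "tile x \<noteq> tile y"
  shows "tile x \<inter> tile y = {}"
  using inj[OF assms(1,2)] assms(3) unfolding tile_eq_iff[OF assms(1,2)] unfolding tile_def
  by blast

lemma connected_tile: "x \<in> X \<Longrightarrow> Digraph_Component.connected (with_proj G \<restriction> tile x)"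
  unfolding tile_def by (rule connected_path[OF t_pos]) (rule consecutive)

lemma omino_tiling_tiles: "omino_tiling G (nat t) (tile ` X)"
  unfolding omino_tiling_def partition_on_def disjoint_def
proof (intro conjI ballI impI)
  show "\<Union> (tile ` X) = pverts G" unfolding cover tile_def by simp
  show "{} \<notin> tile ` X" using t_pos unfolding tile_def by auto
  fix A assume "A \<in> tile ` X"
  then obtain x where x: "x \<in> X" "A = tile x" by auto
  show "finite A" using x(2) unfolding tile_def by simp
  show "card A = nat t" "Digraph_Component.connected (with_proj G \<restriction> A)"
    using x card_tile connected_tile by auto
  fix B assume "B \<in> tile ` X" "A \<noteq> B"
  then show "A \<inter> B = {}" using x tile_disjoint by auto
qed

lemma linked_same_tile:
  assumes "x \<in> X" "i \<in> {0..<t}" "j \<in> {0..<t}" "linked G (Q x i) (Q x j)"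
  shows "\<bar>i - j\<bar> = 1"
  using edge[OF assms(4)]
proof (elim disjE bexE exE conjE)
  fix y k assume *: "y \<in> X" "0 \<le> k" "k + 1 < t" "Q x i = Q y k" "Q x j = Q y (k + 1)"
  have "y = x \<and> k = i \<or> y = \<iota> x \<and> k = t - 1 - i" "y = x \<and> k + 1 = j \<or> y = \<iota> x \<and> k + 1 = t - 1 - j"
    using inj[of x y i k] inj[of x y j "k + 1"] * assms by auto
  then show ?thesis using other_end(3)[OF assms(1)] by auto
next
  fix y k assume *: "y \<in> X" "0 \<le> k" "k + 1 < t" "Q x j = Q y k" "Q x i = Q y (k + 1)"
  have "y = x \<and> k = j \<or> y = \<iota> x \<and> k = t - 1 - j" "y = x \<and> k + 1 = i \<or> y = \<iota> x \<and> k + 1 = t - 1 - i"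
    using inj[of x y j k] inj[of x y i "k + 1"] * assms by auto
  then show ?thesis using other_end(3)[OF assms(1)] by auto
next
  fix y z k l
  assume *: "y \<in> X" "z \<in> X" "k \<in> {0..<t}" "l \<in> {0..<t}" "R y z k l" "Q x i = Q y k" "Q x j = Q z l"
  have "y = x \<or> y = \<iota> x" "z = x \<or> z = \<iota> x"
    using inj[of x y i k] inj[of x z j l] * assms by auto
  then show ?thesis using distinct[OF *(1,2,5)] other_end[OF assms(1)] by auto
next
  fix y z k l
  assume *: "y \<in> X" "z \<in> X" "k \<in> {0..<t}" "l \<in> {0..<t}" "R y z k l" "Q x j = Q y k" "Q x i = Q z l"
  have "y = x \<or> y = \<iota> x" "z = x \<or> z = \<iota> x"
    using inj[of x y j k] inj[of x z i l] * assms by auto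
  then show ?thesis using distinct[OF *(1,2,5)] other_end[OF assms(1)] by auto
qed

lemma linked_different_tiles:
  assumes "x \<in> X" "y \<in> X" "tile x \<noteq> tile y" "i \<in> {0..<t}" "j \<in> {0..<t}" "linked G (Q x i) (Q y j)"
  obtains x' y' i' j' where "x' \<in> {x, \<iota> x}" "y' \<in> {y, \<iota> y}" "R x' y' i' j'"
      "i' \<in> {0..<t}" "j' \<in> {0..<t}" "Q x i = Q x' i'" "Q y j = Q y' j'"
    | x' y' i' j' where "x' \<in> {x, \<iota> x}" "y' \<in> {y, \<iota> y}" "R y' x' j' i'"
proof -
  have ne: "y \<noteq> x" "y \<noteq> \<iota> x" using assms tile_eq_iff by auto
  show thesis
    using edge[OF assms(6)]
  proof (elim disjE bexE exE conjE)
    fix z k assume *: "z \<in> X" "0 \<le> k" "k + 1 < t" "Q x i = Q z k" "Q y j = Q z (k + 1)"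
    have "z = x \<or> z = \<iota> x" "z = y \<or> z = \<iota> y"
      using inj[of x z i k] inj[of y z j "k + 1"] * assms by auto
    then show thesis using ne other_end(2)[OF assms(1)] other_end(2)[OF assms(2)] by metis
  next
    fix z k assume *: "z \<in> X" "0 \<le> k" "k + 1 < t" "Q y j = Q z k" "Q x i = Q z (k + 1)"
    have "z = x \<or> z = \<iota> x" "z = y \<or> z = \<iota> y"
      using inj[of y z j k] inj[of x z i "k + 1"] * assms by auto
    then show thesis using ne other_end(2)[OF assms(1)] other_end(2)[OF assms(2)] by metis
  next
    fix x' y' i' j'
    assume *: "x' \<in> X" "y' \<in> X" "i' \<in> {0..<t}" "j' \<in> {0..<t}" "R x' y' i' j'" "Q x i = Q x' i'" "Q y j = Q y' j'"
    have "x' = x \<or> x' = \<iota> x" "y' = y \<or> y' = \<iota> y"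
      using inj[of x x' i i'] inj[of y y' j j'] * assms by auto
    then show thesis using * that(1) by blast
  next
    fix y' x' j' i'
    assume *: "y' \<in> X" "x' \<in> X" "j' \<in> {0..<t}" "i' \<in> {0..<t}" "R y' x' j' i'" "Q y j = Q y' j'" "Q x i = Q x' i'"
    have "x' = x \<or> x' = \<iota> x" "y' = y \<or> y' = \<iota> y"
      using inj[of x x' i i'] inj[of y y' j j'] * assms by auto
    then show thesis using * that(2) by blast
  qed
qed

text \<open>
  Once two tiles have an edge recorded for the numberings \<open>x\<close> and \<open>y\<close>, all their edges are recorded
  for the same numberings, so that one order governs all of them.
\<close>
lemma linked_imp_related:
  assumes xy: "x \<in> X" "y \<in> X" "tile x \<noteq> tile y" "R x y i0 j0"
    and ij: "i \<in> {0..<t}" "j \<in> {0..<t}" "linked G (Q x i) (Q y j)"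
  shows "R x y i j"
  using linked_different_tiles[OF xy(1-3) ij]
proof cases
  case forward: (1 x' y' i' j')
  then have "x' = x" "y' = y" using unique[OF xy(1,2,4)] by blast+
  then have "i' = i" "j' = j"
    using forward ij inj_path[OF xy(1)] inj_path[OF xy(2)] by (auto dest: inj_onD)
  then show ?thesis using forward \<open>x' = x\<close> \<open>y' = y\<close> by simp
next
  case backward: (2 x' y' i' j')
  then show ?thesis using oriented[OF xy(1,2,4)] by blast
qed

lemma unique_split_by_order:
  assumes xy: "x \<in> X" "y \<in> X" "tile x \<noteq> tile y"
    and lo: "0 \<le> \<alpha>" "\<alpha> < t" "0 \<le> \<beta>" "\<beta> < t" "t < \<alpha> + \<beta> + 2"
      "\<And>i j. \<lbrakk>i \<in> {0..<t}; j \<in> {0..<t}; linked G (Q x i) (Q y j)\<rbrakk> \<Longrightarrow> \<alpha> \<le> i \<and> \<beta> \<le> j"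
    and nc: "\<And>i j i' j'. \<lbrakk>i \<in> {0..<t}; j \<in> {0..<t}; i' \<in> {0..<t}; j' \<in> {0..<t};
      linked G (Q x i) (Q y j); linked G (Q x i') (Q y j'); i < i'\<rbrakk> \<Longrightarrow> j \<le> j'"
    and S: "S \<union> T = tile x \<union> tile y" "S \<inter> T = {}" "card S = nat t" "card T = nat t"
      "indecomposable (linked G) S" "indecomposable (linked G) T"
  shows "{S, T} = {tile x, tile y}"
proof -
  have disj: "Q x ` {0..<t} \<inter> Q y ` {0..<t} = {}"
    using tile_disjoint[OF xy] unfolding tile_def .
  have aa: "\<bar>i - j\<bar> = 1" if "i \<in> {0..<t}" "j \<in> {0..<t}" "linked G (Q x i) (Q x j)" for i j
    using linked_same_tile[OF xy(1) that] .
  have bb: "\<bar>i - j\<bar> = 1" if "i \<in> {0..<t}" "j \<in> {0..<t}" "linked G (Q y i) (Q y j)" for i j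
    using linked_same_tile[OF xy(2) that] .
  note ix = inj_path[OF xy(1)] and iy = inj_path[OF xy(2)]
  show ?thesis
    unfolding tile_def
    by (rule zipper[where adj = "linked G" and \<alpha> = \<alpha> and \<beta> = \<beta>])
      (fact linked_sym ix iy disj aa bb lo nc S[unfolded tile_def])+
qed

lemma unique_split_related:
  assumes xy: "x \<in> X" "y \<in> X" "tile x \<noteq> tile y" "R x y i0 j0"
    and S: "S \<union> T = tile x \<union> tile y" "S \<inter> T = {}" "card S = nat t" "card T = nat t"
      "indecomposable (linked G) S" "indecomposable (linked G) T"
  shows "{S, T} = {tile x, tile y}"
proof -
  obtain \<alpha> \<beta> where ab: "0 \<le> \<alpha>" "\<alpha> < t" "0 \<le> \<beta>" "\<beta> < t" "t < \<alpha> + \<beta> + 2"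
    "\<And>i j. i \<in> {0..<t} \<Longrightarrow> j \<in> {0..<t} \<Longrightarrow> R x y i j \<Longrightarrow> \<alpha> \<le> i \<and> \<beta> \<le> j"
    using late[OF xy(1,2,4)] by blast
  note rel = linked_imp_related[OF xy]
  show ?thesis
  proof (rule unique_split_by_order[OF xy(1-3) ab(1-5) _ _ S])
    show "\<alpha> \<le> i \<and> \<beta> \<le> j"
      if "i \<in> {0..<t}" "j \<in> {0..<t}" "linked G (Q x i) (Q y j)" for i j
      using ab(6) rel that by simp
    show "j \<le> j'"
      if "i \<in> {0..<t}" "j \<in> {0..<t}" "i' \<in> {0..<t}" "j' \<in> {0..<t}"
        "linked G (Q x i) (Q y j)" "linked G (Q x i') (Q y j')" "i < i'" for i j i' j'
      using noncrossing[OF xy(1,2) that(1-4) rel[OF that(1,2,5)] rel[OF that(3,4,6)] that(7)] .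
  qed
qed

text \<open>
  Tiles without common edges are covered by the same argument, with \<open>t - 1\<close> as first index of a
  vacuous set of cross edges.
\<close>
lemma unique_split:
  assumes xy: "x \<in> X" "y \<in> X" "tile x \<noteq> tile y"
    and S: "S \<union> T = tile x \<union> tile y" "S \<inter> T = {}" "card S = nat t" "card T = nat t"
      "indecomposable (linked G) S" "indecomposable (linked G) T"
  shows "{S, T} = {tile x, tile y}"
proof (cases "\<exists>i\<in>{0..<t}. \<exists>j\<in>{0..<t}. linked G (Q x i) (Q y j)")
  case True
  then obtain i j where "i \<in> {0..<t}" "j \<in> {0..<t}" "linked G (Q x i) (Q y j)" by blast
  from linked_different_tiles[OF xy this] show ?thesis
  proof cases
    case forward: (1 x' y' i' j')
    have e: "tile x' = tile x" "tile y' = tile y" "x' \<in> X" "y' \<in> X"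
      using forward xy tile_other_end other_end(1) by auto
    then show ?thesis using unique_split_related[of x' y' i' j' S T] forward xy S by simp
  next
    case backward: (2 x' y' i' j')
    have e: "tile x' = tile x" "tile y' = tile y" "x' \<in> X" "y' \<in> X"
      using backward xy tile_other_end other_end(1) by auto
    then have "{S, T} = {tile y, tile x}"
      using unique_split_related[of y' x' j' i' S T] backward xy S by (simp add: Un_commute)
    then show ?thesis by (simp add: insert_commute)
  qed
next
  case False
  show ?thesis
    by (rule unique_split_by_order[OF xy, where \<alpha> = "t - 1" and \<beta> = "t - 1", OF _ _ _ _ _ _ _ S])
      (use False t_pos in auto)
qed

lemma metagraph_arc_iff:
  "(P, W) \<in> parcs (metagraph G' u) \<longleftrightarrow> omino_tiling G' u P \<and> omino_tiling G' u W \<and> P \<noteq> W \<and>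
    (\<exists>A\<in>P. \<exists>B\<in>P. \<exists>C\<in>W. \<exists>D\<in>W. A \<noteq> B \<and> C \<noteq> D \<and> A \<union> B = C \<union> D \<and> P - {A, B} = W - {C, D})"
  by (simp add: metagraph_def)

theorem isolated_vertex_tiles: "isolated_vertex (metagraph G (nat t)) (tile ` X)"
proof -
  let ?P = "tile ` X"
  have noarc: False
    if W: "omino_tiling G (nat t) W" "W \<noteq> ?P"
      and AB: "A \<in> ?P" "B \<in> ?P" "A \<noteq> B" and CD: "C \<in> W" "D \<in> W" "C \<noteq> D"
      and U: "A \<union> B = C \<union> D" and rest: "?P - {A, B} = W - {C, D}" for W A B C D
  proof -
    obtain x y where xy: "x \<in> X" "y \<in> X" "A = tile x" "B = tile y" using AB by auto
    have part: "card C = nat t" "card D = nat t" "C \<inter> D = {}"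
      using W(1) CD unfolding omino_tiling_def partition_on_def disjoint_def by auto
    have conn: "indecomposable (linked G) C" "indecomposable (linked G) D"
      using W(1) CD(1,2) unfolding omino_tiling_def by (auto intro: connected_imp_indecomposable)
    have eq: "{C, D} = {A, B}"
      using unique_split[of x y C D] xy AB(3) U part conn by simp
    have "?P = (?P - {A, B}) \<union> {A, B}" using AB by auto
    also have "\<dots> = (W - {C, D}) \<union> {C, D}" using rest eq by simp
    also have "\<dots> = W" using CD by auto
    finally show False using W(2) by simp
  qed
  show ?thesis
    unfolding isolated_vertex_def
  proof (intro conjI allI)
    show "?P \<in> pverts (metagraph G (nat t))"
      using omino_tiling_tiles by (simp add: metagraph_def)
    fix W
    show "(?P, W) \<notin> parcs (metagraph G (nat t))"
    proof
      assume "(?P, W) \<in> parcs (metagraph G (nat t))"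
      note arc = this[unfolded metagraph_arc_iff]
      have W: "omino_tiling G (nat t) W" "W \<noteq> ?P" using arc by blast+
      have ex: "\<exists>A\<in>?P. \<exists>B\<in>?P. \<exists>C\<in>W. \<exists>D\<in>W. A \<noteq> B \<and> C \<noteq> D \<and> A \<union> B = C \<union> D \<and> ?P - {A, B} = W - {C, D}"
        using arc by (elim conjE) assumption
      from ex show False
        by (elim bexE conjE) (rule noarc[OF W])
    qed
    show "(W, ?P) \<notin> parcs (metagraph G (nat t))"
    proof
      assume "(W, ?P) \<in> parcs (metagraph G (nat t))"
      note arc = this[unfolded metagraph_arc_iff]
      have W: "omino_tiling G (nat t) W" "W \<noteq> ?P" using arc by blast+
      have ex: "\<exists>C\<in>W. \<exists>D\<in>W. \<exists>A\<in>?P. \<exists>B\<in>?P. C \<noteq> D \<and> A \<noteq> B \<and> C \<union> D = A \<union> B \<and> W - {C, D} = ?P - {A, B}"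
        using arc by (elim conjE) assumption
      from ex show False
        by (elim bexE conjE) (rule noarc[OF W, OF _ _ _ _ _ _ sym sym])
    qed
  qed
qed

end

section \<open>Tiles that spiral into two neighbouring blocks\<close>

text \<open>
  A block \<open>b\<close> has \<open>K\<close> sides in cyclic order, numbered by all integers modulo \<open>K\<close>, and layers
  \<open>k = m, \<dots>, 1\<close> from the boundary to the centre; \<open>pos b s k i\<close> is the cell number \<open>i\<close> on side \<open>s\<close> of
  layer \<open>k\<close>. A strand runs through side \<open>s\<close> of layer \<open>k\<close> and goes on with side \<open>s + 1\<close> of layer
  \<open>k - 1\<close>, so \<open>s + k\<close> is constant on it; \<open>T s k\<close> is the number of its cells from side \<open>s\<close> of layer
  \<open>k\<close> to the centre, and \<open>idx s k i\<close> is the index in the tile, counted so that the tip of the strand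
  in the centre has index \<open>t - 1\<close>.

  Side \<open>s\<close> of the outermost layer is a bar: it is also side \<open>s + h\<close> of the block \<open>neighbour b s\<close>,
  traversed backwards. If opposite sides have different lengths, the shorter one is prolonged
  at its beginning by \<open>extra s\<close> cells with negative numbers. The bar is
  counted twice when the two strands are joined to a tile, which explains \<open>tile_length\<close>. The
  assumption \<open>late_start\<close> is the length condition of the zipper lemma for the strands that start at
  the sides \<open>s\<close> and \<open>s + 1\<close>.

  By \<open>classify\<close> the edges are of the following kinds: consecutive cells of a side; the turn of a strand
  into the next layer; a cell and one of the (at most two) cells next to it in the layer outside;
  the end of a side and the beginning of the next side in the same layer; and two kinds of edges
  between tips of strands, the last of which joins strands that are two apart and occurs only if \<open>tips\<close>
  holds.
\<close>
locale spiral_blocks =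
  fixes G :: "'v pair_pre_digraph" and t m h glue :: int and tips :: bool
    and len T :: "int \<Rightarrow> int \<Rightarrow> int" and extra :: "int \<Rightarrow> int"
    and B :: "'b set" and neighbour :: "'b \<Rightarrow> int \<Rightarrow> 'b" and pos :: "'b \<Rightarrow> int \<Rightarrow> int \<Rightarrow> int \<Rightarrow> 'v"
    and K :: int and valid :: "int \<Rightarrow> int \<Rightarrow> int \<Rightarrow> bool" and idx :: "int \<Rightarrow> int \<Rightarrow> int \<Rightarrow> int"
  defines "K \<equiv> 2 * h"
    and "valid s k i \<equiv> 1 \<le> k \<and> k \<le> m \<and> i < len s k \<and> (0 \<le> i \<or> k = m \<and> - extra s \<le> i)"
    and "idx s k i \<equiv> t - T s k + i"
  assumes h: "2 \<le> h" and tips: "tips \<Longrightarrow> h = 3" and m: "1 \<le> m" and glue: "0 \<le> glue"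
    and periodic: "len (s mod K) k = len s k" "T (s mod K) k = T s k" "extra (s mod K) = extra s"
      "neighbour b (s mod K) = neighbour b s" "pos b (s mod K) k i = pos b s k i"
    and T_0: "T s 0 = 0"
    and T_step: "1 \<le> k \<Longrightarrow> T s k = len s k + T (s + 1) (k - 1)"
    and len: "1 \<le> k \<Longrightarrow> 0 \<le> len s k" "2 \<le> k \<Longrightarrow> 1 \<le> len s k" "1 \<le> len s m"
    and extra: "0 \<le> extra s" "T s m + extra s \<le> t"
    and bar_length: "len (s + h) m = glue + 1 + extra s"
    and tile_length: "T s m + T (s + h) m = t + 1 + glue"
    and late_start: "T s m + T (s + 1) m + extra (s + 1) < t + len s m + 1"
    and neighbour: "b \<in> B \<Longrightarrow> neighbour b s \<in> B" "b \<in> B \<Longrightarrow> neighbour (neighbour b s) (s + h) = b" "b \<in> B \<Longrightarrow> neighbour b s \<noteq> b"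
      "b \<in> B \<Longrightarrow> neighbour b s \<noteq> neighbour b (s + 1)" "b \<in> B \<Longrightarrow> tips \<Longrightarrow> neighbour b s \<noteq> neighbour b (s + 2)"
    and cells: "pverts G = {pos b s k i | b s k i. b \<in> B \<and> valid s k i}"
    and same_cell: "\<lbrakk>b \<in> B; b' \<in> B; valid s k i; valid s' k' i'; pos b s k i = pos b' s' k' i'\<rbrakk> \<Longrightarrow>
      b' = b \<and> s' mod K = s mod K \<and> k' = k \<and> i' = i \<or>
      k = m \<and> k' = m \<and> b' = neighbour b s \<and> s' mod K = (s + h) mod K \<and> i' = glue - i"
    and shared_bar: "\<lbrakk>b \<in> B; valid s m i\<rbrakk> \<Longrightarrow> pos b s m i = pos (neighbour b s) (s + h) m (glue - i)"
    and along: "\<lbrakk>b \<in> B; valid s k i; valid s k (i + 1)\<rbrakk> \<Longrightarrow> linked G (pos b s k i) (pos b s k (i + 1))"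
    and turn: "\<lbrakk>b \<in> B; valid s k (len s k - 1); valid (s + 1) (k - 1) 0\<rbrakk> \<Longrightarrow>
      linked G (pos b s k (len s k - 1)) (pos b (s + 1) (k - 1) 0)"
    and classify: "linked G v w \<Longrightarrow> \<exists>b s k i s' k' i'. b \<in> B \<and> valid s k i \<and> valid s' k' i' \<and>
      (v = pos b s k i \<and> w = pos b s' k' i' \<or> w = pos b s k i \<and> v = pos b s' k' i') \<and>
      (s' = s \<and> k' = k \<and> i' = i + 1 \<or>
       s' = s + 1 \<and> k' = k - 1 \<and> i = len s k - 1 \<and> i' = 0 \<or>
       s' = s \<and> k' = k + 1 \<and> (i' = i \<or> i' = i + 1) \<or>
       s' = s + 1 \<and> k' = k \<and> i = len s k - 1 \<and> (i' = 0 \<or> k = m \<and> i' = -1) \<or>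
       s' = s + 2 \<and> k' = k - 1 \<and> idx s k i = t - 1 \<and> idx s' k' i' = t - 1 \<or>
       tips \<and> s' = s + 2 \<and> k' = k \<and> idx s k i = t - 1 \<and> idx s' k' i' = t - 1)"
begin

lemma valid_cong: "s mod K = s' mod K \<Longrightarrow> valid s k i \<longleftrightarrow> valid s' k i"
  unfolding valid_def using periodic(1)[of s] periodic(1)[of s'] periodic(3)[of s] periodic(3)[of s']
  by simp

lemma idx_cong: "s mod K = s' mod K \<Longrightarrow> idx s k i = idx s' k i"
  unfolding idx_def using periodic(2)[of s] periodic(2)[of s'] by simp

lemma pos_cong: "s mod K = s' mod K \<Longrightarrow> pos b s k i = pos b s' k i"
  using periodic(5)[of b s] periodic(5)[of b s'] by simp

lemma neighbour_cong: "s mod K = s' mod K \<Longrightarrow> neighbour b s = neighbour b s'"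
  using periodic(4)[of b s] periodic(4)[of b s'] by simp

lemma T_nonneg: "0 \<le> k \<Longrightarrow> 0 \<le> T s k"
proof (induction k arbitrary: s rule: int_ge_induct)
  case (step k)
  then show ?case using T_step[of "k + 1" s] len(1)[of "k + 1" s] by simp
qed (simp add: T_0)

lemma T_inner: "k' \<le> k \<Longrightarrow> 0 \<le> k' \<Longrightarrow> T (s + k - k') k' \<le> T s k"
proof (induction k arbitrary: s rule: int_ge_induct)
  case (step k)
  have "T (s + (k + 1) - k') k' = T ((s + 1) + k - k') k'" by (simp add: algebra_simps)
  moreover have "T (s + 1 + k - k') k' \<le> T (s + 1) k" using step.IH[of "s + 1"] step.prems by simp
  ultimately show ?case using step.hyps step.prems T_step[of "k + 1" s] len(1)[of "k + 1" s] by simp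
qed simp

text \<open>
  The layers come one after the other along a strand.
\<close>
lemma idx_increasing:
  assumes "valid s1 k1 i1" "valid s2 k2 i2" "s1 + k1 = s2 + k2" "k2 < k1"
  shows "idx s1 k1 i1 < idx s2 k2 i2"
proof -
  have "idx s1 k1 i1 < t - T (s1 + 1) (k1 - 1)"
    using assms(1) T_step[of k1 s1] unfolding idx_def valid_def by simp
  moreover have "T (s1 + 1 + (k1 - 1) - k2) k2 \<le> T (s1 + 1) (k1 - 1)"
    using assms unfolding valid_def by (intro T_inner) auto
  moreover have "s1 + 1 + (k1 - 1) - k2 = s2" using assms(3) by simp
  moreover have "0 \<le> i2" using assms unfolding valid_def by auto
  ultimately show ?thesis unfolding idx_def by simp
qed

lemma idx_inject:
  assumes "valid s1 k1 i1" "valid s2 k2 i2" "s1 + k1 = s2 + k2" "idx s1 k1 i1 = idx s2 k2 i2"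
  shows "k1 = k2 \<and> i1 = i2"
proof -
  have "k1 = k2"
    using idx_increasing[OF assms(1-3)] idx_increasing[OF assms(2,1) assms(3)[symmetric]] assms(4)
    by linarith
  then show ?thesis using assms(3,4) unfolding idx_def by simp
qed

lemma idx_exists:
  assumes "0 \<le> k" "k \<le> m" "t - T s k \<le> I" "I < t"
  shows "\<exists>k' i. 1 \<le> k' \<and> k' \<le> k \<and> 0 \<le> i \<and> valid (s + k - k') k' i \<and> idx (s + k - k') k' i = I"
  using assms
proof (induction k arbitrary: s rule: int_ge_induct)
  case (step k)
  show ?case
  proof (cases "I < t - T (s + 1) k")
    case True
    then show ?thesis
      using step.prems step.hyps T_step[of "k + 1" s]
      by (intro exI[of _ "k + 1"] exI[of _ "I - (t - T s (k + 1))"]) (auto simp: idx_def valid_def)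
  next
    case False
    then obtain k' i where "1 \<le> k'" "k' \<le> k" "0 \<le> i" "valid (s + 1 + k - k') k' i" "idx (s + 1 + k - k') k' i = I"
      using step.IH[of "s + 1"] step.prems by auto
    then show ?thesis by (intro exI[of _ k'] exI[of _ i]) (simp add: algebra_simps)
  qed
qed (simp add: T_0)

text \<open>
  Here \<open>\<sigma>\<close> is the side on which the strand meets the outermost layer.
\<close>
definition on_strand :: "'b \<Rightarrow> int \<Rightarrow> int \<Rightarrow> 'v \<Rightarrow> bool" where
  "on_strand b \<sigma> I v \<longleftrightarrow> (\<exists>k i. valid (\<sigma> + m - k) k i \<and> I = idx (\<sigma> + m - k) k i \<and> v = pos b (\<sigma> + m - k) k i)"

lemma on_strandI:
  assumes "valid s k i" "s mod K = (\<sigma> + m - k) mod K"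
  shows "on_strand b \<sigma> (idx s k i) (pos b s k i)"
  unfolding on_strand_def using assms valid_cong[OF assms(2)] idx_cong[OF assms(2)] pos_cong[OF assms(2)]
  by blast

lemma on_strand_cong: "\<sigma> mod K = \<sigma>' mod K \<Longrightarrow> on_strand b \<sigma> = on_strand b \<sigma>'"
proof -
  have *: "on_strand b \<tau>' I v" if "\<tau> mod K = \<tau>' mod K" "on_strand b \<tau> I v" for \<tau> \<tau>' I v
  proof -
    obtain k i where "valid (\<tau> + m - k) k i" "I = idx (\<tau> + m - k) k i" "v = pos b (\<tau> + m - k) k i"
      using \<open>on_strand b \<tau> I v\<close> unfolding on_strand_def by blast
    moreover have "(\<tau> + m - k) mod K = (\<tau>' + m - k) mod K"
      using that(1) by (metis add_diff_eq mod_add_cong)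
    ultimately show ?thesis using on_strandI by blast
  qed
  assume "\<sigma> mod K = \<sigma>' mod K"
  then show ?thesis using *[of \<sigma> \<sigma>'] *[of \<sigma>' \<sigma>] by (intro ext) auto
qed

lemma on_strand_unique: "on_strand b \<sigma> I v \<Longrightarrow> on_strand b \<sigma> I v' \<Longrightarrow> v = v'"
  unfolding on_strand_def
proof (elim exE conjE)
  fix k i k' i'
  assume "valid (\<sigma> + m - k) k i" "I = idx (\<sigma> + m - k) k i" "v = pos b (\<sigma> + m - k) k i"
    "valid (\<sigma> + m - k') k' i'" "I = idx (\<sigma> + m - k') k' i'" "v' = pos b (\<sigma> + m - k') k' i'"
  then show "v = v'" using idx_inject[of "\<sigma> + m - k" k i "\<sigma> + m - k'" k' i'] by simp
qed

lemma on_strand_lower: "valid s k i \<Longrightarrow> t - T (s + k - m) m - extra (s + k - m) \<le> idx s k i"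
proof (cases "k = m")
  case False
  assume v: "valid s k i"
  then have "T (s + k - m + m - k) k \<le> T (s + k - m) m" using False by (intro T_inner) (auto simp: valid_def)
  then show ?thesis using v False extra(1)[of "s + k - m"] unfolding valid_def idx_def by simp
next
  case True
  then show "valid s k i \<Longrightarrow> ?thesis" using extra(1)[of s] unfolding valid_def idx_def by auto
qed

lemma idx_range:
  assumes "valid s k i"
  shows "0 \<le> idx s k i" "idx s k i < t"
proof -
  show "0 \<le> idx s k i" using on_strand_lower[OF assms] extra(2)[of "s + k - m"] by simp
  show "idx s k i < t"
    using assms T_step[of k s] T_nonneg[of "k - 1" "s + 1"] unfolding valid_def idx_def by simp
qed

lemma len_bar: "len s m = glue + 1 + extra (s + h)"
proof -
  have "(s + h + h) mod K = s mod K" unfolding K_def by (simp add: algebra_simps)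
  then have "len (s + h + h) m = len s m" using periodic(1)[of "s + h + h"] periodic(1)[of s] by simp
  then show ?thesis using bar_length[of "s + h"] by simp
qed

text \<open>
  The strands that start from a bar on its two sides have exactly the cells of the bar in common,
  because of the length of the tile.
\<close>
lemma on_strand_glue:
  assumes b: "b \<in> B" and v: "on_strand b \<sigma> I v" and w: "on_strand (neighbour b \<sigma>) (\<sigma> + h) (t - 1 - I) w"
  shows "v = w"
proof -
  obtain k i where 1: "valid (\<sigma> + m - k) k i" "I = idx (\<sigma> + m - k) k i" "v = pos b (\<sigma> + m - k) k i"
    using v unfolding on_strand_def by blast
  obtain k' i' where 2: "valid (\<sigma> + h + m - k') k' i'" "t - 1 - I = idx (\<sigma> + h + m - k') k' i'"
    "w = pos (neighbour b \<sigma>) (\<sigma> + h + m - k') k' i'"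
    using w unfolding on_strand_def by blast
  have lo: "t - T \<sigma> m - extra \<sigma> \<le> I" "t - T (\<sigma> + h) m - extra (\<sigma> + h) \<le> t - 1 - I"
    using on_strand_lower[OF 1(1)] on_strand_lower[OF 2(1)] 1 2 by simp_all
  have bar: "len \<sigma> m = glue + 1 + extra (\<sigma> + h)" "len (\<sigma> + h) m = glue + 1 + extra \<sigma>"
    using len_bar bar_length by simp_all
  have high: "t - T \<tau> m + len \<tau> m \<le> idx (\<tau> + m - j) j p" if "valid (\<tau> + m - j) j p" "j < m" for \<tau> j p
  proof -
    have "T (\<tau> + 1 + (m - 1) - j) j \<le> T (\<tau> + 1) (m - 1)" using that by (intro T_inner) (auto simp: valid_def)
    then show ?thesis using T_step[OF m, of \<tau>] that unfolding valid_def idx_def by simp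
  qed
  have "\<not> k < m" using high[OF 1(1)] 1(2) lo(2) tile_length[of \<sigma>] bar by linarith
  then have k: "k = m" using 1 unfolding valid_def by simp
  have "\<not> k' < m" using high[of "\<sigma> + h" k' i'] 2 lo(1) tile_length[of \<sigma>] bar by linarith
  then have k': "k' = m" using 2 unfolding valid_def by simp
  have "i' = glue - i" using 1(2) 2(2) k k' tile_length[of \<sigma>] unfolding idx_def by simp
  then show ?thesis using shared_bar[OF b, of \<sigma> i] 1 2 k k' by simp
qed

lemma on_strand_exists:
  assumes "t - T \<sigma> m - extra \<sigma> \<le> I" "I < t"
  obtains k i where "valid (\<sigma> + m - k) k i" "idx (\<sigma> + m - k) k i = I"
proof (cases "t - T \<sigma> m \<le> I")
  case True
  then show ?thesis using idx_exists[of m \<sigma> I] m assms(2) that by auto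
next
  case False
  have "valid (\<sigma> + m - m) m (I - (t - T \<sigma> m))"
    using False assms m len(3)[of \<sigma>] unfolding valid_def by simp
  then show ?thesis by (rule that) (simp add: idx_def)
qed

text \<open>
  A pair of a block and a side stands for the end of a tile in the centre of that block. The other
  half of the tile leaves the same bar into the neighbouring block.
\<close>
definition far_end :: "'b \<times> int \<Rightarrow> 'b \<times> int" where
  "far_end x = (neighbour (fst x) (snd x), (snd x + h) mod K)"

text \<open>
  An index of the tile belongs to the strand in the one block, to the strand in the other block (with
  reversed numbering), or, on the bar, to both; in the last case they agree.
\<close>
definition path :: "'b \<times> int \<Rightarrow> int \<Rightarrow> 'v" where
  "path x I = (THE v. on_strand (fst x) (snd x) I v \<or>
    on_strand (neighbour (fst x) (snd x)) (snd x + h) (t - 1 - I) v)"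

lemma path_eqI:
  assumes "b \<in> B" "on_strand b \<sigma> I v \<or> on_strand (neighbour b \<sigma>) (\<sigma> + h) (t - 1 - I) v"
  shows "path (b, \<sigma>) I = v"
  unfolding path_def
proof (rule the_equality)
  show "on_strand (fst (b, \<sigma>)) (snd (b, \<sigma>)) I v \<or>
    on_strand (neighbour (fst (b, \<sigma>)) (snd (b, \<sigma>))) (snd (b, \<sigma>) + h) (t - 1 - I) v" using assms(2) by simp
  fix w assume "on_strand (fst (b, \<sigma>)) (snd (b, \<sigma>)) I w \<or>
    on_strand (neighbour (fst (b, \<sigma>)) (snd (b, \<sigma>))) (snd (b, \<sigma>) + h) (t - 1 - I) w"
  then show "w = v"
    using assms on_strand_unique on_strand_glue by (metis fst_conv snd_conv)
qed

lemma path_cases: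
  assumes "b \<in> B" "0 \<le> I" "I < t"
  obtains "on_strand b \<sigma> I (path (b, \<sigma>) I)"
    | "on_strand (neighbour b \<sigma>) (\<sigma> + h) (t - 1 - I) (path (b, \<sigma>) I)"
proof (cases "t - T \<sigma> m \<le> I")
  case True
  obtain k i where "valid (\<sigma> + m - k) k i" "idx (\<sigma> + m - k) k i = I"
    by (rule on_strand_exists[of \<sigma> I]) (use True assms extra(1)[of \<sigma>] in auto)
  then have "on_strand b \<sigma> I (pos b (\<sigma> + m - k) k i)"
    using on_strandI[of "\<sigma> + m - k" k i \<sigma> b] by simp
  from this path_eqI[OF assms(1) disjI1[OF this]] show ?thesis using that(1) by simp
next
  case False
  obtain k i where "valid (\<sigma> + h + m - k) k i" "idx (\<sigma> + h + m - k) k i = t - 1 - I"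
    by (rule on_strand_exists[of "\<sigma> + h" "t - 1 - I"])
      (use False assms extra(1)[of "\<sigma> + h"] tile_length[of \<sigma>] glue in auto)
  then have "on_strand (neighbour b \<sigma>) (\<sigma> + h) (t - 1 - I) (pos (neighbour b \<sigma>) (\<sigma> + h + m - k) k i)"
    using on_strandI[of "\<sigma> + h + m - k" k i "\<sigma> + h" "neighbour b \<sigma>"] by simp
  from this path_eqI[OF assms(1) disjI2[OF this]] show ?thesis using that(2) by simp
qed

lemma pos_on_path:
  assumes "b \<in> B" "valid s k i" "(s + k - m) mod K = \<sigma> mod K"
  shows "pos b s k i = path (b, \<sigma>) (idx s k i)"
proof -
  have "(\<sigma> + m - k) mod K = s mod K"
    using mod_add_cong[OF assms(3), of "m - k" "m - k"] by (simp add: algebra_simps)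
  then have "on_strand b \<sigma> (idx s k i) (pos b s k i)" using on_strandI[OF assms(2)] by simp
  from path_eqI[OF assms(1) disjI1[OF this]] show ?thesis by simp
qed

lemma mod_h_twice: "(s + h + h) mod K = s mod K"
  unfolding K_def by (simp add: algebra_simps)

lemma K_pos: "0 < K" unfolding K_def using h by simp

lemma far_end_far_end: "x \<in> B \<times> {0..<K} \<Longrightarrow> far_end (far_end x) = x"
proof -
  assume x: "x \<in> B \<times> {0..<K}"
  then obtain b \<sigma> where [simp]: "x = (b, \<sigma>)" and b: "b \<in> B" "0 \<le> \<sigma>" "\<sigma> < K" by auto
  have "((\<sigma> + h) mod K + h) mod K = \<sigma>"
    using mod_h_twice[of \<sigma>] b by (simp add: mod_add_left_eq)
  moreover have "neighbour (neighbour b \<sigma>) ((\<sigma> + h) mod K) = b"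
    using neighbour_cong[of "(\<sigma> + h) mod K" "\<sigma> + h"] neighbour(2)[OF b(1)] by simp
  ultimately show ?thesis by (simp add: far_end_def)
qed

lemma far_end_in: "x \<in> B \<times> {0..<K} \<Longrightarrow> far_end x \<in> B \<times> {0..<K}"
  using neighbour(1) K_pos by (auto simp: far_end_def)

lemma far_end_neq: "x \<in> B \<times> {0..<K} \<Longrightarrow> far_end x \<noteq> x"
  using neighbour(3) by (cases x) (auto simp: far_end_def)

lemma path_reverse:
  assumes "x \<in> B \<times> {0..<K}"
  shows "path (far_end x) I = path x (t - 1 - I)"
proof -
  obtain b \<sigma> where [simp]: "x = (b, \<sigma>)" and b: "b \<in> B" using assms by auto
  let ?\<tau> = "(\<sigma> + h) mod K"
  have 1: "on_strand (neighbour b \<sigma>) ?\<tau> = on_strand (neighbour b \<sigma>) (\<sigma> + h)" by (rule on_strand_cong) simp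
  have 2: "neighbour (neighbour b \<sigma>) ?\<tau> = b" using neighbour_cong[of ?\<tau> "\<sigma> + h"] neighbour(2)[OF b] by simp
  have "(?\<tau> + h) mod K = \<sigma> mod K" using mod_h_twice[of \<sigma>] by (simp add: mod_add_left_eq)
  then have 3: "on_strand b (?\<tau> + h) = on_strand b \<sigma>" by (rule on_strand_cong)
  show ?thesis by (simp add: path_def far_end_def 1 2 3 disj_commute)
qed

definition same_place :: "'b \<times> int \<Rightarrow> int \<Rightarrow> 'b \<times> int \<Rightarrow> int \<Rightarrow> bool" where
  "same_place x i y j \<longleftrightarrow> y = x \<and> j = i \<or> y = far_end x \<and> j = t - 1 - i"

lemma on_strand_same:
  assumes b: "b \<in> B" "b' \<in> B" and \<sigma>: "\<sigma> \<in> {0..<K}" "\<sigma>' \<in> {0..<K}"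
    and on: "on_strand b \<sigma> I v" "on_strand b' \<sigma>' I' v"
  shows "same_place (b, \<sigma>) I (b', \<sigma>') I'"
proof -
  obtain k i where 1: "valid (\<sigma> + m - k) k i" "I = idx (\<sigma> + m - k) k i" "v = pos b (\<sigma> + m - k) k i"
    using on unfolding on_strand_def by blast
  obtain k' i' where 2: "valid (\<sigma>' + m - k') k' i'" "I' = idx (\<sigma>' + m - k') k' i'" "v = pos b' (\<sigma>' + m - k') k' i'"
    using on unfolding on_strand_def by blast
  have "pos b (\<sigma> + m - k) k i = pos b' (\<sigma>' + m - k') k' i'" using 1 2 by simp
  from same_cell[OF b 1(1) 2(1) this] show ?thesis
  proof
    assume *: "b' = b \<and> (\<sigma>' + m - k') mod K = (\<sigma> + m - k) mod K \<and> k' = k \<and> i' = i"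
    then have "(\<sigma>' + m - k + (k - m)) mod K = (\<sigma> + m - k + (k - m)) mod K" by (metis mod_add_cong)
    then have "\<sigma>' = \<sigma>" using \<sigma> by simp
    then show ?thesis using * 1 2 unfolding same_place_def by simp
  next
    assume *: "k = m \<and> k' = m \<and> b' = neighbour b (\<sigma> + m - k) \<and> (\<sigma>' + m - k') mod K = (\<sigma> + m - k + h) mod K \<and> i' = glue - i"
    then have s: "\<sigma>' mod K = (\<sigma> + h) mod K" "k = m" "k' = m" "b' = neighbour b \<sigma>" "i' = glue - i" by auto
    then have "T \<sigma>' m = T (\<sigma> + h) m" using periodic(2)[of \<sigma>'] periodic(2)[of "\<sigma> + h"] by simp
    then have "I' = t - 1 - I" using s 1(2) 2(2) tile_length[of \<sigma>] unfolding idx_def by simp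
    then show ?thesis using s \<sigma> unfolding same_place_def far_end_def by simp
  qed
qed

lemma path_on_some_strand:
  assumes x: "x \<in> B \<times> {0..<K}" and I: "0 \<le> I" "I < t"
  obtains b \<sigma> J where "b \<in> B" "\<sigma> \<in> {0..<K}" "on_strand b \<sigma> J (path x I)" "same_place x I (b, \<sigma>) J"
proof -
  obtain b \<sigma> where [simp]: "x = (b, \<sigma>)" and b: "b \<in> B" "\<sigma> \<in> {0..<K}" using x by auto
  show thesis
  proof (rule path_cases[OF b(1) I, of \<sigma>])
    assume "on_strand b \<sigma> I (path (b, \<sigma>) I)"
    then show thesis using that[of b \<sigma> I] b by (simp add: same_place_def)
  next
    assume "on_strand (neighbour b \<sigma>) (\<sigma> + h) (t - 1 - I) (path (b, \<sigma>) I)"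
    then have "on_strand (neighbour b \<sigma>) ((\<sigma> + h) mod K) (t - 1 - I) (path x I)"
      using on_strand_cong[of "(\<sigma> + h) mod K" "\<sigma> + h"] by simp
    then show thesis
      using that[of "neighbour b \<sigma>" "(\<sigma> + h) mod K" "t - 1 - I"] neighbour(1)[OF b(1)] K_pos
      by (simp add: same_place_def far_end_def)
  qed
qed

lemma path_inj:
  assumes x: "x \<in> B \<times> {0..<K}" and y: "y \<in> B \<times> {0..<K}"
    and "i \<in> {0..<t}" "j \<in> {0..<t}" "path x i = path y j"
  shows "y = x \<and> j = i \<or> y = far_end x \<and> j = t - 1 - i"
proof -
  obtain b \<sigma> I where 1: "b \<in> B" "\<sigma> \<in> {0..<K}" "on_strand b \<sigma> I (path x i)" "same_place x i (b, \<sigma>) I"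
    using path_on_some_strand[OF x, of i] assms(3) by auto
  obtain b' \<sigma>' I' where 2: "b' \<in> B" "\<sigma>' \<in> {0..<K}" "on_strand b' \<sigma>' I' (path x i)" "same_place y j (b', \<sigma>') I'"
    using path_on_some_strand[OF y, of j] assms(4,5) by auto
  have "same_place (b, \<sigma>) I (b', \<sigma>') I'" using on_strand_same 1 2 by blast
  then show ?thesis
    using 1(4) 2(4) far_end_far_end[OF x] far_end_far_end[OF y] unfolding same_place_def
    by (elim disjE conjE) auto
qed

lemma path_consecutive_near:
  assumes b: "b \<in> B" and I: "t - T \<sigma> m - extra \<sigma> \<le> I" "I + 1 < t"
  shows "linked G (path (b, \<sigma>) I) (path (b, \<sigma>) (I + 1))"
proof -
  obtain k i where 1: "valid (\<sigma> + m - k) k i" "idx (\<sigma> + m - k) k i = I"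
    using on_strand_exists[of \<sigma> I] I by auto
  let ?s = "\<sigma> + m - k"
  have v: "path (b, \<sigma>) I = pos b ?s k i"
    using pos_on_path[OF b 1(1), of \<sigma>] 1(2) by simp
  show ?thesis
  proof (cases "i + 1 < len ?s k")
    case True
    then have 2: "valid ?s k (i + 1)" using 1 unfolding valid_def by auto
    have "path (b, \<sigma>) (I + 1) = pos b ?s k (i + 1)"
      using pos_on_path[OF b 2, of \<sigma>] 1(2) unfolding idx_def by (simp add: algebra_simps)
    then show ?thesis using along[OF b 1(1) 2] v by simp
  next
    case False
    then have i: "i = len ?s k - 1" using 1 unfolding valid_def by simp
    have k1: "1 \<le> k" "k \<le> m" using 1 unfolding valid_def by auto
    have e: "I + 1 = t - T (?s + 1) (k - 1)" using 1(2) i T_step[OF k1(1), of ?s] unfolding idx_def by simp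
    then have pos: "0 < T (?s + 1) (k - 1)" using I by simp
    then have "k - 1 \<noteq> 0" using T_0 by auto
    then have "1 \<le> len (?s + 1) (k - 1)"
      using pos len(2)[of "k - 1" "?s + 1"] T_step[of "k - 1" "?s + 1"] T_0 k1 by (cases "k = 2") auto
    then have 2: "valid (?s + 1) (k - 1) 0" using k1 \<open>k - 1 \<noteq> 0\<close> unfolding valid_def by simp
    have "path (b, \<sigma>) (I + 1) = pos b (?s + 1) (k - 1) 0"
      using pos_on_path[OF b 2, of \<sigma>] e unfolding idx_def by simp
    then show ?thesis using turn[OF b _ 2] 1(1) i v by simp
  qed
qed

lemma path_consecutive:
  assumes x: "x \<in> B \<times> {0..<K}" and I: "0 \<le> I" "I + 1 < t"
  shows "linked G (path x I) (path x (I + 1))"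
proof -
  obtain b \<sigma> where [simp]: "x = (b, \<sigma>)" and b: "b \<in> B" "\<sigma> \<in> {0..<K}" using x by auto
  show ?thesis
  proof (cases "t - T \<sigma> m - extra \<sigma> \<le> I")
    case True
    then show ?thesis using path_consecutive_near[OF b(1) True I(2)] by simp
  next
    case False
    let ?y = "far_end x" and ?J = "t - 2 - I"
    have "T (snd ?y) m = T (\<sigma> + h) m" "extra (snd ?y) = extra (\<sigma> + h)"
      using periodic(2)[of "\<sigma> + h"] periodic(3)[of "\<sigma> + h"] by (simp_all add: far_end_def)
    then have "t - T (snd ?y) m - extra (snd ?y) \<le> ?J"
      using False tile_length[of \<sigma>] glue extra(1)[of \<sigma>] extra(1)[of "\<sigma> + h"] by simp
    then have "linked G (path ?y ?J) (path ?y (?J + 1))"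
      using path_consecutive_near[of "fst ?y" "snd ?y" ?J] far_end_in[OF x] I by (auto simp: mem_Times_iff)
    then show ?thesis
      using path_reverse[OF x, of ?J] path_reverse[OF x, of "?J + 1"]
      by (intro linked_sym[of G "path x (I + 1)"]) (simp add: algebra_simps)
  qed
qed

text \<open>
  The edges between strand \<open>\<sigma>\<close> and strand \<open>\<sigma> + 1\<close> of a block. The first disjunct allows for an edge between
  the tips, the others are the edges from a side to the layer outside and from the end of a side
  to the next side.
\<close>
definition crossing :: "int \<Rightarrow> int \<Rightarrow> int \<Rightarrow> bool" where
  "crossing \<sigma> I J \<longleftrightarrow> I = t - 1 \<and> J = t - 1 \<or>
    (\<exists>k i k' i'. valid (\<sigma> + m - k) k i \<and> valid (\<sigma> + 1 + m - k') k' i' \<and>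
      I = idx (\<sigma> + m - k) k i \<and> J = idx (\<sigma> + 1 + m - k') k' i' \<and>
      (k' = k + 1 \<and> (i' = i \<or> i' = i + 1) \<or>
       k' = k \<and> i = len (\<sigma> + m - k) k - 1 \<and> (i' = 0 \<or> k = m \<and> i' = - 1)))"

text \<open>
  In a hexagonal block three strands have their tips in the innermost layer and touch mutually there, which
  adds edges from strand \<open>\<sigma>\<close> to strand \<open>\<sigma> + 2\<close>.
\<close>
definition across :: "'b \<times> int \<Rightarrow> 'b \<times> int \<Rightarrow> int \<Rightarrow> int \<Rightarrow> bool" where
  "across x y I J \<longleftrightarrow> fst y = fst x \<and>
    (snd y = (snd x + 1) mod K \<and> crossing (snd x) I J \<or>
     tips \<and> snd y = (snd x + 2) mod K \<and> I = t - 1 \<and> J = t - 1)"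

text \<open>
  Strand \<open>\<sigma>\<close> is first touched by strand \<open>\<sigma> + 1\<close> at the end of its bar, and there the bar of strand
  \<open>\<sigma> + 1\<close> begins.
\<close>
lemma crossing_late:
  assumes "crossing \<sigma> I J"
  shows "t - T \<sigma> m + len \<sigma> m - 1 \<le> I \<and> t - T (\<sigma> + 1) m - extra (\<sigma> + 1) \<le> J"
  using assms unfolding crossing_def
proof (elim disjE exE)
  assume "I = t - 1 \<and> J = t - 1"
  moreover have "len \<sigma> m \<le> T \<sigma> m" using T_step[OF m, of \<sigma>] T_nonneg[of "m - 1" "\<sigma> + 1"] m by simp
  moreover have "1 \<le> T (\<sigma> + 1) m"
    using T_step[OF m, of "\<sigma> + 1"] T_nonneg[of "m - 1" "\<sigma> + 1 + 1"] m len(3)[of "\<sigma> + 1"] by simp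
  ultimately show ?thesis using extra(1)[of "\<sigma> + 1"] by simp
next
  fix k i k' i'
  assume *: "valid (\<sigma> + m - k) k i \<and> valid (\<sigma> + 1 + m - k') k' i' \<and>
      I = idx (\<sigma> + m - k) k i \<and> J = idx (\<sigma> + 1 + m - k') k' i' \<and>
      (k' = k + 1 \<and> (i' = i \<or> i' = i + 1) \<or>
       k' = k \<and> i = len (\<sigma> + m - k) k - 1 \<and> (i' = 0 \<or> k = m \<and> i' = - 1))"
  have "t - T \<sigma> m + len \<sigma> m - 1 \<le> I"
  proof (cases "k = m")
    case True
    then show ?thesis using * unfolding valid_def idx_def by auto
  next
    case False
    then have "k < m" using * unfolding valid_def by auto
    then have "valid (\<sigma> + m - m) m (len \<sigma> m - 1)" using m len(3)[of \<sigma>] unfolding valid_def by simp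
    from idx_increasing[OF this, of "\<sigma> + m - k" k i] show ?thesis using * \<open>k < m\<close> unfolding idx_def by simp
  qed
  moreover have "t - T (\<sigma> + 1) m - extra (\<sigma> + 1) \<le> J" using * on_strand_lower[of "\<sigma> + 1 + m - k'" k' i'] by simp
  ultimately show ?thesis by simp
qed

text \<open>
  Strand \<open>\<sigma> + 1\<close> accompanies strand \<open>\<sigma>\<close> one layer further out, in the same direction.
\<close>
lemma crossing_ordered:
  assumes "crossing \<sigma> I J" "crossing \<sigma> I' J'" "I < I'" "I' < t" "J < t"
  shows "J \<le> J'"
proof (cases "I' = t - 1 \<and> J' = t - 1")
  case True then show ?thesis using assms by simp
next
  case False
  then obtain k2 i2 k2' i2' where 2: "valid (\<sigma> + m - k2) k2 i2" "valid (\<sigma> + 1 + m - k2') k2' i2'"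
    "I' = idx (\<sigma> + m - k2) k2 i2" "J' = idx (\<sigma> + 1 + m - k2') k2' i2'"
    "k2' = k2 + 1 \<and> (i2' = i2 \<or> i2' = i2 + 1) \<or>
     k2' = k2 \<and> i2 = len (\<sigma> + m - k2) k2 - 1 \<and> (i2' = 0 \<or> k2 = m \<and> i2' = - 1)"
    using assms(2) unfolding crossing_def by blast
  have "I \<noteq> t - 1" using assms(3,4) by simp
  then obtain k1 i1 k1' i1' where 1: "valid (\<sigma> + m - k1) k1 i1" "valid (\<sigma> + 1 + m - k1') k1' i1'"
    "I = idx (\<sigma> + m - k1) k1 i1" "J = idx (\<sigma> + 1 + m - k1') k1' i1'"
    "k1' = k1 + 1 \<and> (i1' = i1 \<or> i1' = i1 + 1) \<or>
     k1' = k1 \<and> i1 = len (\<sigma> + m - k1) k1 - 1 \<and> (i1' = 0 \<or> k1 = m \<and> i1' = - 1)"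
    using assms(1) unfolding crossing_def by blast
  have outer: "J \<le> J'" if "k2' < k1'"
    using idx_increasing[OF 1(2) 2(2) _ that] 1(4) 2(4) by simp
  have same: "J \<le> J'" if "k2' = k1'" "i1' \<le> i2'"
    using that 1(4) 2(4) unfolding idx_def by simp
  have k: "k2 < k1 \<or> k1 = k2 \<and> i1 < i2"
  proof -
    have "\<not> k1 < k2" using idx_increasing[OF 2(1) 1(1)] assms(3) 1(3) 2(3) by fastforce
    then show ?thesis using assms(3) 1(3) 2(3) unfolding idx_def by (cases "k1 = k2") auto
  qed
  have bounds: "k1' \<le> m" "k2' \<le> m" "k1 \<le> m" "k2 \<le> m" "i2 < len (\<sigma> + m - k2) k2"
    "k2 < m \<longrightarrow> 0 \<le> i2" "k2' < m \<longrightarrow> 0 \<le> i2'"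
    using 1 2 unfolding valid_def by auto
  show ?thesis
    using k
  proof
    assume k: "k2 < k1"
    show ?thesis
      using 1(5) 2(5) k bounds outer same by (cases "k2' < k1'") auto
  next
    assume k: "k1 = k2 \<and> i1 < i2"
    then have "k1' = k1 + 1" "i1' \<le> i1 + 1" using 1(5) bounds by auto
    then show ?thesis
      using 2(5) k bounds outer same by (cases "k2' < k1'") auto
  qed
qed

end

context spiral_blocks
begin

abbreviation ends :: "('b \<times> int) set" where
  "ends \<equiv> B \<times> {0..<K}"

lemma mod_K_shift_neq: "\<not> K dvd d \<Longrightarrow> (s + d) mod K \<noteq> s mod K"
  by (metis add_diff_cancel_left' mod_eq_dvd_iff)

lemma step_not_dvd: "\<not> K dvd 1" "tips \<Longrightarrow> \<not> K dvd 2" "\<not> K dvd 2" "tips \<Longrightarrow> \<not> K dvd 3" "tips \<Longrightarrow> \<not> K dvd 4"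
  using h tips zdvd_not_zless[of 1 K] zdvd_not_zless[of 2 K] zdvd_not_zless[of 3 K] zdvd_not_zless[of 4 K]
  unfolding K_def by auto

lemma acrossE:
  assumes "across (b, \<sigma>) y I J"
  obtains "y = (b, (\<sigma> + 1) mod K)" "crossing \<sigma> I J"
    | "tips" "y = (b, (\<sigma> + 2) mod K)" "I = t - 1" "J = t - 1"
  using assms unfolding across_def by (cases y) auto

lemma across_far_neq:
  assumes x: "(b, \<sigma>) \<in> ends" and a: "across (b, \<sigma>) (b, \<tau>) I J"
  shows "\<tau> \<noteq> \<sigma>" "neighbour b \<tau> \<noteq> neighbour b \<sigma>"
proof -
  have s: "0 \<le> \<sigma>" "\<sigma> < K" "b \<in> B" using x by auto
  show "\<tau> \<noteq> \<sigma>"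
    using a s mod_K_shift_neq[OF step_not_dvd(1), of \<sigma>] mod_K_shift_neq[OF step_not_dvd(3), of \<sigma>]
    by (elim acrossE) auto
  show "neighbour b \<tau> \<noteq> neighbour b \<sigma>"
    using a neighbour(4)[OF s(3), of \<sigma>] neighbour(5)[OF s(3), of \<sigma>] neighbour_cong[of "(\<sigma> + 1) mod K" "\<sigma> + 1" b]
      neighbour_cong[of "(\<sigma> + 2) mod K" "\<sigma> + 2" b]
    by (elim acrossE) auto
qed

lemma across_distinct:
  assumes "x \<in> ends" "across x y I J"
  shows "y \<noteq> x \<and> y \<noteq> far_end x"
proof -
  obtain b \<sigma> \<tau> where [simp]: "x = (b, \<sigma>)" "y = (b, \<tau>)"
    using assms(2) unfolding across_def by (cases x, cases y) auto
  show ?thesis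
    using across_far_neq(1)[of b \<sigma> \<tau> I J] neighbour(3)[of b \<sigma>] assms by (auto simp: far_end_def)
qed

text \<open>
  Two tiles meet in at most one block: the blocks on the far sides of neighbouring bars differ from
  each other and from the block itself.
\<close>
lemma across_unique:
  assumes "x \<in> ends" "y \<in> ends" "across x y I J" "x' \<in> {x, far_end x}" "y' \<in> {y, far_end y}"
    "fst x' = fst y'"
  shows "x' = x \<and> y' = y"
proof -
  obtain b \<sigma> \<tau> where [simp]: "x = (b, \<sigma>)" "y = (b, \<tau>)"
    using assms(3) unfolding across_def by (cases x, cases y) auto
  have "b \<in> B" using assms(1) by simp
  then show ?thesis
    using across_far_neq(2)[of b \<sigma> \<tau> I J] neighbour(3)[of b \<sigma>] neighbour(3)[of b \<tau>] assms
    by (auto simp: far_end_def)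
qed

lemma across_oriented:
  assumes "x \<in> ends" "across x y I J"
  shows "\<not> across y x I' J'"
proof
  assume bw: "across y x I' J'"
  obtain b \<sigma> \<tau> where [simp]: "x = (b, \<sigma>)" "y = (b, \<tau>)"
    using assms(2) unfolding across_def by (cases x, cases y) auto
  have s: "\<sigma> mod K = \<sigma>" using assms(1) by simp
  obtain d where d: "\<tau> = (\<sigma> + d) mod K" "d = 1 \<or> tips \<and> d = 2"
    using assms(2) that unfolding across_def by auto
  obtain e where e: "\<sigma> = (\<tau> + e) mod K" "e = 1 \<or> tips \<and> e = 2"
    using bw that unfolding across_def by auto
  have "(\<sigma> + (d + e)) mod K = ((\<sigma> + d) mod K + e) mod K" by (simp only: mod_add_left_eq add.assoc)
  also have "\<dots> = \<sigma>" by (simp only: d(1)[symmetric] e(1)[symmetric])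
  finally have "(\<sigma> + (d + e)) mod K = \<sigma> mod K" using s by simp
  moreover have "\<not> K dvd d + e" using d(2) e(2) step_not_dvd by auto
  ultimately show False using mod_K_shift_neq by blast
qed

lemma across_late:
  assumes "x \<in> ends" "across x y I0 J0"
  shows "\<exists>\<alpha> \<beta>. 0 \<le> \<alpha> \<and> \<alpha> < t \<and> 0 \<le> \<beta> \<and> \<beta> < t \<and> t < \<alpha> + \<beta> + 2 \<and>
    (\<forall>i\<in>{0..<t}. \<forall>j\<in>{0..<t}. across x y i j \<longrightarrow> \<alpha> \<le> i \<and> \<beta> \<le> j)"
proof -
  obtain b \<sigma> where [simp]: "x = (b, \<sigma>)" by (cases x)
  have ne: "(\<sigma> + 1) mod K \<noteq> (\<sigma> + 2) mod K"
    using mod_K_shift_neq[OF step_not_dvd(1), of "\<sigma> + 1"] by (simp add: algebra_simps)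
  have T1: "1 \<le> T s m" "T s m \<le> t" "len s m \<le> T s m" for s
    using T_step[OF m, of s] T_nonneg[of "m - 1" "s + 1"] m len(3)[of s] extra[of s] by simp_all
  show ?thesis
    using assms(2)[unfolded \<open>x = (b, \<sigma>)\<close>]
  proof (cases rule: acrossE)
    case 1
    have "crossing \<sigma> i j" if "across x y i j" for i j
      using that 1 ne unfolding across_def by auto
    then show ?thesis
      using crossing_late[of \<sigma>] late_start[of \<sigma>] T1[of \<sigma>] T1[of "\<sigma> + 1"] len(3)[of \<sigma>] extra[of "\<sigma> + 1"]
      by (intro exI[of _ "t - T \<sigma> m + len \<sigma> m - 1"] exI[of _ "t - T (\<sigma> + 1) m - extra (\<sigma> + 1)"]) auto
  next
    case 2
    have "i = t - 1 \<and> j = t - 1" if "across x y i j" for i j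
      using that 2(2) ne unfolding across_def by auto
    then show ?thesis
      using T1[of 0] by (intro exI[of _ "t - 1"] exI[of _ "t - 1"]) auto
  qed
qed

lemma across_noncrossing:
  assumes "across x y i j" "across x y i' j'" "i < i'" "i' < t" "j < t"
  shows "j \<le> j'"
proof -
  obtain b \<sigma> where [simp]: "x = (b, \<sigma>)" by (cases x)
  have ne: "(\<sigma> + 1) mod K \<noteq> (\<sigma> + 2) mod K"
    using mod_K_shift_neq[OF step_not_dvd(1), of "\<sigma> + 1"] by (simp add: algebra_simps)
  show ?thesis
    using assms crossing_ordered[of \<sigma> i j i' j'] ne unfolding across_def by auto
qed

lemma pos_path_end:
  assumes "b \<in> B" "valid s k i"
  shows "pos b s k i = path (b, (s + k - m) mod K) (idx s k i)"
  using pos_on_path[OF assms, of "(s + k - m) mod K"] by simp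

lemma crossingI:
  assumes "valid s k i" "valid s' k' i'" "s' + k' = s + k + 1"
    "k' = k + 1 \<and> (i' = i \<or> i' = i + 1) \<or>
       k' = k \<and> i = len s k - 1 \<and> (i' = 0 \<or> k = m \<and> i' = - 1)"
  shows "crossing ((s + k - m) mod K) (idx s k i) (idx s' k' i')"
proof -
  let ?\<sigma> = "(s + k - m) mod K"
  have 1: "(?\<sigma> + m - k) mod K = s mod K"
    using mod_add_left_eq[of "s + k - m" K "m - k"] by (simp add: algebra_simps)
  have "?\<sigma> + 1 + m - k' = ?\<sigma> + (1 + m - k')" "s + k - m + (1 + m - k') = s'"
    using assms(3) by simp_all
  then have 2: "(?\<sigma> + 1 + m - k') mod K = s' mod K"
    by (simp only: mod_add_left_eq)
  have "len (?\<sigma> + m - k) k = len s k"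
    using periodic(1)[of "?\<sigma> + m - k"] periodic(1)[of s] 1 by simp
  then show ?thesis
    unfolding crossing_def
    using assms(1,2,4) valid_cong[OF 1] valid_cong[OF 2] idx_cong[OF 1] idx_cong[OF 2]
    by (intro disjI2 exI[of _ k] exI[of _ i] exI[of _ k'] exI[of _ i']) simp
qed

lemma linked_cases:
  assumes b: "b \<in> B" and v: "valid s k i" "valid s' k' i'"
    and step: "s' = s \<and> k' = k \<and> i' = i + 1 \<or>
       s' = s + 1 \<and> k' = k - 1 \<and> i = len s k - 1 \<and> i' = 0 \<or>
       s' = s \<and> k' = k + 1 \<and> (i' = i \<or> i' = i + 1) \<or>
       s' = s + 1 \<and> k' = k \<and> i = len s k - 1 \<and> (i' = 0 \<or> k = m \<and> i' = -1) \<or>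
       s' = s + 2 \<and> k' = k - 1 \<and> idx s k i = t - 1 \<and> idx s' k' i' = t - 1 \<or>
       tips \<and> s' = s + 2 \<and> k' = k \<and> idx s k i = t - 1 \<and> idx s' k' i' = t - 1"
  shows "(\<exists>x\<in>ends. \<exists>I. 0 \<le> I \<and> I + 1 < t \<and> pos b s k i = path x I \<and> pos b s' k' i' = path x (I + 1)) \<or>
    (\<exists>x\<in>ends. \<exists>y\<in>ends. \<exists>I\<in>{0..<t}. \<exists>J\<in>{0..<t}. across x y I J \<and>
      pos b s k i = path x I \<and> pos b s' k' i' = path y J)"
proof -
  let ?\<sigma> = "(s + k - m) mod K" and ?\<tau> = "(s' + k' - m) mod K"
  let ?I = "idx s k i" and ?J = "idx s' k' i'"
  have p: "pos b s k i = path (b, ?\<sigma>) ?I" "pos b s' k' i' = path (b, ?\<tau>) ?J"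
    using pos_path_end[OF b] v by simp_all
  have r: "?I \<in> {0..<t}" "?J \<in> {0..<t}" using idx_range v by auto
  have e: "(b, ?\<sigma>) \<in> ends" "(b, ?\<tau>) \<in> ends" using b K_pos by auto
  have same: ?thesis if "s' + k' = s + k" "?J = ?I + 1"
    using that p r e by (intro disjI1 bexI[of _ "(b, ?\<sigma>)"] exI[of _ ?I]) auto
  have diff: ?thesis if "across (b, ?\<sigma>) (b, ?\<tau>) ?I ?J"
    using that p r e by blast
  have next1: ?thesis if "s' + k' = s + k + 1" "crossing ?\<sigma> ?I ?J"
  proof (rule diff)
    have "s' + k' - m = s + k - m + 1" using that(1) by simp
    then have "?\<tau> = (?\<sigma> + 1) mod K" by (simp only: mod_add_left_eq)
    then show "across (b, ?\<sigma>) (b, ?\<tau>) ?I ?J"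
      using that(2) unfolding across_def fst_conv snd_conv by blast
  qed
  consider (a) "s' = s" "k' = k" "i' = i + 1" | (b) "s' = s + 1" "k' = k - 1" "i = len s k - 1" "i' = 0"
    | (c) "s' + k' = s + k + 1" "k' = k + 1 \<and> (i' = i \<or> i' = i + 1) \<or>
       k' = k \<and> i = len s k - 1 \<and> (i' = 0 \<or> k = m \<and> i' = - 1)"
    | (d) "s' + k' = s + k + 1" "?I = t - 1" "?J = t - 1"
    | (e) tips "s' + k' = s + k + 2" "?I = t - 1" "?J = t - 1"
    using step by auto
  then show ?thesis
  proof cases
    case a
    then show ?thesis by (intro same) (auto simp: idx_def)
  next
    case b
    then show ?thesis using v(1) T_step[of k s] by (intro same) (auto simp: idx_def valid_def)
  next
    case c
    then show ?thesis using crossingI[OF v c(1,2)] by (intro next1)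
  next
    case d
    then show ?thesis by (intro next1) (auto simp: crossing_def)
  next
    case e
    have "s' + k' - m = s + k - m + 2" using e(2) by simp
    then have "?\<tau> = (?\<sigma> + 2) mod K" by (simp only: mod_add_left_eq)
    then have "across (b, ?\<sigma>) (b, ?\<tau>) ?I ?J"
      using e unfolding across_def fst_conv snd_conv by blast
    then show ?thesis by (rule diff)
  qed
qed

lemma path_in_pverts:
  assumes "x \<in> ends" "I \<in> {0..<t}"
  shows "path x I \<in> pverts G"
proof -
  have "0 \<le> I" "I < t" using assms(2) by auto
  from path_on_some_strand[OF assms(1) this]
  obtain b \<sigma> J where "b \<in> B" "on_strand b \<sigma> J (path x I)" by blast
  then show ?thesis unfolding cells on_strand_def by blast
qed

sublocale path_tiling G t ends far_end path across
proof
  show "0 < t" using len(3)[of 0] T_step[OF m, of 0] T_nonneg[of "m - 1" "0 + 1"] extra[of 0] m by simp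
  show "pverts G = (\<Union>x\<in>ends. path x ` {0..<t})"
  proof
    show "pverts G \<subseteq> (\<Union>x\<in>ends. path x ` {0..<t})"
    proof
      fix v assume "v \<in> pverts G"
      then obtain b s k i where v: "b \<in> B" "valid s k i" "v = pos b s k i" unfolding cells by blast
      then have "v = path (b, (s + k - m) mod K) (idx s k i)" using pos_path_end by simp
      moreover have "(b, (s + k - m) mod K) \<in> ends" using v K_pos by simp
      moreover have "idx s k i \<in> {0..<t}" using idx_range v by simp
      ultimately show "v \<in> (\<Union>x\<in>ends. path x ` {0..<t})" by blast
    qed
  qed (use path_in_pverts in auto)
  fix x assume x: "x \<in> ends"
  show "far_end x \<in> ends" "far_end (far_end x) = x" "far_end x \<noteq> x"
    using far_end_in[OF x] far_end_far_end[OF x] far_end_neq[OF x] .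
  show "path (far_end x) i = path x (t - 1 - i)" for i by (rule path_reverse[OF x])
  show "linked G (path x i) (path x (i + 1))" if "0 \<le> i" "i + 1 < t" for i
    by (rule path_consecutive[OF x that])
  fix y assume y: "y \<in> ends"
  show "y = x \<and> j = i \<or> y = far_end x \<and> j = t - 1 - i"
    if "i \<in> {0..<t}" "j \<in> {0..<t}" "path x i = path y j" for i j
    by (rule path_inj[OF x y that])
  show "y \<noteq> x \<and> y \<noteq> far_end x" if "across x y i j" for i j
    by (rule across_distinct[OF x that])
  show "x' = x \<and> y' = y" if "across x y i j" "x' \<in> {x, far_end x}" "y' \<in> {y, far_end y}" "across x' y' i' j'"
    for i j x' y' i' j'
    by (rule across_unique[OF x y that(1-3)]) (use that(4) in \<open>simp add: across_def\<close>)
  show "\<not> across y' x' i' j'" if "across x y i j" "x' \<in> {x, far_end x}" "y' \<in> {y, far_end y}" for i j x' y' i' j'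
  proof
    assume a: "across y' x' i' j'"
    then have "x' = x \<and> y' = y" by (intro across_unique[OF x y that]) (simp add: across_def)
    then show False using across_oriented[OF x that(1)] a by simp
  qed
  show "\<exists>\<alpha> \<beta>. 0 \<le> \<alpha> \<and> \<alpha> < t \<and> 0 \<le> \<beta> \<and> \<beta> < t \<and> t < \<alpha> + \<beta> + 2 \<and>
        (\<forall>i\<in>{0..<t}. \<forall>j\<in>{0..<t}. across x y i j \<longrightarrow> \<alpha> \<le> i \<and> \<beta> \<le> j)" if "across x y i0 j0" for i0 j0
    by (rule across_late[OF x that])
  show "j \<le> j'" if "i \<in> {0..<t}" "j \<in> {0..<t}" "i' \<in> {0..<t}" "j' \<in> {0..<t}"
      "across x y i j" "across x y i' j'" "i < i'" for i j i' j'
    using across_noncrossing[OF that(5-7)] that by simp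
next
  fix v w assume "linked G v w"
  from classify[OF this] obtain b s k i s' k' i' where
    *: "b \<in> B" "valid s k i" "valid s' k' i'"
      "v = pos b s k i \<and> w = pos b s' k' i' \<or> w = pos b s k i \<and> v = pos b s' k' i'"
      "s' = s \<and> k' = k \<and> i' = i + 1 \<or>
       s' = s + 1 \<and> k' = k - 1 \<and> i = len s k - 1 \<and> i' = 0 \<or>
       s' = s \<and> k' = k + 1 \<and> (i' = i \<or> i' = i + 1) \<or>
       s' = s + 1 \<and> k' = k \<and> i = len s k - 1 \<and> (i' = 0 \<or> k = m \<and> i' = -1) \<or>
       s' = s + 2 \<and> k' = k - 1 \<and> idx s k i = t - 1 \<and> idx s' k' i' = t - 1 \<or>
       tips \<and> s' = s + 2 \<and> k' = k \<and> idx s k i = t - 1 \<and> idx s' k' i' = t - 1"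
    by (elim exE conjE)
  from linked_cases[OF *(1-3,5)] *(4)
  show "(\<exists>x\<in>ends. \<exists>i. 0 \<le> i \<and> i + 1 < t \<and>
        (v = path x i \<and> w = path x (i + 1) \<or> w = path x i \<and> v = path x (i + 1))) \<or>
      (\<exists>x\<in>ends. \<exists>y\<in>ends. \<exists>i\<in>{0..<t}. \<exists>j\<in>{0..<t}. across x y i j \<and>
        (v = path x i \<and> w = path y j \<or> w = path x i \<and> v = path y j))"
    by (elim disjE) blast+
qed

theorem isolated: "isolated_vertex (metagraph G (nat t)) (tile ` ends)"
  by (rule isolated_vertex_tiles)

end

section \<open>Blocks placed along a lattice\<close>

text \<open>
  For \<open>N = 0\<close> this is the identity, so that the plane is the case \<open>N = 0\<close> of the torus of width \<open>N\<close>.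
\<close>
definition red :: "int \<Rightarrow> int \<times> int \<Rightarrow> int \<times> int" where
  "red N v = (fst v mod N, snd v mod N)"

definition translation_graph :: "int \<Rightarrow> (int \<times> int) set \<Rightarrow> (int \<times> int) pair_pre_digraph" where
  "translation_graph N D = \<lparr> pverts = {v. red N v = v},
     parcs = {(v, w). red N v = v \<and> (\<exists>d\<in>D. w = red N (v + d))} \<rparr>"

lemma red_red [simp]: "red N (red N v) = red N v"
  by (simp add: red_def)

lemma red_add_left [simp]: "red N (red N v + w) = red N (v + w)"
  by (simp add: red_def mod_add_left_eq)

lemma red_diff_left [simp]: "red N (red N v - w) = red N (v - w)"
  by (simp add: red_def mod_diff_left_eq)

lemma red_eqE:
  assumes "red N v = red N w"
  obtains a b where "v = w + (N * a, N * b)"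
proof -
  have "N dvd fst v - fst w" "N dvd snd v - snd w"
    using assms unfolding red_def by (simp_all add: mod_eq_dvd_iff)
  then obtain a b where "fst v - fst w = N * a" "snd v - snd w = N * b" by (elim dvdE) blast
  then have "v = w + (N * a, N * b)" by (simp add: prod_eq_iff algebra_simps)
  then show ?thesis by (rule that)
qed

lemma red_add_multiple [simp]: "red N (v + (N * a, N * b)) = red N v"
  by (simp add: red_def)

text \<open>
  Blocks are the translates of one region by the vectors of a lattice \<open>L\<close>, taken modulo \<open>N\<close>. The cell
  \<open>c s k i\<close> belongs to the block at the origin, and \<open>\<delta> s\<close> is the position of the neighbour on side
  \<open>s\<close>. All assumptions from \<open>c_inj\<close> on speak about the infinite lattice; the quotient enters
  only through \<open>\<delta>_distinct\<close> and through \<open>(N a, N b) \<in> L\<close>.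
\<close>
locale lattice_spiral =
  fixes N t m h glue :: int and tips :: bool
    and len T :: "int \<Rightarrow> int \<Rightarrow> int" and extra :: "int \<Rightarrow> int"
    and L D :: "(int \<times> int) set" and \<delta> :: "int \<Rightarrow> int \<times> int" and c :: "int \<Rightarrow> int \<Rightarrow> int \<Rightarrow> int \<times> int"
    and K :: int and valid :: "int \<Rightarrow> int \<Rightarrow> int \<Rightarrow> bool" and idx :: "int \<Rightarrow> int \<Rightarrow> int \<Rightarrow> int"
    and step :: "int \<Rightarrow> int \<Rightarrow> int \<Rightarrow> int \<Rightarrow> int \<Rightarrow> int \<Rightarrow> bool"
    and region :: "(int \<times> int) set"
  defines "K \<equiv> 2 * h"
    and "valid s k i \<equiv> 1 \<le> k \<and> k \<le> m \<and> i < len s k \<and> (0 \<le> i \<or> k = m \<and> - extra s \<le> i)"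
    and "idx s k i \<equiv> t - T s k + i"
    and "step s k i s' k' i' \<equiv>
       s' mod K = s mod K \<and> k' = k \<and> i' = i + 1 \<or>
       s' mod K = (s + 1) mod K \<and> k' = k - 1 \<and> i = len s k - 1 \<and> i' = 0 \<or>
       s' mod K = s mod K \<and> k' = k + 1 \<and> (i' = i \<or> i' = i + 1) \<or>
       s' mod K = (s + 1) mod K \<and> k' = k \<and> i = len s k - 1 \<and> (i' = 0 \<or> k = m \<and> i' = -1) \<or>
       s' mod K = (s + 2) mod K \<and> k' = k - 1 \<and> idx s k i = t - 1 \<and> idx s' k' i' = t - 1 \<or>
       tips \<and> s' mod K = (s + 2) mod K \<and> k' = k \<and> idx s k i = t - 1 \<and> idx s' k' i' = t - 1"
    and "region \<equiv> {c s k i | s k i. valid s k i}"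
  assumes h: "2 \<le> h" and tips: "tips \<Longrightarrow> h = 3" and m: "1 \<le> m" and glue: "0 \<le> glue"
    and periodic: "len (s mod K) k = len s k" "T (s mod K) k = T s k" "extra (s mod K) = extra s"
      "\<delta> (s mod K) = \<delta> s" "c (s mod K) k i = c s k i"
    and T_0: "T s 0 = 0"
    and T_step: "1 \<le> k \<Longrightarrow> T s k = len s k + T (s + 1) (k - 1)"
    and len: "1 \<le> k \<Longrightarrow> 0 \<le> len s k" "2 \<le> k \<Longrightarrow> 1 \<le> len s k" "1 \<le> len s m"
    and extra: "0 \<le> extra s" "T s m + extra s \<le> t"
    and bar_length: "len (s + h) m = glue + 1 + extra s"
    and tile_length: "T s m + T (s + h) m = t + 1 + glue"
    and late_start: "T s m + T (s + 1) m + extra (s + 1) < t + len s m + 1"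
    and lattice: "v \<in> L \<Longrightarrow> w \<in> L \<Longrightarrow> v + w \<in> L" "v \<in> L \<Longrightarrow> - v \<in> L" "(N * a, N * b) \<in> L"
    and \<delta>: "\<delta> s \<in> L" "\<delta> (s + h) = - \<delta> s"
    and \<delta>_distinct: "red N (\<delta> s) \<noteq> 0" "red N (\<delta> s - \<delta> (s + 1)) \<noteq> 0"
      "tips \<Longrightarrow> red N (\<delta> s - \<delta> (s + 2)) \<noteq> 0"
    and D: "(1, 0) \<in> D" "(0, 1) \<in> D" "d \<in> D \<Longrightarrow> - d \<in> D"
    and c_inj: "\<lbrakk>v \<in> L; valid s k i; valid s' k' i'; c s k i = v + c s' k' i'\<rbrakk> \<Longrightarrow>
      v = 0 \<and> s' mod K = s mod K \<and> k' = k \<and> i' = i \<or>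
      k = m \<and> k' = m \<and> v = \<delta> s \<and> s' mod K = (s + h) mod K \<and> i' = glue - i"
    and c_bar: "valid s m i \<Longrightarrow> c s m i = \<delta> s + c (s + h) m (glue - i)"
    and c_along: "\<lbrakk>valid s k i; valid s k (i + 1)\<rbrakk> \<Longrightarrow> c s k (i + 1) - c s k i \<in> D"
    and c_turn: "\<lbrakk>valid s k (len s k - 1); valid (s + 1) (k - 1) 0\<rbrakk> \<Longrightarrow>
      c (s + 1) (k - 1) 0 - c s k (len s k - 1) \<in> D"
    and c_classify: "\<lbrakk>valid s k i; valid s' k' i'; c s' k' i' - c s k i \<in> D\<rbrakk> \<Longrightarrow>
      step s k i s' k' i' \<or> step s' k' i' s k i"
    and region_step: "\<lbrakk>v \<in> region; d \<in> D; v + d \<notin> region\<rbrakk> \<Longrightarrow>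
      \<exists>s. v - \<delta> s \<in> region \<and> v + d - \<delta> s \<in> region"
begin

lemma L_0: "0 \<in> L"
  using lattice(3)[of 0 0] by (simp add: zero_prod_def)

lemma L_red: "v \<in> L \<Longrightarrow> red N v \<in> L"
proof -
  assume v: "v \<in> L"
  obtain a b where "red N v = v + (N * a, N * b)" by (rule red_eqE[of N "red N v" v]) simp
  then show ?thesis using lattice(1)[OF v lattice(3)] by simp
qed

text \<open>
  The set of covered points is closed under unit steps: a step that leaves a block arrives in a
  neighbouring block.
\<close>
lemma region_cover: "\<exists>v\<in>L. w - v \<in> region"
proof -
  have stp: "\<exists>v\<in>L. w + d - v \<in> region" if extra: "\<exists>v\<in>L. w - v \<in> region" and d: "d \<in> D" for w d
  proof -
    obtain v where v: "v \<in> L" "w - v \<in> region" using extra by blast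
    show ?thesis
    proof (cases "w - v + d \<in> region")
      case True then show ?thesis using v(1) by (intro bexI[of _ v]) (simp_all add: algebra_simps)
    next
      case False
      then obtain s where "w - v + d - \<delta> s \<in> region" using region_step[OF v(2) d] by blast
      then show ?thesis
        using lattice(1)[OF v(1) \<delta>(1)[of s]] by (intro bexI[of _ "v + \<delta> s"]) (simp_all add: algebra_simps)
    qed
  qed
  define w0 where "w0 = c 0 m 0"
  have start: "\<exists>v\<in>L. w0 - v \<in> region"
    using L_0 m len(3)[of 0] unfolding region_def valid_def w0_def
    by (intro bexI[of _ 0] CollectI exI[of _ 0] exI[of _ m]) simp_all
  have Dneg: "(-1, 0) \<in> D" "(0, -1) \<in> D" using D by fastforce+
  have row: "\<exists>v\<in>L. w0 + (x, 0) - v \<in> region" for x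
  proof (induction x rule: int_induct[where k = 0])
    case base then show ?case using start by (simp add: zero_prod_def[symmetric])
  next
    case (step1 x) then show ?case using stp[OF _ D(1), of "w0 + (x, 0)"] by (simp add: add.assoc)
  next
    case (step2 x) then show ?case using stp[OF _ Dneg(1), of "w0 + (x, 0)"] by (simp add: add.assoc)
  qed
  have all: "\<exists>v\<in>L. w0 + (x, y) - v \<in> region" for x y
  proof (induction y rule: int_induct[where k = 0])
    case base then show ?case using row by simp
  next
    case (step1 y) then show ?case using stp[OF _ D(2), of "w0 + (x, y)"] by (simp add: add.assoc)
  next
    case (step2 y) then show ?case using stp[OF _ Dneg(2), of "w0 + (x, y)"] by (simp add: add.assoc)
  qed
  have "w0 + (fst (w - w0), snd (w - w0)) = w" by (simp add: prod_eq_iff)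
  then show ?thesis using all by metis
qed

definition G :: "(int \<times> int) pair_pre_digraph" where
  "G = translation_graph N D"

definition blocks :: "(int \<times> int) set" where
  "blocks = {v \<in> L. red N v = v}"

definition neighbour :: "int \<times> int \<Rightarrow> int \<Rightarrow> int \<times> int" where
  "neighbour b s = red N (b + \<delta> s)"

definition pos :: "int \<times> int \<Rightarrow> int \<Rightarrow> int \<Rightarrow> int \<Rightarrow> int \<times> int" where
  "pos b s k i = red N (b + c s k i)"

lemma red_blocks: "v \<in> L \<Longrightarrow> red N v \<in> blocks"
  unfolding blocks_def using L_red by simp

lemma red_pos: "red N (v + c s k i) = pos (red N v) s k i"
  unfolding pos_def by simp

lemma linked_iff: "linked G v w \<longleftrightarrow>
    red N v = v \<and> (\<exists>d\<in>D. w = red N (v + d)) \<or> red N w = w \<and> (\<exists>d\<in>D. v = red N (w + d))"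
  unfolding linked_def G_def translation_graph_def by simp

lemma linked_posI: "b \<in> blocks \<Longrightarrow> c s' k' i' - c s k i \<in> D \<Longrightarrow> linked G (pos b s k i) (pos b s' k' i')"
  unfolding linked_iff pos_def
  by (intro disjI1 conjI bexI[of _ "c s' k' i' - c s k i"]) simp_all

text \<open>
  Both ends of an edge lie in a common block, namely the block of the first end or a neighbour of
  it, so that edges can be classified within one block.
\<close>
lemma classify_arc:
  assumes "red N v = v" "d \<in> D"
  shows "\<exists>b s k i s' k' i'. b \<in> blocks \<and> valid s k i \<and> valid s' k' i' \<and>
    (step s k i s' k' i' \<or> step s' k' i' s k i) \<and> v = pos b s k i \<and> red N (v + d) = pos b s' k' i'"
proof -
  obtain u where u: "u \<in> L" "v - u \<in> region" using region_cover by blast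
  obtain u' where u': "u' \<in> L" "v - u' \<in> region" "v - u' + d \<in> region"
  proof (cases "v - u + d \<in> region")
    case True then show ?thesis using u that by blast
  next
    case False
    obtain s where "v - u - \<delta> s \<in> region" "v - u + d - \<delta> s \<in> region"
      using region_step[OF u(2) assms(2) False] by blast
    then show ?thesis using that[of "u + \<delta> s"] lattice(1)[OF u(1) \<delta>(1)[of s]] by (simp add: algebra_simps)
  qed
  obtain s k i where r: "valid s k i" "v - u' = c s k i" using u'(2) unfolding region_def by blast
  obtain s' k' i' where r': "valid s' k' i'" "v - u' + d = c s' k' i'" using u'(3) unfolding region_def by blast
  have e: "v = u' + c s k i" "v + d = u' + c s' k' i'" using r(2) r'(2) by (auto simp: algebra_simps)
  have "c s' k' i' - c s k i = d" using r(2) r'(2) by (auto simp: algebra_simps)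
  then have "step s k i s' k' i' \<or> step s' k' i' s k i" using c_classify[OF r(1) r'(1)] assms(2) by simp
  moreover have "v = pos (red N u') s k i" using assms(1) e(1) red_pos by metis
  moreover have "red N (v + d) = pos (red N u') s' k' i'" using e(2) red_pos by metis
  ultimately show ?thesis using red_blocks[OF u'(1)] r(1) r'(1) by blast
qed

lemma blocks_0: "red N v = 0 \<longleftrightarrow> (\<exists>a b. v = (N * a, N * b))"
proof
  assume "red N v = 0"
  then have "red N v = red N 0" by (simp add: red_def zero_prod_def)
  then show "\<exists>a b. v = (N * a, N * b)" by (rule red_eqE) (auto simp: zero_prod_def)
qed (auto simp: red_def zero_prod_def)

lemma red_add_inject: "red N (b + v) = red N (b + w) \<Longrightarrow> red N (v - w) = 0"
  unfolding blocks_0 by (erule red_eqE) (metis add.assoc add_diff_cancel_left' add_left_imp_eq)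

lemma valid_mod: "valid (s mod K) k i \<longleftrightarrow> valid s k i"
  unfolding valid_def by (simp add: periodic)

lemma idx_mod: "idx (s mod K) k i = idx s k i"
  unfolding idx_def by (simp add: periodic)

lemma neighbour_blocks:
  assumes "b \<in> blocks"
  shows "neighbour b s \<in> blocks" "neighbour (neighbour b s) (s + h) = b" "neighbour b s \<noteq> b"
    "neighbour b s \<noteq> neighbour b (s + 1)" "tips \<Longrightarrow> neighbour b s \<noteq> neighbour b (s + 2)"
proof -
  have b: "b \<in> L" "red N b = b" using assms unfolding blocks_def by auto
  show "neighbour b s \<in> blocks"
    using red_blocks lattice(1)[OF b(1) \<delta>(1)] unfolding neighbour_def by blast
  show "neighbour (neighbour b s) (s + h) = b"
    using b \<delta>(2)[of s] unfolding neighbour_def by simp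
  show "neighbour b s \<noteq> b"
  proof
    assume "neighbour b s = b"
    then have "red N (b + \<delta> s) = red N (b + 0)" using b unfolding neighbour_def by simp
    then show False using red_add_inject[of b "\<delta> s" 0] \<delta>_distinct(1)[of s] by simp
  qed
  show "neighbour b s \<noteq> neighbour b (s + 1)"
    using red_add_inject \<delta>_distinct(2) unfolding neighbour_def by blast
  show "neighbour b s \<noteq> neighbour b (s + 2)" if tips
    using red_add_inject \<delta>_distinct(3)[OF that] unfolding neighbour_def by blast
qed

lemma neighbour_pos_mod: "neighbour b (s mod K) = neighbour b s" "pos b (s mod K) k i = pos b s k i"
  using periodic(4,5) unfolding neighbour_def pos_def by simp_all

lemma pverts_G: "pverts G = {pos b s k i |b s k i. b \<in> blocks \<and> valid s k i}"
proof (intro set_eqI iffI)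
  fix v assume "v \<in> pverts G"
  then have v: "red N v = v" unfolding G_def translation_graph_def by simp
  obtain u where u: "u \<in> L" "v - u \<in> region" using region_cover by blast
  then obtain s k i where "valid s k i" "v - u = c s k i" unfolding region_def by blast
  then have "valid s k i" "v = u + c s k i" by (auto simp: algebra_simps)
  then have "v = pos (red N u) s k i" using v red_pos by metis
  then show "v \<in> {pos b s k i |b s k i. b \<in> blocks \<and> valid s k i}"
    using \<open>valid s k i\<close> red_blocks[OF u(1)] by blast
qed (auto simp: G_def translation_graph_def pos_def)

text \<open>
  Equality modulo \<open>N\<close> becomes equality in the plane after a change of the block by a multiple of \<open>N\<close>,
  which is possible since \<open>L\<close> contains these multiples.
\<close>
lemma pos_eq_cases:
  assumes "b \<in> blocks" "b' \<in> blocks" "valid s k i" "valid s' k' i'" and eq: "pos b s k i = pos b' s' k' i'"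
  shows "b' = b \<and> s' mod K = s mod K \<and> k' = k \<and> i' = i \<or>
      k = m \<and> k' = m \<and> b' = neighbour b s \<and> s' mod K = (s + h) mod K \<and> i' = glue - i"
proof -
  obtain x y where xy: "b + c s k i = b' + c s' k' i' + (N * x, N * y)"
    using eq unfolding pos_def by (rule red_eqE)
  define u where "u = b' - b + (N * x, N * y)"
  have b: "b \<in> L" "b' \<in> L" "red N b = b" "red N b' = b'" using assms unfolding blocks_def by auto
  have "u \<in> L" unfolding u_def using lattice(1)[OF lattice(1)[OF b(2) lattice(2)[OF b(1)]] lattice(3)] by simp
  moreover have "c s k i = u + c s' k' i'" using xy unfolding u_def by (simp add: algebra_simps)
  moreover have "red N (b + u) = b'" using b(4) unfolding u_def by (simp add: add.assoc[symmetric])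
  ultimately show ?thesis
    using c_inj[of u s k i s' k' i'] assms(3,4) b(3) unfolding neighbour_def by auto
qed

lemma pos_bar: "b \<in> blocks \<Longrightarrow> valid s m i \<Longrightarrow> pos b s m i = pos (neighbour b s) (s + h) m (glue - i)"
  using c_bar[of s i] unfolding pos_def neighbour_def by (simp add: add.assoc)

lemma pos_along: "b \<in> blocks \<Longrightarrow> valid s k i \<Longrightarrow> valid s k (i + 1) \<Longrightarrow> linked G (pos b s k i) (pos b s k (i + 1))"
  by (rule linked_posI[OF _ c_along])

lemma pos_turn: "b \<in> blocks \<Longrightarrow> valid s k (len s k - 1) \<Longrightarrow> valid (s + 1) (k - 1) 0 \<Longrightarrow>
    linked G (pos b s k (len s k - 1)) (pos b (s + 1) (k - 1) 0)"
  by (rule linked_posI[OF _ c_turn])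

lemma linked_classify:
  assumes "linked G v w"
  shows "\<exists>b s k i s' k' i'. b \<in> blocks \<and> valid s k i \<and> valid s' k' i' \<and>
      (v = pos b s k i \<and> w = pos b s' k' i' \<or> w = pos b s k i \<and> v = pos b s' k' i') \<and>
      (s' = s \<and> k' = k \<and> i' = i + 1 \<or>
       s' = s + 1 \<and> k' = k - 1 \<and> i = len s k - 1 \<and> i' = 0 \<or>
       s' = s \<and> k' = k + 1 \<and> (i' = i \<or> i' = i + 1) \<or>
       s' = s + 1 \<and> k' = k \<and> i = len s k - 1 \<and> (i' = 0 \<or> k = m \<and> i' = -1) \<or>
       s' = s + 2 \<and> k' = k - 1 \<and> idx s k i = t - 1 \<and> idx s' k' i' = t - 1 \<or>
       tips \<and> s' = s + 2 \<and> k' = k \<and> idx s k i = t - 1 \<and> idx s' k' i' = t - 1)"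
proof -
  have arcs: "\<exists>b s k i s' k' i'. b \<in> blocks \<and> valid s k i \<and> valid s' k' i' \<and> step s k i s' k' i' \<and>
      (x = pos b s k i \<and> y = pos b s' k' i' \<or> y = pos b s k i \<and> x = pos b s' k' i')"
    if "red N x = x" "d \<in> D" "y = red N (x + d)" for x y d
    using classify_arc[OF that(1,2)] unfolding that(3)[symmetric] by blast
  have "\<exists>b s k i s' k' i'. b \<in> blocks \<and> valid s k i \<and> valid s' k' i' \<and> step s k i s' k' i' \<and>
      (v = pos b s k i \<and> w = pos b s' k' i' \<or> w = pos b s k i \<and> v = pos b s' k' i')"
    using assms unfolding linked_iff
  proof (elim disjE conjE bexE)
    fix d assume "red N v = v" "d \<in> D" "w = red N (v + d)"
    then show ?thesis by (rule arcs)
  next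
    fix d assume "red N w = w" "d \<in> D" "v = red N (w + d)"
    from arcs[OF this] show ?thesis by blast
  qed
  then obtain b s k i s' k' i' where 1: "b \<in> blocks" "valid s k i" "valid s' k' i'" "step s k i s' k' i'"
    and vw: "v = pos b s k i \<and> w = pos b s' k' i' \<or> w = pos b s k i \<and> v = pos b s' k' i'"
    by (elim exE conjE)
  have pc: "pos b z k' i' = pos b s' k' i' \<and> valid z k' i' \<and> idx z k' i' = idx s' k' i'"
    if "s' mod K = z mod K" for z
    using that 1(3) valid_mod[of z] valid_mod[of s'] idx_mod[of z] idx_mod[of s'] periodic(5)[of z] periodic(5)[of s']
    unfolding pos_def by simp
  obtain j where j: "s' mod K = (s + j) mod K"
      "j = 0 \<and> k' = k \<and> i' = i + 1 \<or>
       j = 1 \<and> k' = k - 1 \<and> i = len s k - 1 \<and> i' = 0 \<or>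
       j = 0 \<and> k' = k + 1 \<and> (i' = i \<or> i' = i + 1) \<or>
       j = 1 \<and> k' = k \<and> i = len s k - 1 \<and> (i' = 0 \<or> k = m \<and> i' = -1) \<or>
       j = 2 \<and> k' = k - 1 \<and> idx s k i = t - 1 \<and> idx s' k' i' = t - 1 \<or>
       tips \<and> j = 2 \<and> k' = k \<and> idx s k i = t - 1 \<and> idx s' k' i' = t - 1"
    using 1(4) that[of 0] that[of 1] that[of 2] unfolding step_def by (elim disjE conjE) simp_all
  note sj = pc[OF j(1)]
  have step': "s + j = s \<and> k' = k \<and> i' = i + 1 \<or>
       s + j = s + 1 \<and> k' = k - 1 \<and> i = len s k - 1 \<and> i' = 0 \<or>
       s + j = s \<and> k' = k + 1 \<and> (i' = i \<or> i' = i + 1) \<or>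
       s + j = s + 1 \<and> k' = k \<and> i = len s k - 1 \<and> (i' = 0 \<or> k = m \<and> i' = -1) \<or>
       s + j = s + 2 \<and> k' = k - 1 \<and> idx s k i = t - 1 \<and> idx (s + j) k' i' = t - 1 \<or>
       tips \<and> s + j = s + 2 \<and> k' = k \<and> idx s k i = t - 1 \<and> idx (s + j) k' i' = t - 1"
    using j(2) unfolding sj[THEN conjunct2, THEN conjunct2] by (elim disjE conjE) simp_all
  show ?thesis
  proof (intro exI conjI)
    show "b \<in> blocks" "valid s k i" by fact+
    show "valid (s + j) k' i'" using sj by blast
    show "v = pos b s k i \<and> w = pos b (s + j) k' i' \<or> w = pos b s k i \<and> v = pos b (s + j) k' i'"
      using vw sj by simp
  qed (rule step')
qed

sublocale spiral_blocks G t m h glue tips len T extra blocks neighbour pos K valid idx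
  by unfold_locales
    (fact K_def valid_def idx_def h tips m glue periodic[unfolded K_def] neighbour_pos_mod[unfolded K_def]
      T_0 T_step len extra bar_length tile_length late_start neighbour_blocks pverts_G[unfolded valid_def]
      pos_eq_cases[unfolded valid_def K_def] pos_bar[unfolded valid_def] pos_along[unfolded valid_def]
      pos_turn[unfolded valid_def] linked_classify[unfolded valid_def idx_def])+

end

section \<open>Square spirals\<close>

text \<open>
  Layer \<open>k\<close> is the boundary of the square \<open>[-k, k - 1] \<times> [-k, k - 1]\<close>, traversed clockwise from the
  upper right corner; each of the four sides owns its first corner and has \<open>2 k - 1\<close> cells.
\<close>
definition sq_side :: "int \<Rightarrow> int \<Rightarrow> int \<Rightarrow> int \<times> int" where
  "sq_side r k i = (if r = 0 then (k - 1, k - 1 - i)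
    else if r = 1 then (k - 1 - i, - k)
    else if r = 2 then (- k, i - k)
    else (i - k, k - 1))"

text \<open>
  The two blocks overlap in one column (or row) of the squares and are shifted against each other
  by \<open>1\<close> along it, so that a bar has \<open>2 m - 1\<close> cells and each end of it is free to turn inwards.
\<close>
definition sq_delta :: "int \<Rightarrow> int \<Rightarrow> int \<times> int" where
  "sq_delta m r = (if r = 0 then (2 * m - 1, 1)
    else if r = 1 then (1, 1 - 2 * m)
    else if r = 2 then (1 - 2 * m, -1)
    else (-1, 2 * m - 1))"

abbreviation sq_cell :: "int \<Rightarrow> int \<Rightarrow> int \<Rightarrow> int \<times> int" where
  "sq_cell s \<equiv> sq_side (s mod 4)"

abbreviation sq_shift :: "int \<Rightarrow> int \<Rightarrow> int \<times> int" where
  "sq_shift m s \<equiv> sq_delta m (s mod 4)"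

text \<open>
  Generated by \<open>\<delta>\<^sub>0 = (2 m - 1, 1)\<close> and \<open>\<delta>\<^sub>1 = (1, 1 - 2 m)\<close>.
\<close>
definition sq_lattice :: "int \<Rightarrow> (int \<times> int) set" where
  "sq_lattice m = {(a * (2 * m - 1) + b, a + b * (1 - 2 * m)) | a b. True}"

definition sq_dirs :: "(int \<times> int) set" where
  "sq_dirs = {(1, 0), (-1, 0), (0, 1), (0, -1)}"

lemma mod4_set: "s mod 4 \<in> {0, 1, 2, 3}" for s :: int
  by simp presburger

lemma mod4_step:
  fixes s s' :: int
  shows "s' mod 4 = (s + 1) mod 4 \<longleftrightarrow> s' mod 4 = s mod 4 + 1 \<or> s' mod 4 = s mod 4 - 3"
    and "s' mod 4 = (s + 2) mod 4 \<longleftrightarrow> s' mod 4 = s mod 4 + 2 \<or> s' mod 4 = s mod 4 - 2"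
proof -
  define r r' where "r = s mod 4" and "r' = s' mod 4"
  have "r \<in> {0, 1, 2, 3}" "r' \<in> {0, 1, 2, 3}" unfolding r_def r'_def by (rule mod4_set)+
  then have "r' = (r + 1) mod 4 \<longleftrightarrow> r' = r + 1 \<or> r' = r - 3" "r' = (r + 2) mod 4 \<longleftrightarrow> r' = r + 2 \<or> r' = r - 2"
    by (elim insertE emptyE; simp)+
  moreover have "(r + 1) mod 4 = (s + 1) mod 4" "(r + 2) mod 4 = (s + 2) mod 4"
    unfolding r_def by (rule mod_add_left_eq)+
  ultimately show "s' mod 4 = (s + 1) mod 4 \<longleftrightarrow> s' mod 4 = s mod 4 + 1 \<or> s' mod 4 = s mod 4 - 3"
    "s' mod 4 = (s + 2) mod 4 \<longleftrightarrow> s' mod 4 = s mod 4 + 2 \<or> s' mod 4 = s mod 4 - 2"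
    unfolding r_def r'_def by (simp_all only:)
qed

lemma sq_side_inject:
  assumes "0 \<le> i" "i < 2 * k - 1" "0 \<le> i'" "i' < 2 * k' - 1" "r \<in> {0, 1, 2, 3}" "r' \<in> {0, 1, 2, 3}"
    "sq_side r k i = sq_side r' k' i'"
  shows "r' = r \<and> k' = k \<and> i' = i"
  using assms by (simp add: sq_side_def split: if_splits)

text \<open>
  Two blocks at distance \<open>\<delta>\<^sub>p\<close> overlap in the bar on side \<open>p\<close> of the first, and in nothing else.
\<close>
lemma sq_side_shift:
  assumes "0 \<le> i" "i < 2 * k - 1" "0 \<le> i'" "i' < 2 * k' - 1" "k \<le> m" "k' \<le> m"
    and "p \<in> {0, 1, 2, 3}" "r \<in> {0, 1, 2, 3}" "r' \<in> {0, 1, 2, 3}"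
    and "sq_side r k i = sq_delta m p + sq_side r' k' i'"
  shows "k = m \<and> k' = m \<and> r = p \<and> (r' = r + 2 \<or> r' = r - 2) \<and> i' = 2 * m - 2 - i"
  using assms(7-9)
  by (elim insertE emptyE; insert assms(1-6,10); simp add: sq_side_def sq_delta_def)

lemma sq_region: "{sq_cell s k i | s k i. 1 \<le> k \<and> k \<le> m \<and> 0 \<le> i \<and> i < 2 * k - 1} = {-m..m - 1} \<times> {-m..m - 1}"
proof (intro equalityI subsetI)
  fix v assume "v \<in> {sq_cell s k i | s k i. 1 \<le> k \<and> k \<le> m \<and> 0 \<le> i \<and> i < 2 * k - 1}"
  then obtain s k i where "v = sq_cell s k i" "1 \<le> k" "k \<le> m" "0 \<le> i" "i < 2 * k - 1" by blast
  then show "v \<in> {-m..m - 1} \<times> {-m..m - 1}"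
    using mod4_set[of s] by (auto simp: sq_side_def)
next
  fix v assume "v \<in> {-m..m - 1} \<times> {-m..m - 1}"
  then obtain x y where v: "v = (x, y)" "- m \<le> x" "x \<le> m - 1" "- m \<le> y" "y \<le> m - 1" by auto
  have ex: "v \<in> {sq_cell s k i | s k i. 1 \<le> k \<and> k \<le> m \<and> 0 \<le> i \<and> i < 2 * k - 1}"
    if "v = sq_cell s k i" "1 \<le> k" "k \<le> m" "0 \<le> i" "i < 2 * k - 1" for s k i
    using that by blast
  consider "- x \<le> y" "y \<le> x" | "y < x" "x < - y" | "x \<le> y" "y < - x - 1" | "- y - 1 \<le> x" "x < y"
    by atomize_elim presburger
  then show "v \<in> {sq_cell s k i | s k i. 1 \<le> k \<and> k \<le> m \<and> 0 \<le> i \<and> i < 2 * k - 1}"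
  proof cases
    case 1 then show ?thesis using v by (intro ex[of 0 "x + 1" "x - y"]) (auto simp: sq_side_def)
  next
    case 2 then show ?thesis using v by (intro ex[of 1 "- y" "- y - 1 - x"]) (auto simp: sq_side_def)
  next
    case 3 then show ?thesis using v by (intro ex[of 2 "- x" "y - x"]) (auto simp: sq_side_def)
  next
    case 4 then show ?thesis using v by (intro ex[of 3 "y + 1" "x + y + 1"]) (auto simp: sq_side_def)
  qed
qed

text \<open>
  A step across one side of the square usually ends in the neighbour on this side; at the one corner
  that this neighbour does not contain, because of the shift of the blocks, the next neighbour takes
  its place.
\<close>
lemma sq_region_step:
  assumes "v \<in> {-m..m - 1} \<times> {-m..m - 1}" "d \<in> sq_dirs" "v + d \<notin> {-m..m - 1} \<times> {-m..m - 1}" "2 \<le> m"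
  shows "\<exists>s. v - sq_shift m s \<in> {-m..m - 1} \<times> {-m..m - 1} \<and> v + d - sq_shift m s \<in> {-m..m - 1} \<times> {-m..m - 1}"
proof -
  obtain x y where v: "v = (x, y)" "- m \<le> x" "x \<le> m - 1" "- m \<le> y" "y \<le> m - 1" using assms(1) by auto
  have ex: ?thesis if "v - sq_shift m s \<in> {-m..m - 1} \<times> {-m..m - 1}"
    "v + d - sq_shift m s \<in> {-m..m - 1} \<times> {-m..m - 1}" for s
    using that by (intro exI[of _ s]) simp
  consider "d = (1, 0)" "x = m - 1" | "d = (-1, 0)" "x = - m" | "d = (0, 1)" "y = m - 1" | "d = (0, -1)" "y = - m"
    using assms(2) unfolding sq_dirs_def by (elim insertE emptyE) (use v assms(3) in auto)
  then show ?thesis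
  proof cases
    case 1
    then show ?thesis
      using v assms(4) ex[of 0] ex[of 1] by (cases "y = - m") (simp_all add: sq_delta_def)
  next
    case 2
    then show ?thesis
      using v assms(4) ex[of 2] ex[of 3] by (cases "y = m - 1") (simp_all add: sq_delta_def)
  next
    case 3
    then show ?thesis
      using v assms(4) ex[of 3] ex[of 0] by (cases "x = m - 1") (simp_all add: sq_delta_def)
  next
    case 4
    then show ?thesis
      using v assms(4) ex[of 1] ex[of 2] by (cases "x = - m") (simp_all add: sq_delta_def)
  qed
qed

text \<open>
  The generators are orthogonal vectors of length \<open>\<surd>(w\<^sup>2 + 1)\<close>, and the vector in question has squared
  length at most \<open>2 w\<^sup>2\<close>.
\<close>
lemma sq_lattice_short:
  fixes a b w :: int
  assumes "\<bar>a * w + b\<bar> \<le> w" "\<bar>a - b * w\<bar> \<le> w" "0 < w"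
  shows "(a, b) \<in> {(0, 0), (1, 0), (-1, 0), (0, 1), (0, -1)}"
proof -
  have "(a * w + b)\<^sup>2 \<le> w\<^sup>2" "(a - b * w)\<^sup>2 \<le> w\<^sup>2"
    using assms by (simp_all add: abs_le_square_iff[symmetric])
  then have "(a\<^sup>2 + b\<^sup>2) * (w\<^sup>2 + 1) \<le> 2 * w\<^sup>2" by (simp add: power2_eq_square algebra_simps)
  also have "\<dots> < 2 * (w\<^sup>2 + 1)" by simp
  finally have "a\<^sup>2 + b\<^sup>2 < 2" using mult_less_cancel_right[of "a\<^sup>2 + b\<^sup>2" "w\<^sup>2 + 1" 2] by (smt (verit) zero_le_power2)
  have sq: "z\<^sup>2 < 2 \<Longrightarrow> z = 0 \<or> z = 1 \<or> z = -1" for z :: int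
    using abs_le_square_iff[of 2 z] by (cases "\<bar>z\<bar> < 2") auto
  have "a\<^sup>2 < 2" "b\<^sup>2 < 2"
    using \<open>a\<^sup>2 + b\<^sup>2 < 2\<close> zero_le_power2[of a] zero_le_power2[of b] by linarith+
  then have "a = 0 \<or> a = 1 \<or> a = -1" "b = 0 \<or> b = 1 \<or> b = -1" using sq by blast+
  then show ?thesis using \<open>a\<^sup>2 + b\<^sup>2 < 2\<close> by auto
qed

lemma sq_side_classify:
  assumes "0 \<le> i" "i < 2 * k - 1" "0 \<le> i'" "i' < 2 * k' - 1" and r: "r \<in> {0, 1, 2, 3}" "r' \<in> {0, 1, 2, 3}"
    and d: "sq_side r' k' i' - sq_side r k i \<in> sq_dirs"
  shows "(r' = r \<and> k' = k \<and> i' = i + 1 \<or>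
       (r' = r + 1 \<or> r' = r - 3) \<and> k' = k - 1 \<and> i = 2 * k - 2 \<and> i' = 0 \<or>
       r' = r \<and> k' = k + 1 \<and> i' = i + 1 \<or>
       (r' = r + 1 \<or> r' = r - 3) \<and> k' = k \<and> i = 2 * k - 2 \<and> i' = 0) \<or>
      (r = r' \<and> k = k' \<and> i = i' + 1 \<or>
       (r = r' + 1 \<or> r = r' - 3) \<and> k = k' - 1 \<and> i' = 2 * k' - 2 \<and> i = 0 \<or>
       r = r' \<and> k = k' + 1 \<and> i = i' + 1 \<or>
       (r = r' + 1 \<or> r = r' - 3) \<and> k = k' \<and> i' = 2 * k' - 2 \<and> i = 0)"
  using r d[unfolded sq_dirs_def]
  by (elim insertE emptyE; insert assms(1-4); simp add: sq_side_def; presburger)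

lemma dvd_small: "(N :: int) dvd x \<Longrightarrow> \<bar>x\<bar> < N \<or> N = 0 \<Longrightarrow> x = 0"
  using dvd_imp_le_int[of x N] by (cases "x = 0") auto

lemma sq_delta_in_lattice: "sq_shift m s \<in> sq_lattice m"
proof -
  have "sq_shift m s = (a * (2 * m - 1) + b, a + b * (1 - 2 * m)) \<Longrightarrow> ?thesis" for a b
    unfolding sq_lattice_def by blast
  from this[of 1 0] this[of 0 1] this[of "-1" 0] this[of 0 "-1"] show ?thesis
    using mod4_set[of s] by (auto simp: sq_delta_def)
qed

lemma sq_lattice_shift:
  assumes v: "v \<in> sq_lattice m" and m: "1 \<le> m" and "\<bar>fst v\<bar> \<le> 2 * m - 1" "\<bar>snd v\<bar> \<le> 2 * m - 1"
  shows "v = 0 \<or> (\<exists>p\<in>{0, 1, 2, 3}. v = sq_delta m p)"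
proof -
  obtain a b where ab: "v = (a * (2 * m - 1) + b, a + b * (1 - 2 * m))"
    using v unfolding sq_lattice_def by blast
  have "(a, b) \<in> {(0, 0), (1, 0), (-1, 0), (0, 1), (0, -1)}"
    using assms ab by (intro sq_lattice_short[of a "2 * m - 1" b]) (auto simp: algebra_simps)
  then show ?thesis unfolding ab by (auto simp: sq_delta_def zero_prod_def)
qed

lemma sq_side_box:
  assumes "r \<in> {0, 1, 2, 3}" "k \<le> m" "0 \<le> i" "i < 2 * k - 1" "sq_side r k i = (x, y)"
  shows "- m \<le> x" "x \<le> m - 1" "- m \<le> y" "y \<le> m - 1"
  using assms by (auto simp: sq_side_def split: if_splits)

lemma sq_delta_opposite:
  assumes "r \<in> {0, 1, 2, 3}" "r' \<in> {0, 1, 2, 3}" "r' = r + 2 \<or> r' = r - 2"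
  shows "sq_delta m r' = - sq_delta m r"
  using assms(1,2) by (elim insertE emptyE; insert assms(3); simp add: sq_delta_def)

lemma sq_delta_nonzero:
  assumes "r \<in> {0, 1, 2, 3}" "1 \<le> m"
  shows "sq_delta m r \<noteq> 0" "\<bar>fst (sq_delta m r)\<bar> \<le> 2 * m" "\<bar>snd (sq_delta m r)\<bar> \<le> 2 * m"
  using assms(1) by (elim insertE emptyE; insert assms(2); simp add: sq_delta_def zero_prod_def)+

lemma sq_delta_consecutive:
  assumes "r \<in> {0, 1, 2, 3}" "r' \<in> {0, 1, 2, 3}" "r' = r + 1 \<or> r' = r - 3" "2 \<le> m"
  shows "sq_delta m r - sq_delta m r' \<noteq> 0"
    "\<bar>fst (sq_delta m r - sq_delta m r')\<bar> \<le> 2 * m" "\<bar>snd (sq_delta m r - sq_delta m r')\<bar> \<le> 2 * m"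
  using assms(1,2) by (elim insertE emptyE; insert assms(3,4); simp add: sq_delta_def zero_prod_def)+

lemma sq_side_along:
  assumes "r \<in> {0, 1, 2, 3}"
  shows "sq_side r k (i + 1) - sq_side r k i \<in> sq_dirs"
  using assms by (elim insertE emptyE; simp add: sq_side_def sq_dirs_def)

lemma sq_side_turn:
  assumes "r \<in> {0, 1, 2, 3}" "r' \<in> {0, 1, 2, 3}" "r' = r + 1 \<or> r' = r - 3"
  shows "sq_side r' (k - 1) 0 - sq_side r k (2 * k - 2) \<in> sq_dirs"
  using assms(1,2) by (elim insertE emptyE; insert assms(3); simp add: sq_side_def sq_dirs_def)

lemma sq_side_bar:
  assumes "r \<in> {0, 1, 2, 3}" "r' \<in> {0, 1, 2, 3}" "r' = r + 2 \<or> r' = r - 2"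
  shows "sq_side r m i = sq_delta m r + sq_side r' m (2 * m - 2 - i)"
  using assms(1,2) by (elim insertE emptyE; insert assms(3); simp add: sq_side_def sq_delta_def)

text \<open>
  The strand from layer \<open>k\<close> has \<open>(2 k - 1) + (2 k - 3) + \<dots> + 1 = k\<^sup>2\<close> cells, so a tile has
  \<open>2 m\<^sup>2 - (2 m - 1)\<close> cells.
\<close>
lemma lattice_spiral_square:
  assumes m: "2 \<le> m" and t: "t = 2 * m\<^sup>2 - 2 * m + 1" and N: "N = 0 \<or> N = 2 * t"
  shows "lattice_spiral N t m 2 (2 * m - 2) False (\<lambda>s k. 2 * k - 1) (\<lambda>s k. k\<^sup>2) (\<lambda>s. 0)
    (sq_lattice m) sq_dirs (sq_shift m) sq_cell"
proof -
  have large: "2 * m < 2 * t"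
  proof -
    have "2 * m \<le> m\<^sup>2" unfolding power2_eq_square using m by (intro mult_right_mono) auto
    then show ?thesis using m t by linarith
  qed
  have small: "x = 0" if "N dvd x" "\<bar>x\<bar> \<le> 2 * m" for x
    using dvd_small[OF that(1)] that(2) N large by auto
  \<comment> \<open>a torus is wider than a block, which has width \<open>2 m\<close>\<close>
  have red0: "red N v = 0 \<Longrightarrow> \<bar>fst v\<bar> \<le> 2 * m \<Longrightarrow> \<bar>snd v\<bar> \<le> 2 * m \<Longrightarrow> v = 0" for v
    using small[of "fst v"] small[of "snd v"] by (auto simp: red_def zero_prod_def prod_eq_iff)
  have mod22: "z mod (2 * 2) = z mod 4" for z :: int by simp
  show ?thesis
  \<comment> \<open>the case numbers follow the order of the assumptions of \<open>lattice_spiral\<close>; simplification settles the cases that are left out\<close>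
  proof (unfold_locales, unfold mod22, goal_cases)
    \<comment> \<open>\<open>T_step\<close>\<close>
    case (11 k s)
    then show ?case by (simp add: power2_eq_square algebra_simps)
  next
    \<comment> \<open>\<open>extra\<close>\<close>
    case (16 s)
    have "0 \<le> (m - 1)\<^sup>2" by simp
    then show ?case unfolding t by (simp add: power2_eq_square algebra_simps)
  next
    \<comment> \<open>\<open>lattice\<close>\<close>
    case (20 v w)
    then obtain a b a' b' where "v = (a * (2 * m - 1) + b, a + b * (1 - 2 * m))"
      "w = (a' * (2 * m - 1) + b', a' + b' * (1 - 2 * m))" unfolding sq_lattice_def by blast
    then have "v + w = ((a + a') * (2 * m - 1) + (b + b'), (a + a') + (b + b') * (1 - 2 * m))"
      by (simp add: algebra_simps)
    then show ?case unfolding sq_lattice_def by blast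
  next
    case (21 v)
    then obtain a b where "v = (a * (2 * m - 1) + b, a + b * (1 - 2 * m))" unfolding sq_lattice_def by blast
    then have "- v = ((- a) * (2 * m - 1) + (- b), (- a) + (- b) * (1 - 2 * m))" by (simp add: algebra_simps)
    then show ?case unfolding sq_lattice_def by blast
  next
    case (22 a b)
    define q where "q = (if N = 0 then 0 else 1 :: int)"
    have Nq: "N = q * ((2 * m - 1)\<^sup>2 + 1)"
      using N unfolding q_def t by (auto simp: power2_eq_square algebra_simps)
    \<comment> \<open>the first coordinate vector of length \<open>2 t\<close> is \<open>(2 m - 1) \<delta>\<^sub>0 + \<delta>\<^sub>1\<close>, the second \<open>\<delta>\<^sub>0 - (2 m - 1) \<delta>\<^sub>1\<close>\<close>
    have "(N * a, N * b) = ((q * (a * (2 * m - 1) + b)) * (2 * m - 1) + q * (a - b * (2 * m - 1)),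
        q * (a * (2 * m - 1) + b) + (q * (a - b * (2 * m - 1))) * (1 - 2 * m))"
      unfolding Nq by (simp add: power2_eq_square algebra_simps)
    then show ?case unfolding sq_lattice_def by blast
  next
    \<comment> \<open>\<open>\<delta>\<close>\<close>
    case (23 s)
    show ?case by (rule sq_delta_in_lattice)
  next
    case (24 s)
    have "(s + 2) mod 4 = s mod 4 + 2 \<or> (s + 2) mod 4 = s mod 4 - 2" using mod4_step(2)[of "s + 2" s] by blast
    then show ?case by (rule sq_delta_opposite[OF mod4_set mod4_set])
  next
    \<comment> \<open>\<open>\<delta>_distinct\<close>\<close>
    case (25 s)
    show ?case using red0[of "sq_shift m s"] sq_delta_nonzero[OF mod4_set[of s], of m] m by linarith
  next
    case (26 s)
    have "(s + 1) mod 4 = s mod 4 + 1 \<or> (s + 1) mod 4 = s mod 4 - 3" using mod4_step(1)[of "s + 1" s] by blast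
    note * = sq_delta_consecutive[OF mod4_set mod4_set this m]
    show ?case using red0[OF _ *(2,3)] *(1) by blast
  next
    \<comment> \<open>\<open>c_inj\<close>\<close>
    case (31 v s k i s' k' i')
    then have *: "0 \<le> i" "i < 2 * k - 1" "k \<le> m" "0 \<le> i'" "i' < 2 * k' - 1" "k' \<le> m" by auto
    obtain x y x' y' where xy: "sq_cell s k i = (x, y)" "sq_cell s' k' i' = (x', y')" by (meson prod.exhaust)
    have v: "v = (x - x', y - y')" using 31(4) unfolding xy by (cases v) simp
    have "\<bar>fst v\<bar> \<le> 2 * m - 1" "\<bar>snd v\<bar> \<le> 2 * m - 1"
      using sq_side_box[OF mod4_set *(3,1,2) xy(1)] sq_side_box[OF mod4_set *(6,4,5) xy(2)]
      unfolding v fst_conv snd_conv by linarith+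
    moreover have "1 \<le> m" using m by simp
    ultimately consider "v = 0" | p where "p \<in> {0, 1, 2, 3}" "v = sq_delta m p"
      using sq_lattice_shift[OF 31(1)] by meson
    then show ?case
    proof cases
      case 1
      then show ?thesis using sq_side_inject[OF *(1,2,4,5) mod4_set mod4_set, of s s'] 31(4) by simp
    next
      case 2
      have "sq_cell s k i = sq_delta m p + sq_cell s' k' i'" using 31(4) 2(2) by simp
      from sq_side_shift[OF *(1,2,4,5,3,6) 2(1) mod4_set mod4_set this] show ?thesis
        using 2(2) unfolding mod4_step by blast
    qed
  next
    \<comment> \<open>\<open>c_bar\<close>\<close>
    case (32 s i)
    have "(s + 2) mod 4 = s mod 4 + 2 \<or> (s + 2) mod 4 = s mod 4 - 2" using mod4_step(2)[of "s + 2" s] by blast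
    then show ?case by (rule sq_side_bar[OF mod4_set mod4_set])
  next
    \<comment> \<open>\<open>c_along\<close>\<close>
    case (33 s k i)
    show ?case by (rule sq_side_along[OF mod4_set])
  next
    \<comment> \<open>\<open>c_turn\<close>\<close>
    case (34 s k)
    have "(s + 1) mod 4 = s mod 4 + 1 \<or> (s + 1) mod 4 = s mod 4 - 3" using mod4_step(1)[of "s + 1" s] by blast
    from sq_side_turn[OF mod4_set mod4_set this] show ?case by simp
  next
    \<comment> \<open>\<open>c_classify\<close>\<close>
    case (35 s k i s' k' i')
    then have *: "0 \<le> i" "i < 2 * k - 1" "0 \<le> i'" "i' < 2 * k' - 1" by auto
    from sq_side_classify[OF * mod4_set mod4_set 35(3)] show ?case
      unfolding mod4_step by auto
  next
    \<comment> \<open>\<open>region_step\<close>\<close>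
    case (36 v d)
    have reg: "{sq_cell s k i | s k i. 1 \<le> k \<and> k \<le> m \<and> i < 2 * k - 1 \<and> (0 \<le> i \<or> k = m \<and> - 0 \<le> i)}
      = {-m..m - 1} \<times> {-m..m - 1}"
      unfolding sq_region[symmetric] by auto
    show ?case using 36 sq_region_step[of v m d] m unfolding reg by blast
  qed (use m in \<open>auto simp: t sq_dirs_def\<close>)
qed

section \<open>Hexagonal spirals\<close>

text \<open>
  In a hexagonal block the sides of layer \<open>k\<close> have alternately \<open>k - 1\<close> and \<open>k\<close> cells, and a short side
  faces a long side of the neighbouring block. A short bar is therefore prolonged by one cell.
\<close>
definition tri_extra :: "int \<Rightarrow> int" where
  "tri_extra s = (if even s then 1 else 0)"

definition tri_len :: "int \<Rightarrow> int \<Rightarrow> int" where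
  "tri_len s k = k - tri_extra s"

text \<open>
  The sums \<open>(k - 1) + (k - 1) + (k - 3) + (k - 3) + \<dots>\<close> and \<open>k + (k - 2) + (k - 2) + \<dots>\<close>.
\<close>
definition tri_total :: "int \<Rightarrow> int \<Rightarrow> int" where
  "tri_total s k = (k\<^sup>2 + 1 - tri_extra s) div 2"

text \<open>
  Layer \<open>1\<close> is the triangle \<open>(1, 0)\<close>, \<open>(0, 0)\<close>, \<open>(0, -1)\<close>, and layer \<open>k\<close> is the \<open>k\<close>-th ring in the
  triangular lattice around it.
\<close>
definition tri_side :: "int \<Rightarrow> int \<Rightarrow> int \<Rightarrow> int \<times> int" where
  "tri_side r k i = (if r = 0 then (k, i)
    else if r = 1 then (k - i, k - 1)
    else if r = 2 then (- i, k - 1 - i)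
    else if r = 3 then (1 - k, - i)
    else if r = 4 then (1 - k + i, - k)
    else (i, i - k))"

definition tri_delta :: "int \<Rightarrow> int \<Rightarrow> int \<times> int" where
  "tri_delta m r = (if r = 0 then (2 * m - 1, m - 2)
    else if r = 1 then (m + 1, 2 * m - 1)
    else if r = 2 then (2 - m, m + 1)
    else if r = 3 then (1 - 2 * m, 2 - m)
    else if r = 4 then (-1 - m, 1 - 2 * m)
    else (m - 2, -1 - m))"

abbreviation tri_cell :: "int \<Rightarrow> int \<Rightarrow> int \<Rightarrow> int \<times> int" where
  "tri_cell s \<equiv> tri_side (s mod 6)"

abbreviation tri_shift :: "int \<Rightarrow> int \<Rightarrow> int \<times> int" where
  "tri_shift m s \<equiv> tri_delta m (s mod 6)"

text \<open>
  Generated by \<open>\<delta>\<^sub>0 = (2 m - 1, m - 2)\<close> and \<open>\<delta>\<^sub>1 = (m + 1, 2 m - 1)\<close>; the remaining neighbours are at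
  \<open>\<delta>\<^sub>1 - \<delta>\<^sub>0\<close> and at the opposite vectors.
\<close>
definition tri_lattice :: "int \<Rightarrow> (int \<times> int) set" where
  "tri_lattice m = {(a * (2 * m - 1) + b * (m + 1), a * (m - 2) + b * (2 * m - 1)) | a b. True}"

definition tri_dirs :: "(int \<times> int) set" where
  "tri_dirs = {(1, 0), (-1, 0), (0, 1), (0, -1), (1, 1), (-1, -1)}"

definition tri_valid :: "int \<Rightarrow> int \<Rightarrow> int \<Rightarrow> int \<Rightarrow> bool" where
  "tri_valid m s k i \<longleftrightarrow> 1 \<le> k \<and> k \<le> m \<and> i < tri_len s k \<and> (0 \<le> i \<or> k = m \<and> - tri_extra s \<le> i)"

text \<open>
  A hexagon whose sides have alternately \<open>m\<close> and \<open>m + 1\<close> cells, and the three cells that prolong the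
  short bars.
\<close>
definition tri_region :: "int \<Rightarrow> (int \<times> int) set" where
  "tri_region m = {(x, y). 1 - m \<le> x \<and> x \<le> m \<and> - m \<le> y \<and> y \<le> m - 1 \<and> 1 - m \<le> x - y \<and> x - y \<le> m}
    \<union> {(m, -1), (1, m), (- m, - m)}"

abbreviation residues6 :: "int set" where
  "residues6 \<equiv> {0, 1, 2, 3, 4, 5}"

lemma mod6_set: "s mod 6 \<in> residues6" for s :: int
proof -
  have "0 \<le> s mod 6" "s mod 6 < 6" by simp_all
  then show ?thesis unfolding insert_iff empty_iff by presburger
qed

lemma mod6_step:
  fixes s s' :: int
  shows "s' mod 6 = (s + 1) mod 6 \<longleftrightarrow> s' mod 6 = s mod 6 + 1 \<or> s' mod 6 = s mod 6 - 5"
    and "s' mod 6 = (s + 2) mod 6 \<longleftrightarrow> s' mod 6 = s mod 6 + 2 \<or> s' mod 6 = s mod 6 - 4"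
    and "s' mod 6 = (s + 3) mod 6 \<longleftrightarrow> s' mod 6 = s mod 6 + 3 \<or> s' mod 6 = s mod 6 - 3"
proof -
  define r r' where "r = s mod 6" and "r' = s' mod 6"
  have "r \<in> residues6" "r' \<in> residues6" unfolding r_def r'_def by (rule mod6_set)+
  then have "r' = (r + 1) mod 6 \<longleftrightarrow> r' = r + 1 \<or> r' = r - 5" "r' = (r + 2) mod 6 \<longleftrightarrow> r' = r + 2 \<or> r' = r - 4"
    "r' = (r + 3) mod 6 \<longleftrightarrow> r' = r + 3 \<or> r' = r - 3"
    by (elim insertE emptyE; simp)+
  moreover have "(r + 1) mod 6 = (s + 1) mod 6" "(r + 2) mod 6 = (s + 2) mod 6" "(r + 3) mod 6 = (s + 3) mod 6"
    unfolding r_def by (rule mod_add_left_eq)+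
  ultimately show "s' mod 6 = (s + 1) mod 6 \<longleftrightarrow> s' mod 6 = s mod 6 + 1 \<or> s' mod 6 = s mod 6 - 5"
    "s' mod 6 = (s + 2) mod 6 \<longleftrightarrow> s' mod 6 = s mod 6 + 2 \<or> s' mod 6 = s mod 6 - 4"
    "s' mod 6 = (s + 3) mod 6 \<longleftrightarrow> s' mod 6 = s mod 6 + 3 \<or> s' mod 6 = s mod 6 - 3"
    unfolding r_def r'_def by (simp_all only:)
qed

lemma tri_extra_mod [simp]: "tri_extra (s mod 6) = tri_extra s"
  unfolding tri_extra_def by (simp add: dvd_mod_iff)

lemma tri_len_mod [simp]: "tri_len (s mod 6) k = tri_len s k"
  unfolding tri_len_def by simp

lemma tri_total_mod [simp]: "tri_total (s mod 6) k = tri_total s k"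
  unfolding tri_total_def by simp

lemma tri_valid_mod [simp]: "tri_valid m (s mod 6) k i = tri_valid m s k i"
  unfolding tri_valid_def by simp

lemma tri_total_step: "tri_total s k = tri_len s k + tri_total (s + 1) (k - 1)"
proof (cases "even s")
  case True
  have "(k - 1)\<^sup>2 + 1 = k\<^sup>2 + (1 - k) * 2" by (simp add: power2_eq_square algebra_simps)
  then show ?thesis using True by (simp add: tri_total_def tri_len_def tri_extra_def)
next
  case False
  have "k\<^sup>2 + 1 = (k - 1)\<^sup>2 + k * 2" by (simp add: power2_eq_square algebra_simps)
  then show ?thesis using False by (simp add: tri_total_def tri_len_def tri_extra_def)
qed

lemma tri_total_sum: "odd j \<Longrightarrow> tri_total s k + tri_total (s + j) k = k\<^sup>2"
  unfolding tri_total_def tri_extra_def by (cases "even s"; simp; presburger)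

lemma tri_side_inject:
  assumes "r \<in> residues6" "r' \<in> residues6" "tri_valid m r k i" "tri_valid m r' k' i'"
    "tri_side r k i = tri_side r' k' i'"
  shows "r' = r \<and> k' = k \<and> i' = i"
  using assms(1,2)
  by (elim insertE emptyE; insert assms(3-5); simp add: tri_side_def tri_valid_def tri_len_def tri_extra_def; linarith?)

lemma tri_side_box:
  assumes "r \<in> residues6" "tri_valid m r k i"
  shows "- m \<le> fst (tri_side r k i)" "fst (tri_side r k i) \<le> m" "- m \<le> snd (tri_side r k i)" "snd (tri_side r k i) \<le> m"
    "1 - m \<le> fst (tri_side r k i) - snd (tri_side r k i)" "fst (tri_side r k i) - snd (tri_side r k i) \<le> m + 1"
  using assms(1)
  by (elim insertE emptyE; insert assms(2); simp add: tri_side_def tri_valid_def tri_len_def tri_extra_def; linarith?)+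

lemma tri_delta_opposite:
  assumes "r \<in> residues6" "r' \<in> residues6" "r' = r + 3 \<or> r' = r - 3"
  shows "tri_delta m r' = - tri_delta m r"
  using assms(1,2) by (elim insertE emptyE; insert assms(3); simp add: tri_delta_def)

lemma tri_delta_nonzero:
  assumes "r \<in> residues6" "3 \<le> m"
  shows "tri_delta m r \<noteq> 0"
  using assms(1) by (elim insertE emptyE; insert assms(2); simp add: tri_delta_def zero_prod_def)+

lemma tri_delta_distinct:
  assumes "r \<in> residues6" "r' \<in> residues6" "r' \<noteq> r" "3 \<le> m"
  shows "tri_delta m r \<noteq> tri_delta m r'"
  using assms(1,2) by (elim insertE emptyE; insert assms(3,4); simp add: tri_delta_def)+

lemma tri_side_along:
  assumes "r \<in> residues6"
  shows "tri_side r k (i + 1) - tri_side r k i \<in> tri_dirs"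
  using assms by (elim insertE emptyE; simp add: tri_side_def tri_dirs_def)

lemma tri_side_turn:
  assumes "r \<in> residues6" "r' \<in> residues6" "r' = r + 1 \<or> r' = r - 5"
  shows "tri_side r' (k - 1) 0 - tri_side r k (tri_len r k - 1) \<in> tri_dirs"
  using assms(1,2)
  by (elim insertE emptyE; insert assms(3); simp add: tri_side_def tri_dirs_def tri_len_def tri_extra_def)

lemma tri_side_bar:
  assumes "r \<in> residues6" "r' \<in> residues6" "r' = r + 3 \<or> r' = r - 3"
  shows "tri_side r m i = tri_delta m r + tri_side r' m (m - 2 - i)"
  using assms(1,2) by (elim insertE emptyE; insert assms(3); simp add: tri_side_def tri_delta_def)

text \<open>
  Two blocks at distance \<open>\<delta>\<^sub>p\<close> overlap in the bar on side \<open>p\<close> of the first, and in nothing else.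
\<close>
lemma tri_side_shift:
  assumes "p \<in> residues6" "r \<in> residues6" "r' \<in> residues6" "tri_valid m r k i" "tri_valid m r' k' i'" "3 \<le> m"
    "tri_side r k i = tri_delta m p + tri_side r' k' i'"
  shows "k = m \<and> k' = m \<and> r = p \<and> (r' = r + 3 \<or> r' = r - 3) \<and> i' = m - 2 - i"
  using assms(1-3)
  by (elim insertE emptyE; insert assms(4-7);
      simp add: tri_side_def tri_delta_def tri_valid_def tri_len_def tri_extra_def; linarith?)

text \<open>
  The last two kinds are edges between tips. Since even sides of layer \<open>1\<close> are empty, three of the six
  strands end in layer \<open>2\<close> and three in layer \<open>1\<close>; a tip of the former touches the next tip of the latter,
  and the latter touch each other.
\<close>
lemma tri_side_classify:
  assumes "r \<in> residues6" "r' \<in> residues6" "tri_valid m r k i" "tri_valid m r' k' i'" "3 \<le> m"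
    and d: "tri_side r' k' i' - tri_side r k i \<in> tri_dirs"
  defines "S \<equiv> \<lambda>r k i r' k' i'. r' = r \<and> k' = k \<and> i' = i + 1 \<or>
       (r' = r + 1 \<or> r' = r - 5) \<and> k' = k - 1 \<and> i = tri_len r k - 1 \<and> i' = 0 \<or>
       r' = r \<and> k' = k + 1 \<and> (i' = i \<or> i' = i + 1) \<or>
       (r' = r + 1 \<or> r' = r - 5) \<and> k' = k \<and> i = tri_len r k - 1 \<and> (i' = 0 \<or> k = m \<and> i' = -1) \<or>
       odd r \<and> (r' = r + 2 \<or> r' = r - 4) \<and> k = 2 \<and> i = 1 \<and> k' = 1 \<and> i' = 0 \<or>
       odd r \<and> (r' = r + 2 \<or> r' = r - 4) \<and> k = 1 \<and> i = 0 \<and> k' = 1 \<and> i' = 0"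
  shows "S r k i r' k' i' \<or> S r' k' i' r k i"
  using assms(1,2) d[unfolded tri_dirs_def] unfolding S_def
  by (elim insertE emptyE; insert assms(3-5);
      simp add: tri_side_def tri_valid_def tri_len_def tri_extra_def; presburger?)

lemma tri_side_region:
  assumes "r \<in> residues6" "tri_valid m r k i"
  shows "tri_side r k i \<in> tri_region m"
  using assms(1)
  by (elim insertE emptyE; insert assms(2);
      simp add: tri_side_def tri_valid_def tri_len_def tri_extra_def tri_region_def; presburger?)

lemma tri_region_covered:
  assumes v: "v \<in> tri_region m" and m: "3 \<le> m"
  shows "\<exists>s k i. tri_valid m s k i \<and> v = tri_cell s k i"
proof -
  obtain x y where xy: "v = (x, y)" by (meson prod.exhaust)
  have ex: ?thesis if "tri_valid m s k i" "v = tri_cell s k i" for s k i using that by blast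
  note defs = tri_side_def tri_valid_def tri_len_def tri_extra_def
  consider "v = (m, -1)" | "v = (1, m)" | "v = (- m, - m)"
    | "1 - m \<le> x" "x \<le> m" "- m \<le> y" "y \<le> m - 1" "1 - m \<le> x - y" "x - y \<le> m"
    using v unfolding xy tri_region_def by auto
  then show ?thesis
  proof cases
    case 1 show ?thesis by (rule ex[of 0 m "-1"]) (use 1 m in \<open>simp_all add: defs\<close>)
  next
    case 2 show ?thesis by (rule ex[of 2 m "-1"]) (use 2 m in \<open>simp_all add: defs\<close>)
  next
    case 3 show ?thesis by (rule ex[of 4 m "-1"]) (use 3 m in \<open>simp_all add: defs\<close>)
  next
    case 4
    note hex = 4
    consider "0 \<le> y" "y \<le> x - 2" | "1 \<le> x" "x \<le> y + 1" | "x \<le> 0" "1 \<le> y" | "x \<le> y" "y \<le> 0"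
      | "y < x" "x < 0" | "0 \<le> x" "y < 0"
      by linarith
    then show ?thesis
    proof cases
      case 1 show ?thesis by (rule ex[of 0 x y]) (use 1 hex xy in \<open>simp_all add: defs\<close>)
    next
      case 2 show ?thesis by (rule ex[of 1 "y + 1" "y + 1 - x"]) (use 2 hex xy in \<open>simp_all add: defs\<close>)
    next
      case 3 show ?thesis by (rule ex[of 2 "y + 1 - x" "- x"]) (use 3 hex xy in \<open>simp_all add: defs\<close>)
    next
      case 4 show ?thesis by (rule ex[of 3 "1 - x" "- y"]) (use 4 hex xy in \<open>simp_all add: defs\<close>)
    next
      case 5 show ?thesis by (rule ex[of 4 "- y" "x - 1 - y"]) (use 5 hex xy in \<open>simp_all add: defs\<close>)
    next
      case 6 show ?thesis by (rule ex[of 5 "x - y" x]) (use 6 hex xy in \<open>simp_all add: defs\<close>)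
    qed
  qed
qed

text \<open>
  In the triangular lattice \<open>x\<^sup>2 - x y + y\<^sup>2\<close> is the squared Euclidean length, called norm below; the bounds
  on \<open>x\<close>, \<open>y\<close> and \<open>x - y\<close> describe a hexagon whose corners have norm \<open>M\<^sup>2\<close>.
\<close>
lemma hex_norm_le:
  fixes x y M :: int
  assumes "\<bar>x\<bar> \<le> M" "\<bar>y\<bar> \<le> M" "\<bar>x - y\<bar> \<le> M"
  shows "x\<^sup>2 - x * y + y\<^sup>2 \<le> M\<^sup>2"
proof -
  have sq: "x\<^sup>2 \<le> M\<^sup>2" "y\<^sup>2 \<le> M\<^sup>2" "(x - y)\<^sup>2 \<le> M\<^sup>2"
    using assms by (simp_all add: abs_le_square_iff[symmetric])
  have le: "z\<^sup>2 \<le> w * z" if "0 \<le> w * z" "\<bar>z\<bar> \<le> \<bar>w\<bar>" for w z :: int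
    using mult_right_mono[OF that(2) abs_ge_zero[of z]] that(1) by (simp add: power2_eq_square abs_mult[symmetric])
  consider "x * y \<le> 0" | "0 \<le> x * y" "\<bar>y\<bar> \<le> \<bar>x\<bar>" | "0 \<le> x * y" "\<bar>x\<bar> \<le> \<bar>y\<bar>" by linarith
  then show ?thesis
  proof cases
    case 1 then show ?thesis using sq(3) by (simp add: power2_eq_square algebra_simps)
  next
    case 2 then show ?thesis using sq(1) le[of x y] by simp
  next
    case 3 then show ?thesis using sq(2) le[of y x] by (simp add: mult.commute)
  qed
qed

text \<open>
  The generators have norm \<open>3 m\<^sup>2 - 3 m + 3\<close> and form an angle of 60 degrees, so the vector with
  coordinates \<open>a\<close>, \<open>b\<close> has the norm of a generator times \<open>a\<^sup>2 + a b + b\<^sup>2\<close>. Differences of cells of a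
  block are too short for any values of this form but \<open>0\<close> and \<open>1\<close>, which belong to the origin and
  the six neighbours.
\<close>
lemma tri_lattice_shift:
  assumes v: "v \<in> tri_lattice m" and m: "3 \<le> m"
    and short: "\<bar>fst v\<bar> \<le> 2 * m" "\<bar>snd v\<bar> \<le> 2 * m" "\<bar>fst v - snd v\<bar> \<le> 2 * m"
  shows "v = 0 \<or> (\<exists>p\<in>residues6. v = tri_delta m p)"
proof -
  obtain a b where ab: "v = (a * (2 * m - 1) + b * (m + 1), a * (m - 2) + b * (2 * m - 1))"
    using v unfolding tri_lattice_def by blast
  have "(a\<^sup>2 + a * b + b\<^sup>2) * (3 * m\<^sup>2 - 3 * m + 3) = (fst v)\<^sup>2 - fst v * snd v + (snd v)\<^sup>2"
    unfolding ab by (simp add: power2_eq_square algebra_simps)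
  also have "\<dots> \<le> (2 * m)\<^sup>2" by (rule hex_norm_le[OF short])
  also have "\<dots> < 3 * (3 * m\<^sup>2 - 3 * m + 3)"
  proof -
    have "3 * m \<le> m\<^sup>2" unfolding power2_eq_square using m by (intro mult_right_mono) auto
    moreover have "4 * q < 3 * (3 * q - 3 * m + 3)" if "3 * m \<le> q" for q using that m by simp
    ultimately show ?thesis by simp
  qed
  finally have "(a\<^sup>2 + a * b + b\<^sup>2) * (3 * m\<^sup>2 - 3 * m + 3) < 3 * (3 * m\<^sup>2 - 3 * m + 3)" .
  moreover have "0 \<le> 3 * m\<^sup>2 - 3 * m + 3"
    using zero_le_power2[of "m - 1"] m by (simp add: power2_eq_square algebra_simps)
  ultimately have small: "a\<^sup>2 + a * b + b\<^sup>2 < 3" by (rule mult_right_less_imp_less)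
  then have "(2 * a + b)\<^sup>2 + 3 * b\<^sup>2 < 12" "(2 * b + a)\<^sup>2 + 3 * a\<^sup>2 < 12"
    by (simp_all add: power2_eq_square algebra_simps)
  moreover have "z = 0 \<or> z = 1 \<or> z = -1" if "w\<^sup>2 + 3 * z\<^sup>2 < 12" for w z :: int
  proof -
    have "\<not> 2\<^sup>2 \<le> z\<^sup>2" using that zero_le_power2[of w] unfolding power2_eq_square[of 2] by linarith
    then have "\<bar>z\<bar> < 2" using abs_le_square_iff[of 2 z] by auto
    then show ?thesis by auto
  qed
  ultimately have "a = 0 \<or> a = 1 \<or> a = -1" "b = 0 \<or> b = 1 \<or> b = -1" by blast+
  then show ?thesis using small unfolding ab
    by (elim disjE) (simp_all add: tri_delta_def zero_prod_def)
qed

lemma tri_side_inner: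
  assumes "r \<in> residues6" "tri_valid m r k i" "k < m" "d \<in> tri_dirs"
  shows "tri_side r k i + d \<in> tri_region m"
  using assms(1) assms(4)[unfolded tri_dirs_def]
  by (elim insertE emptyE; insert assms(2,3);
      simp add: tri_side_def tri_valid_def tri_len_def tri_extra_def tri_region_def; linarith?)

text \<open>
  A step that leaves the block from the bar on side \<open>r\<close> ends in the neighbour on this very side; hence the
  prolonged bars have to be counted as parts of the block.
\<close>
lemma tri_side_outer:
  assumes "r \<in> residues6" "tri_valid m r m i" "3 \<le> m" "d \<in> tri_dirs" "tri_side r m i + d \<notin> tri_region m"
  shows "tri_side r m i + d - tri_delta m r \<in> tri_region m"
  using assms(1) assms(4)[unfolded tri_dirs_def]
  by (elim insertE emptyE; insert assms(2,3,5);
      simp add: tri_side_def tri_delta_def tri_valid_def tri_len_def tri_extra_def tri_region_def; presburger?)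

lemma tri_delta_in_lattice:
  assumes "r \<in> residues6"
  shows "tri_delta m r \<in> tri_lattice m"
proof -
  have in_lattice: "tri_delta m r \<in> tri_lattice m"
    if "tri_delta m r = (a * (2 * m - 1) + b * (m + 1), a * (m - 2) + b * (2 * m - 1))" for a b
    using that unfolding tri_lattice_def by blast
  show ?thesis using assms
  proof (elim insertE emptyE)
    assume "r = 0" then show ?thesis by (intro in_lattice[of 1 0]) (simp add: tri_delta_def)
  next
    assume "r = 1" then show ?thesis by (intro in_lattice[of 0 1]) (simp add: tri_delta_def)
  next
    assume "r = 2" then show ?thesis by (intro in_lattice[of "-1" 1]) (simp add: tri_delta_def)
  next
    assume "r = 3" then show ?thesis by (intro in_lattice[of "-1" 0]) (simp add: tri_delta_def)
  next
    assume "r = 4" then show ?thesis by (intro in_lattice[of 0 "-1"]) (simp add: tri_delta_def)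
  next
    assume "r = 5" then show ?thesis by (intro in_lattice[of 1 "-1"]) (simp add: tri_delta_def)
  qed
qed

text \<open>
  The two strands of a tile have together \<open>m\<^sup>2\<close> cells, of which the \<open>m - 1\<close> cells between the two
  turns are counted twice.
\<close>
lemma lattice_spiral_triangular:
  assumes m: "3 \<le> m" and t: "t = m\<^sup>2 - m + 1"
  shows "lattice_spiral 0 t m 3 (m - 2) True tri_len tri_total tri_extra (tri_lattice m) tri_dirs (tri_shift m) tri_cell"
proof -
  have red0: "red 0 v = v" for v by (simp add: red_def)
  have m_sq: "3 * m \<le> m\<^sup>2" unfolding power2_eq_square using m by (intro mult_right_mono) auto
  have mod23: "2 * 3 = (6 :: int)" by simp
  have valid: "1 \<le> k \<and> k \<le> m \<and> i < tri_len s k \<and> (0 \<le> i \<or> k = m \<and> - tri_extra s \<le> i) \<longleftrightarrow>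
    tri_valid m (s mod 6) k i" for s k i
    by (simp add: tri_valid_def)
  have len_m: "tri_len (s + 3) m = m - 1 + tri_extra s" for s by (simp add: tri_len_def tri_extra_def)
  have step3: "(s + 3) mod 6 = s mod 6 + 3 \<or> (s + 3) mod 6 = s mod 6 - 3" for s :: int using mod6_step(3)[of "s + 3" s] by blast
  have step1: "(s + 1) mod 6 = s mod 6 + 1 \<or> (s + 1) mod 6 = s mod 6 - 5" for s :: int using mod6_step(1)[of "s + 1" s] by blast
  have step2: "(s + 2) mod 6 = s mod 6 + 2 \<or> (s + 2) mod 6 = s mod 6 - 4" for s :: int using mod6_step(2)[of "s + 2" s] by blast
  show ?thesis
  \<comment> \<open>the case numbers follow the order of the assumptions of \<open>lattice_spiral\<close>; simplification settles the cases that are left out\<close>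
  proof (unfold_locales, unfold mod23 valid, goal_cases)
    \<comment> \<open>\<open>T_0\<close>\<close>
    case (10 s)
    then show ?case by (simp add: tri_total_def tri_extra_def)
  next
    \<comment> \<open>\<open>T_step\<close>\<close>
    case (11 k s)
    show ?case by (rule tri_total_step)
  next
    \<comment> \<open>\<open>extra\<close>\<close>
    case (16 s)
    show ?case using m m_sq unfolding t tri_total_def tri_extra_def by auto
  next
    \<comment> \<open>\<open>bar_length\<close>\<close>
    case (17 s)
    show ?case by (simp add: len_m)
  next
    \<comment> \<open>\<open>tile_length\<close>\<close>
    case (18 s)
    show ?case using tri_total_sum[of 3 s m] unfolding t by simp
  next
    \<comment> \<open>\<open>late_start\<close>\<close>
    case (19 s)
    show ?case using tri_total_sum[of 1 s m] unfolding t by (simp add: tri_len_def tri_extra_def)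
  next
    \<comment> \<open>\<open>lattice\<close>\<close>
    case (20 v w)
    then obtain a b a' b' where "v = (a * (2 * m - 1) + b * (m + 1), a * (m - 2) + b * (2 * m - 1))"
      "w = (a' * (2 * m - 1) + b' * (m + 1), a' * (m - 2) + b' * (2 * m - 1))" unfolding tri_lattice_def by blast
    then have "v + w = ((a + a') * (2 * m - 1) + (b + b') * (m + 1), (a + a') * (m - 2) + (b + b') * (2 * m - 1))"
      by (simp add: algebra_simps)
    then show ?case unfolding tri_lattice_def by blast
  next
    case (21 v)
    then obtain a b where "v = (a * (2 * m - 1) + b * (m + 1), a * (m - 2) + b * (2 * m - 1))"
      unfolding tri_lattice_def by blast
    then have "- v = ((- a) * (2 * m - 1) + (- b) * (m + 1), (- a) * (m - 2) + (- b) * (2 * m - 1))"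
      by (simp add: algebra_simps)
    then show ?case unfolding tri_lattice_def by blast
  next
    case (22 a b)
    have "(0 * a, 0 * b) = (0 * (2 * m - 1) + 0 * (m + 1), 0 * (m - 2) + 0 * (2 * m - 1))" by simp
    then show ?case unfolding tri_lattice_def by blast
  next
    \<comment> \<open>\<open>\<delta>\<close>\<close>
    case (23 s)
    show ?case by (rule tri_delta_in_lattice[OF mod6_set])
  next
    case (24 s)
    show ?case by (rule tri_delta_opposite[OF mod6_set mod6_set step3])
  next
    \<comment> \<open>\<open>\<delta>_distinct\<close>\<close>
    case (25 s)
    show ?case unfolding red0 by (rule tri_delta_nonzero[OF mod6_set m])
  next
    case (26 s)
    have "(s + 1) mod 6 \<noteq> s mod 6" using step1[of s] by linarith
    from tri_delta_distinct[OF mod6_set mod6_set this m] show ?case unfolding red0 by simp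
  next
    case (27 s)
    have "(s + 2) mod 6 \<noteq> s mod 6" using step2[of s] by linarith
    from tri_delta_distinct[OF mod6_set mod6_set this m] show ?case unfolding red0 by simp
  next
    \<comment> \<open>\<open>c_inj\<close>\<close>
    case (31 v s k i s' k' i')
    note box = tri_side_box[OF mod6_set 31(2)] tri_side_box[OF mod6_set 31(3)]
    have v: "v = tri_cell s k i - tri_cell s' k' i'" using 31(4) by (simp add: algebra_simps)
    have "\<bar>fst v\<bar> \<le> 2 * m" "\<bar>snd v\<bar> \<le> 2 * m" "\<bar>fst v - snd v\<bar> \<le> 2 * m"
      using box unfolding v fst_diff snd_diff by linarith+
    then consider "v = 0" | p where "p \<in> residues6" "v = tri_delta m p"
      using tri_lattice_shift[OF 31(1) m] by meson
    then show ?case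
    proof cases
      case 1
      have "tri_cell s k i = tri_cell s' k' i'" using 31(4) 1 by simp
      from tri_side_inject[OF mod6_set mod6_set 31(2,3) this] show ?thesis using 1 by simp
    next
      case 2
      have "tri_cell s k i = tri_delta m p + tri_cell s' k' i'" using 31(4) 2(2) by simp
      from tri_side_shift[OF 2(1) mod6_set mod6_set 31(2,3) m this] show ?thesis
        using 2(2) unfolding mod6_step by blast
    qed
  next
    \<comment> \<open>\<open>c_bar\<close>\<close>
    case (32 s i)
    show ?case by (rule tri_side_bar[OF mod6_set mod6_set step3])
  next
    \<comment> \<open>\<open>c_along\<close>\<close>
    case (33 s k i)
    show ?case by (rule tri_side_along[OF mod6_set])
  next
    \<comment> \<open>\<open>c_turn\<close>\<close>
    case (34 s k)
    from tri_side_turn[OF mod6_set mod6_set step1] show ?case by simp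
  next
    \<comment> \<open>\<open>c_classify\<close>\<close>
    case (35 s k i s' k' i')
    have tip: "tri_total s 1 = 1 \<and> tri_total s 2 = 2 \<and> tri_total s' 1 = 1"
      if "odd (s mod 6)" "s' mod 6 = (s + 2) mod 6" for s s' :: int
    proof -
      have "odd s" "odd s'" using that by presburger+
      then show ?thesis by (simp add: tri_total_def tri_extra_def)
    qed
    from tri_side_classify[OF mod6_set mod6_set 35(1,2) m 35(3)] show ?case
      unfolding mod6_step[symmetric] tri_len_mod
      by (elim disjE conjE) (use tip[of s s'] tip[of s' s] in simp_all)
  next
    \<comment> \<open>\<open>region_step\<close>\<close>
    case (36 v d)
    have reg: "{tri_cell s k i | s k i. tri_valid m (s mod 6) k i} = tri_region m"
    proof (intro equalityI subsetI)
      fix v assume "v \<in> {tri_cell s k i | s k i. tri_valid m (s mod 6) k i}"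
      then obtain s k i where "tri_valid m (s mod 6) k i" "v = tri_cell s k i" by blast
      then show "v \<in> tri_region m" using tri_side_region[OF mod6_set] by simp
    next
      fix v assume "v \<in> tri_region m"
      from tri_region_covered[OF this m] show "v \<in> {tri_cell s k i | s k i. tri_valid m (s mod 6) k i}"
        by simp blast
    qed
    obtain s k i where ski: "tri_valid m (s mod 6) k i" "v = tri_cell s k i"
      using 36(1) by blast
    have v: "v \<in> tri_region m" "v + d \<notin> tri_region m" using 36 unfolding reg by simp_all
    have "k \<le> m" using ski(1) unfolding tri_valid_def by simp
    moreover have "\<not> k < m" using tri_side_inner[OF mod6_set ski(1) _ 36(2)] v(2) unfolding ski(2) by blast
    ultimately have k: "k = m" by simp
    have "v - tri_shift m s = tri_cell (s + 3) m (m - 2 - i)"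
      using tri_side_bar[OF mod6_set mod6_set step3[of s], of m i] unfolding ski(2) k by simp
    moreover have "tri_valid m ((s + 3) mod 6) m (m - 2 - i)"
      using ski(1) m len_m[of s] len_m[of "s + 3"] unfolding k tri_valid_mod by (auto simp: tri_valid_def tri_len_def tri_extra_def)
    ultimately have "v - tri_shift m s \<in> tri_region m" using tri_side_region[OF mod6_set] by simp
    moreover have "v + d - tri_shift m s \<in> tri_region m"
      using tri_side_outer[OF mod6_set _ m 36(2)] ski(1) v(2) unfolding ski(2) k by blast
    ultimately show ?case unfolding reg by blast
  qed (use m in \<open>auto simp: tri_dirs_def tri_len_def tri_extra_def dvd_mod_iff\<close>)
qed

section \<open>The three graphs and their row tilings\<close>

text \<open>
  The interval of the subdivision of a row into intervals of length \<open>t\<close> that contains \<open>v\<close>.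
\<close>
definition row_piece :: "int \<Rightarrow> int \<times> int \<Rightarrow> (int \<times> int) set" where
  "row_piece t v = (\<lambda>i. (t * (fst v div t) + i, snd v)) ` {0..<t}"

lemma mem_row_piece: "0 < t \<Longrightarrow> w \<in> row_piece t v \<longleftrightarrow> fst w div t = fst v div t \<and> snd w = snd v"
proof
  assume t: "0 < t" and "w \<in> row_piece t v"
  then obtain i where "w = (t * (fst v div t) + i, snd v)" "0 \<le> i" "i < t" unfolding row_piece_def by auto
  then show "fst w div t = fst v div t \<and> snd w = snd v" using t by simp
next
  assume t: "0 < t" and w: "fst w div t = fst v div t \<and> snd w = snd v"
  have "w = (t * (fst v div t) + fst w mod t, snd v)"
    using w mult_div_mod_eq[of t "fst w"] by (simp add: prod_eq_iff)
  then show "w \<in> row_piece t v" using t unfolding row_piece_def by (intro image_eqI[of _ _ "fst w mod t"]) auto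
qed

lemma red_fixed_iff: "0 \<le> N \<Longrightarrow> red N v = v \<longleftrightarrow> N = 0 \<or> 0 \<le> fst v \<and> fst v < N \<and> 0 \<le> snd v \<and> snd v < N"
proof -
  assume "0 \<le> N"
  have "x mod N = x \<longleftrightarrow> N = 0 \<or> 0 \<le> x \<and> x < N" for x
  proof (cases "N = 0")
    case False
    then have "0 \<le> x mod N" "x mod N < N" using \<open>0 \<le> N\<close> by simp_all
    then show ?thesis using False mod_pos_pos_trivial[of x N] by auto
  qed simp
  then show ?thesis unfolding red_def prod_eq_iff by auto
qed

lemma omino_tiling_rows:
  assumes t: "0 < t" and N: "0 \<le> N" "t dvd N" and D: "(1, 0) \<in> D"
  shows "omino_tiling (translation_graph N D) (nat t) (row_piece t ` pverts (translation_graph N D))"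
proof -
  define V where "V = pverts (translation_graph N D)"
  have V: "v \<in> V \<longleftrightarrow> red N v = v" for v unfolding V_def translation_graph_def by simp
  have self: "v \<in> row_piece t v" for v using mem_row_piece[OF t] by simp
  have sub: "row_piece t v \<subseteq> V" if v: "v \<in> V" for v
  proof
    fix w assume "w \<in> row_piece t v"
    then have w: "fst w div t = fst v div t" "snd w = snd v" using mem_row_piece[OF t] by auto
    obtain q where q: "N = t * q" using N(2) by (rule dvdE)
    have "x < N \<longleftrightarrow> x div t < q" for x
    proof
      assume x: "x < N"
      show "x div t < q"
      proof (rule ccontr)
        assume "\<not> x div t < q"
        then have "N \<le> t * (x div t)" unfolding q using t by (intro mult_left_mono) auto
        then show False using x mult_div_mod_eq[of t x] pos_mod_sign[OF t, of x] by linarith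
      qed
    next
      assume "x div t < q"
      then have "t * (x div t + 1) \<le> N" unfolding q using t by (intro mult_left_mono) auto
      then have "t * (x div t) + t \<le> N" by (simp add: distrib_left)
      then show "x < N" using mult_div_mod_eq[of t x] pos_mod_bound[OF t, of x] by linarith
    qed
    moreover have "0 \<le> x \<longleftrightarrow> 0 \<le> x div t" for x using pos_imp_zdiv_nonneg_iff[OF t] by simp
    ultimately have bounds: "0 \<le> x \<longleftrightarrow> 0 \<le> x div t" "x < N \<longleftrightarrow> x div t < q" for x by blast+
    show "w \<in> V" using v unfolding V red_fixed_iff[OF N(1)] bounds[of "fst w"] bounds[of "fst v"] w .
  qed
  have "partition_on V (row_piece t ` V)"
    unfolding partition_on_def disjoint_def
  proof (intro conjI ballI impI)
    show "\<Union> (row_piece t ` V) = V" using sub self by blast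
    show "{} \<notin> row_piece t ` V" using self by blast
    fix A B assume "A \<in> row_piece t ` V" "B \<in> row_piece t ` V" "A \<noteq> B"
    then obtain v w where vw: "A = row_piece t v" "B = row_piece t w" by blast
    have "A = B" if "u \<in> A" "u \<in> B" for u
      using that unfolding vw by (auto simp: mem_row_piece[OF t])
    then show "A \<inter> B = {}" using \<open>A \<noteq> B\<close> by blast
  qed
  moreover have "finite (row_piece t v) \<and> card (row_piece t v) = nat t \<and>
      Digraph_Component.connected (with_proj (translation_graph N D) \<restriction> row_piece t v)" if v: "v \<in> V" for v
  proof (intro conjI)
    show "finite (row_piece t v)" unfolding row_piece_def by simp
    show "card (row_piece t v) = nat t"
      unfolding row_piece_def by (subst card_image) (auto simp: inj_on_def)
    show "Digraph_Component.connected (with_proj (translation_graph N D) \<restriction> row_piece t v)"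
      unfolding row_piece_def
    proof (rule connected_path[OF t])
      fix i assume i: "0 \<le> i" "i + 1 < t"
      have in_V: "(t * (fst v div t) + j, snd v) \<in> V" if "0 \<le> j" "j < t" for j
        using sub[OF v] that unfolding row_piece_def by auto
      have "red N (t * (fst v div t) + i, snd v) = (t * (fst v div t) + i, snd v)"
        "red N (t * (fst v div t) + (i + 1), snd v) = (t * (fst v div t) + (i + 1), snd v)"
        using in_V[of i] in_V[of "i + 1"] i unfolding V by simp_all
      then show "linked (translation_graph N D) (t * (fst v div t) + i, snd v) (t * (fst v div t) + (i + 1), snd v)"
        using D unfolding linked_def translation_graph_def by (auto intro!: bexI[of _ "(1, 0)"] simp: add.assoc)
    qed
  qed
  ultimately show ?thesis unfolding omino_tiling_def V_def by blast
qed

context lattice_spiral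
begin

text \<open>
  The bar on side \<open>0\<close> runs across the rows.
\<close>
lemma two_rows:
  assumes "2 \<le> len 0 m" "\<not> N dvd snd (c 0 m 1) - snd (c 0 m 0)"
  shows "\<exists>A\<in>tile ` ends. \<exists>v\<in>A. \<exists>w\<in>A. snd v \<noteq> snd w"
proof -
  define b where "b = red N 0"
  have b: "b \<in> blocks" unfolding b_def by (rule red_blocks[OF L_0])
  have valid: "valid 0 m 0" "valid 0 m 1" using assms(1) m unfolding valid_def by auto
  have "(b, 0) \<in> ends" using b h unfolding K_def by simp
  moreover have "pos b 0 m i \<in> tile (b, 0)" if "valid 0 m i" for i
    using pos_path_end[OF b that] idx_range[OF that] unfolding tile_def by simp
  moreover have "snd (pos b 0 m 1) \<noteq> snd (pos b 0 m 0)"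
    using assms(2) unfolding pos_def red_def b_def by (simp add: mod_eq_dvd_iff)
  ultimately show ?thesis using valid by blast
qed

text \<open>
  The tiles are not all contained in single rows, so the row tiling is a different vertex of the
  metagraph.
\<close>
theorem locked:
  assumes "0 \<le> N" "t dvd N" "2 \<le> len 0 m" "\<not> N dvd snd (c 0 m 1) - snd (c 0 m 0)"
  shows "\<exists>P. locked_tiling (translation_graph N D) (nat t) P"
proof -
  let ?rows = "row_piece t ` pverts G"
  have "?rows \<in> pverts (metagraph G (nat t))"
    using omino_tiling_rows[OF t_pos assms(1,2) D(1)] unfolding G_def metagraph_def by simp
  moreover have "?rows \<noteq> tile ` ends"
  proof
    assume eq: "?rows = tile ` ends"
    have "snd v = snd w" if "A \<in> ?rows" "v \<in> A" "w \<in> A" for A v w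
      using that mem_row_piece[OF t_pos] by (elim imageE) simp
    then show False using two_rows[OF assms(3,4)] unfolding eq by blast
  qed
  ultimately have "locked_tiling G (nat t) (tile ` ends)" using isolated unfolding locked_tiling_def by blast
  then show ?thesis unfolding G_def by blast
qed

end

lemma red_zero: "red 0 v = v"
  by (simp add: red_def)

lemma unit_distance_iff:
  fixes x y x' y' :: int
  shows "\<bar>x - x'\<bar> + \<bar>y - y'\<bar> = 1 \<longleftrightarrow>
    x' = x \<and> (y' = y + 1 \<or> y' = y - 1) \<or> y' = y \<and> (x' = x + 1 \<or> x' = x - 1)"
  by arith

lemma square_lattice_translation: "square_lattice = translation_graph 0 sq_dirs"
proof -
  have *: "\<bar>x - x'\<bar> + \<bar>y - y'\<bar> = 1 \<longleftrightarrow> (\<exists>d\<in>sq_dirs. (x', y') = (x, y) + d)" for x y x' y' :: int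
    unfolding unit_distance_iff sq_dirs_def by auto
  show ?thesis
    unfolding square_lattice_def translation_graph_def * by (simp add: red_zero case_prod_unfold)
qed

lemma triangular_lattice_translation: "triangular_lattice = translation_graph 0 tri_dirs"
proof -
  have dirs: "tri_dirs = sq_dirs \<union> {(1, 1), (-1, -1)}" unfolding tri_dirs_def sq_dirs_def by auto
  have "{((x, y), (x + 1, y + 1)) | x y. True} = {(v, v + (1, 1)) | v :: int \<times> int. True}"
    "{((x + 1, y + 1), (x, y)) | x y. True} = {(v, v + (-1, -1)) | v :: int \<times> int. True}"
    by force+
  then show ?thesis
    unfolding triangular_lattice_def square_lattice_translation
    by (auto simp: translation_graph_def red_zero dirs)
qed

text \<open>
  On a cycle the two neighbours differ by \<open>1\<close> or are joined by the wrapping edge.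
\<close>
lemma cyclic_neighbour_iff:
  fixes x x' N :: int
  assumes "3 \<le> N" "0 \<le> x" "x < N"
  shows "x' = (x + 1) mod N \<or> x' = (x + -1) mod N \<longleftrightarrow>
    0 \<le> x' \<and> x' < N \<and> (x' = x + 1 \<or> x' = x - 1 \<or> x = 0 \<and> x' = N - 1 \<or> x' = 0 \<and> x = N - 1)"
proof -
  have inc: "(x + 1) mod N = (if x = N - 1 then 0 else x + 1)" using assms by auto
  have dec: "(x + -1) mod N = (if x = 0 then N - 1 else x - 1)" using assms by (auto simp: zmod_minus1)
  show ?thesis unfolding inc dec using assms by (cases "x = 0"; cases "x = N - 1") auto
qed

lemma torus_graph_translation:
  assumes "3 \<le> a"
  shows "torus_graph a a = translation_graph (int a) sq_dirs"
proof -
  define N where "N = int a"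
  have N: "3 \<le> N" using assms unfolding N_def by simp
  define V where "V = {0..<N} \<times> {0..<N}"
  have mem_V: "(x, y) \<in> V \<longleftrightarrow> 0 \<le> x \<and> x < N \<and> 0 \<le> y \<and> y < N" for x y
    unfolding V_def by auto
  have fixed: "red N v = v \<longleftrightarrow> v \<in> V" for v
    using red_fixed_iff[of N v] N mem_V[of "fst v" "snd v"] by simp
  have wrap: "((x, y), (x', y')) \<in> wrap_pairs a a \<longleftrightarrow>
      x' = x \<and> 0 \<le> x \<and> x < N \<and> y = 0 \<and> y' = N - 1 \<or>
      y' = y \<and> 0 \<le> y \<and> y < N \<and> x = 0 \<and> x' = N - 1" for x y x' y'
    unfolding wrap_pairs_def N_def by blast
  have arc: "((x, y), (x', y')) \<in> parcs (torus_graph a a) \<longleftrightarrow>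
      (x, y) \<in> V \<and> (\<exists>d\<in>sq_dirs. (x', y') = red N ((x, y) + d))" for x y x' y'
  proof -
    have trans: "(\<exists>d\<in>sq_dirs. (x', y') = red N ((x, y) + d)) \<longleftrightarrow>
      y' = y mod N \<and> (x' = (x + 1) mod N \<or> x' = (x + -1) mod N) \<or>
      x' = x mod N \<and> (y' = (y + 1) mod N \<or> y' = (y + -1) mod N)"
      unfolding sq_dirs_def red_def by auto
    have torus: "((x, y), (x', y')) \<in> parcs (torus_graph a a) \<longleftrightarrow>
      (x, y) \<in> V \<and> (x', y') \<in> V \<and> \<bar>x - x'\<bar> + \<bar>y - y'\<bar> = 1 \<or>
      (x, y) \<noteq> (x', y') \<and>
        (((x, y), (x', y')) \<in> wrap_pairs a a \<or> ((x', y'), (x, y)) \<in> wrap_pairs a a)"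
      unfolding torus_graph_def grid_graph_def square_lattice_def V_def N_def Let_def by auto
    show ?thesis
    proof (cases "(x, y) \<in> V")
      case True
      then have b: "0 \<le> x" "x < N" "0 \<le> y" "y < N" unfolding mem_V by auto
      have eq: "x mod N = x" "y mod N = y" using b by simp_all
      have ne: "0 \<noteq> N - 1" "N - 1 \<noteq> 0" "0 \<le> N - 1" "N - 1 < N" "0 < N" "(0 :: int) \<le> 0" using N by simp_all
      show ?thesis
        unfolding trans torus eq wrap mem_V unit_distance_iff
          cyclic_neighbour_iff[OF N b(1,2)] cyclic_neighbour_iff[OF N b(3,4)]
        using b ne unfolding prod.inject by (intro iffI; elim disjE conjE; simp)
    next
      case False
      have "(x, y) \<in> V" if "((x, y), (x', y')) \<in> wrap_pairs a a \<or> ((x', y'), (x, y)) \<in> wrap_pairs a a"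
        using that N unfolding wrap mem_V by auto
      then show ?thesis using False unfolding torus by blast
    qed
  qed
  have "parcs (torus_graph a a) = {(v, w). red N v = v \<and> (\<exists>d\<in>sq_dirs. w = red N (v + d))}"
    unfolding fixed
  proof (intro set_eqI)
    fix p show "p \<in> parcs (torus_graph a a) \<longleftrightarrow> p \<in> {(v, w). v \<in> V \<and> (\<exists>d\<in>sq_dirs. w = red N (v + d))}"
      using arc[of "fst (fst p)" "snd (fst p)" "fst (snd p)" "snd (snd p)"] by (simp add: case_prod_unfold)
  qed
  moreover have "pverts (torus_graph a a) = {v. red N v = v}"
    unfolding fixed by (auto simp: torus_graph_def grid_graph_def V_def N_def Let_def)
  ultimately show ?thesis unfolding translation_graph_def N_def by simp
qed

theorem theorem5p1:
  fixes n :: nat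
  assumes "n \<ge> 1"
  shows "(\<exists>P. locked_tiling
            (torus_graph (2 * (2 * n^2 + 2 * n + 1)) (2 * (2 * n^2 + 2 * n + 1)))
            (2 * n^2 + 2 * n + 1) P)
       \<and> (\<exists>P. locked_tiling square_lattice (2 * n^2 + 2 * n + 1) P)
       \<and> (\<exists>P. locked_tiling triangular_lattice ((n + 1) * (n + 2) + 1) P)"
proof -
  define m where "m = int n + 1"
  define t where "t = 2 * n^2 + 2 * n + 1"
  have m: "2 \<le> m" using assms unfolding m_def by simp
  have t_pos: "2 \<le> t" using assms unfolding t_def by simp
  have t: "int t = 2 * m\<^sup>2 - 2 * m + 1" unfolding t_def m_def by (simp add: power2_eq_square algebra_simps)
  have square: "\<exists>P. locked_tiling (translation_graph N sq_dirs) t P" if N: "N = 0 \<or> N = 2 * int t" for N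
  proof -
    have "\<not> N dvd -1" using N t_pos by auto
    moreover have "0 \<le> N" "int t dvd N" using N by auto
    ultimately show ?thesis
      using lattice_spiral.locked[OF lattice_spiral_square[OF m t N]] m by (simp add: sq_side_def)
  qed
  have "\<exists>P. locked_tiling (torus_graph (2 * t) (2 * t)) t P"
    using square[of "int (2 * t)"] torus_graph_translation[of "2 * t"] t_pos by simp
  moreover have "\<exists>P. locked_tiling square_lattice t P"
    using square[of 0] unfolding square_lattice_translation by simp
  moreover have "\<exists>P. locked_tiling triangular_lattice ((n + 1) * (n + 2) + 1) P"
  proof -
    have m: "3 \<le> int n + 2" using assms by simp
    have t: "int ((n + 1) * (n + 2) + 1) = (int n + 2)\<^sup>2 - (int n + 2) + 1"
      by (simp add: power2_eq_square algebra_simps)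
    show ?thesis
      using lattice_spiral.locked[OF lattice_spiral_triangular[OF m t]] assms
      unfolding triangular_lattice_translation nat_int by (simp add: tri_side_def tri_len_def tri_extra_def)
  qed
  ultimately show ?thesis unfolding t_def by blast
qed

end
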